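(* Let $a\in\mathbb{R}\setminus\{0\}$ and consider the weight matrix (density with respect to Lebesgue measure) $$W_a(t)=e^{-t^2}\begin{pmatrix}1+a^2t^2 & at \\ at & 1\end{pmatrix},\quad t\in\mathbb{R},$$ and the second order differential operator $$D_a=\partial^2\begin{pmatrix}1-at & -1+a^2t^2 \\ -1 & 1+at\end{pmatrix}+\partial^1\begin{pmatrix}-2a-2t & 2a+2(2+a^2)t \\ 0 & -2t\end{pmatrix}+\partial^0\begin{pmatrix}-1 & 2\frac{2+a^2}{a^2} \\ \frac{4}{a^2} & 1\end{pmatrix}.$$ Then the set $\Upsilon(D_a)$ of all $2\times2$ weight matrices with respect to which $D_a$ is symmetric is $$\Upsilon(D_a)=\left\{\gamma W_a+\zeta\,\delta_0\begin{pmatrix}1 & 1 \\ 1 & 1\end{pmatrix}:\ \gamma>0,\ \zeta\ge0\right\}.$$ Moreover, for all $\gamma>0$ and $\zeta\ge0$, the sequence $(P_{n,a,\zeta/\gamma})_n$ of monic matrix polynomials orthogonal with respect to $\gamma W_a+\zeta\delta_0\begin{pmatrix}1 & 1 \\ 1 & 1\end{pmatrix}$ satisfies $$P_{n,a,\zeta/\gamma}D_a=\Gamma_{n,a}P_{n,a,\zeta/\gamma},\quad n=0,1,\ldots,\qquad \Gamma_{n,a}=\begin{pmatrix}-(2n+1) & \frac{(2+na^2)(2+(n+1)a^2)}{a^2} \\ \frac{4}{a^2} & -2n+1\end{pmatrix}.$$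
   Context: A weight matrix $W$ is an $N\times N$ matrix of measures supported in the real line such that: $W(\Omega)$ is positive semidefinite for every Borel set $\Omega\subset\mathbb{R}$; for every $n\in\mathbb{N}$ the moment $\mu_n=\int t^n\,dW(t)$ exists and is finite; and $\int P(t)\,dW(t)\,P^*(t)$ is nonsingular whenever $P$ is an $N\times N$ matrix polynomial with nonsingular leading coefficient. Here $P^*(t)$ is the conjugate transpose of $P(t)$; in this statement $N=2$. A density $W(t)$ is identified with the matrix of measures $W(t)\,dt$. An operator $D=\partial^2F_2(t)+\partial^1F_1(t)+\partial^0F_0$, $\partial=\frac{d}{dt}$, acts on the right on matrix polynomials: $PD=P''(t)F_2(t)+P'(t)F_1(t)+P(t)F_0$. It is symmetric with respect to $W$ if $\int(PD)\,dW\,Q^*=\int P\,dW\,(QD)^*$ for all matrix polynomials $P,Q$. We write $\Upsilon(D)$ for the set of all weight matrices with respect to which $D$ is symmetric. The monic orthogonal polynomials $(P_n)_n$ with respect to $W$ are the matrix polynomials with $\deg P_n=n$, leading coefficient the identity, and $\int P_n\,dW\,P_m^*=0$ for $n\ne m$. $\delta_0$ is the Dirac measure at $0$. *)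

theory Defs
  imports
    "HOL-Probability.Probability"
    "HOL-Computational_Algebra.Polynomial"
begin

section \<open>Integration against a complex measure\<close>

text \<open>A finite real or complex measure is a countably additive set function on the Borel sets of
  the real line. Set functions are required to vanish outside the Borel sets, as \<^const>\<open>emeasure\<close>
  does, so that equality of set functions is equality of measures.\<close>

definition complex_measure :: "(real set \<Rightarrow> complex) \<Rightarrow> bool" where
  "complex_measure \<nu> \<longleftrightarrow>
     (\<forall>\<Omega>. \<Omega> \<notin> sets borel \<longrightarrow> \<nu> \<Omega> = 0) \<and>
     (\<forall>A :: nat \<Rightarrow> real set. range A \<subseteq> sets borel \<longrightarrow> disjoint_family A \<longrightarrow>
        (\<lambda>n. \<nu> (A n)) sums \<nu> (\<Union>n. A n))"

text \<open>The positive part in the Jordan decomposition of a signed measure; the negative part is the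
  positive part of its negation. The empty set makes the supremum the right one even though
  \<^const>\<open>ennreal\<close> truncates negative numbers to zero.\<close>

definition jordan_pos :: "(real set \<Rightarrow> real) \<Rightarrow> real measure" where
  "jordan_pos \<nu> = measure_of UNIV (sets borel)
     (\<lambda>\<Omega>. SUP B \<in> {B \<in> sets borel. B \<subseteq> \<Omega>}. ennreal (\<nu> B))"

definition jordan_neg :: "(real set \<Rightarrow> real) \<Rightarrow> real measure" where
  "jordan_neg \<nu> = jordan_pos (\<lambda>\<Omega>. - \<nu> \<Omega>)"

definition cm_integrable :: "(real set \<Rightarrow> complex) \<Rightarrow> (real \<Rightarrow> complex) \<Rightarrow> bool" where
  "cm_integrable \<nu> f \<longleftrightarrow>
     integrable (jordan_pos (\<lambda>\<Omega>. Re (\<nu> \<Omega>))) f \<and> integrable (jordan_neg (\<lambda>\<Omega>. Re (\<nu> \<Omega>))) f \<and>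
     integrable (jordan_pos (\<lambda>\<Omega>. Im (\<nu> \<Omega>))) f \<and> integrable (jordan_neg (\<lambda>\<Omega>. Im (\<nu> \<Omega>))) f"

definition cm_integral :: "(real set \<Rightarrow> complex) \<Rightarrow> (real \<Rightarrow> complex) \<Rightarrow> complex" where
  "cm_integral \<nu> f =
     ((LINT t|jordan_pos (\<lambda>\<Omega>. Re (\<nu> \<Omega>)). f t) - (LINT t|jordan_neg (\<lambda>\<Omega>. Re (\<nu> \<Omega>)). f t)) +
     \<i> * ((LINT t|jordan_pos (\<lambda>\<Omega>. Im (\<nu> \<Omega>)). f t) - (LINT t|jordan_neg (\<lambda>\<Omega>. Im (\<nu> \<Omega>)). f t))"


section \<open>Matrix polynomials\<close>

text \<open>A matrix polynomial is a matrix of polynomials, so that \<open>**\<close> is its product. (The type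
  \<open>(complex^'n^'n) poly\<close> would multiply coefficients entrywise.)\<close>

type_synonym 'n matpoly = "((complex poly, 'n) vec, 'n) vec"

definition mp_coeff :: "'n::finite matpoly \<Rightarrow> nat \<Rightarrow> complex^'n^'n" where
  "mp_coeff P k = map_matrix (\<lambda>p. coeff p k) P"

definition mp_degree :: "'n::finite matpoly \<Rightarrow> nat" where
  "mp_degree P = Max (range (\<lambda>(i, j). degree (P $ i $ j)))"

definition mp_lead_coeff :: "'n::finite matpoly \<Rightarrow> complex^'n^'n" where
  "mp_lead_coeff P = mp_coeff P (mp_degree P)"

definition mp_const :: "complex^'n^'n \<Rightarrow> 'n::finite matpoly" where
  "mp_const M = map_matrix (\<lambda>c. [:c:]) M"

definition mp_deriv :: "'n::finite matpoly \<Rightarrow> 'n matpoly" where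
  "mp_deriv P = map_matrix pderiv P"


section \<open>Weight matrices\<close>

type_synonym 'n mat_setfun = "real set \<Rightarrow> ((complex, 'n) vec, 'n) vec"

definition entry :: "'n::finite mat_setfun \<Rightarrow> 'n \<Rightarrow> 'n \<Rightarrow> real set \<Rightarrow> complex" where
  "entry W i j = (\<lambda>\<Omega>. W \<Omega> $ i $ j)"

text \<open>\<open>mint W P Q\<close> is the matrix \<open>\<integral> P dW Q\<^sup>*\<close>.\<close>

definition mint :: "'n::finite mat_setfun \<Rightarrow> 'n matpoly \<Rightarrow> 'n matpoly \<Rightarrow> complex^'n^'n" where
  "mint W P Q = (\<chi> i j. \<Sum>k\<in>UNIV. \<Sum>l\<in>UNIV.
     cm_integral (entry W k l)
       (\<lambda>t. poly (P $ i $ k) (of_real t) * cnj (poly (Q $ j $ l) (of_real t))))"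

definition pos_semidef :: "complex^'n^'n::finite \<Rightarrow> bool" where
  "pos_semidef M \<longleftrightarrow>
     (\<forall>i j. M $ i $ j = cnj (M $ j $ i)) \<and>
     (\<forall>v :: complex^'n. 0 \<le> Re (\<Sum>i\<in>UNIV. \<Sum>j\<in>UNIV. cnj (v $ i) * M $ i $ j * v $ j))"

definition weight_matrix :: "'n::finite mat_setfun \<Rightarrow> bool" where
  "weight_matrix W \<longleftrightarrow>
     (\<forall>i j. complex_measure (entry W i j)) \<and>
     (\<forall>\<Omega> \<in> sets borel. pos_semidef (W \<Omega>)) \<and>
     (\<forall>n i j. cm_integrable (entry W i j) (\<lambda>t. of_real (t ^ n))) \<and>
     (\<forall>P. invertible (mp_lead_coeff P) \<longrightarrow> invertible (mint W P P))"

definition density_matrix :: "(real \<Rightarrow> complex^'n^'n) \<Rightarrow> 'n::finite mat_setfun" where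
  "density_matrix w = (\<lambda>\<Omega>. if \<Omega> \<in> sets borel
     then \<chi> i j. LINT t:\<Omega>|lborel. w t $ i $ j else 0)"

text \<open>The Dirac measure at \<open>x\<close> times the matrix \<open>M\<close>.\<close>

definition dirac_matrix :: "real \<Rightarrow> complex^'n^'n \<Rightarrow> 'n::finite mat_setfun" where
  "dirac_matrix x M = (\<lambda>\<Omega>. measure (return borel x) \<Omega> *\<^sub>R M)"

definition monic_orthogonal :: "'n::finite mat_setfun \<Rightarrow> (nat \<Rightarrow> 'n matpoly) \<Rightarrow> bool" where
  "monic_orthogonal W P \<longleftrightarrow>
     (\<forall>n. mp_degree (P n) = n \<and> mp_lead_coeff (P n) = mat 1) \<and>
     (\<forall>n m. n \<noteq> m \<longrightarrow> mint W (P n) (P m) = 0)"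


section \<open>Differential operators acting on the right\<close>

definition diffop2 ::
  "'n::finite matpoly \<Rightarrow> 'n matpoly \<Rightarrow> complex^'n^'n \<Rightarrow> 'n matpoly \<Rightarrow> 'n matpoly" where
  "diffop2 F2 F1 F0 P =
     mp_deriv (mp_deriv P) ** F2 + mp_deriv P ** F1 + P ** mp_const F0"

definition symmetric_wrt :: "('n::finite matpoly \<Rightarrow> 'n matpoly) \<Rightarrow> 'n mat_setfun \<Rightarrow> bool" where
  "symmetric_wrt D W \<longleftrightarrow> (\<forall>P Q. mint W (D P) Q = mint W P (D Q))"

definition Upsilon :: "('n::finite matpoly \<Rightarrow> 'n matpoly) \<Rightarrow> 'n mat_setfun set" where
  "Upsilon D = {W. weight_matrix W \<and> symmetric_wrt D W}"


section \<open>The example\<close>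

definition mat22 :: "'a \<Rightarrow> 'a \<Rightarrow> 'a \<Rightarrow> 'a \<Rightarrow> 'a::zero^2^2" where
  "mat22 a b c d = vector [vector [a, b], vector [c, d]]"

definition Wa :: "real \<Rightarrow> 2 mat_setfun" where
  "Wa a = density_matrix (\<lambda>t. exp (- t\<^sup>2) *\<^sub>R
     mat22 (of_real (1 + a\<^sup>2 * t\<^sup>2)) (of_real (a * t))
           (of_real (a * t)) 1)"

definition Da :: "real \<Rightarrow> 2 matpoly \<Rightarrow> 2 matpoly" where
  "Da a = diffop2
     (mat22 [:1, of_real (- a):] [:- 1, 0, of_real (a\<^sup>2):]
            [:- 1:] [:1, of_real a:])
     (mat22 [:of_real (- 2 * a), - 2:] [:of_real (2 * a), of_real (2 * (2 + a\<^sup>2)):]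
            0 [:0, - 2:])
     (mat22 (- 1) (of_real (2 * ((2 + a\<^sup>2) / a\<^sup>2)))
            (of_real (4 / a\<^sup>2)) 1)"

definition Wa_dirac :: "real \<Rightarrow> real \<Rightarrow> real \<Rightarrow> 2 mat_setfun" where
  "Wa_dirac a \<gamma> \<zeta> = (\<lambda>\<Omega>. \<gamma> *\<^sub>R Wa a \<Omega> + \<zeta> *\<^sub>R dirac_matrix 0 (mat22 1 1 1 1) \<Omega>)"

definition Gamma_na :: "nat \<Rightarrow> real \<Rightarrow> complex^2^2" where
  "Gamma_na n a =
     mat22 (of_real (- (2 * real n + 1)))
           (of_real ((2 + real n * a\<^sup>2) * (2 + (real n + 1) * a\<^sup>2) / a\<^sup>2))
           (of_real (4 / a\<^sup>2))
           (of_real (- 2 * real n + 1))"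

end

theory Submission
  imports Defs
begin

text \<open>The argument runs through the moment functionals \<open>p \<mapsto> \<integral> p dW\<^sub>i\<^sub>j\<close> of a weight matrix. Let
  \<open>L = (L\<^sub>i\<^sub>j)\<close> be these functionals, and let \<open>F\<^sub>2, F\<^sub>1, F\<^sub>0\<close> be the coefficients of \<open>D\<^sub>a\<close>.

  If \<open>D\<^sub>a\<close> is symmetric with respect to \<open>W\<close>, then its first and second commutators with multiplication by
  \<open>t\<close>, which have the orders one and zero, satisfy symmetry relations too (\<open>first_commutator\<close>,
  \<open>second_commutator\<close>). The second one says \<open>F\<^sub>2L = LF\<^sub>2\<^sup>*\<close>, whence \<open>L\<^sub>2\<^sub>1 = L\<^sub>1\<^sub>2\<close> and
  \<open>L\<^sub>1\<^sub>1 = 2at L\<^sub>1\<^sub>2 + (1 - a\<^sup>2t\<^sup>2) L\<^sub>2\<^sub>2\<close>. Put \<open>U = L\<^sub>1\<^sub>2 - at L\<^sub>2\<^sub>2\<close>. The first one gives \<open>t U = 0\<close>, so that \<open>U\<close> is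
  a multiple \<open>c\<close> of evaluation at \<open>0\<close>, and \<open>L\<^sub>2\<^sub>2(p') - U(p') = 2 L\<^sub>2\<^sub>2(t p)\<close>. The functional
  \<open>p \<mapsto> \<integral> p(t) exp(-t\<^sup>2) dt\<close> is characterized up to a factor by \<open>L(p') = 2 L(t p)\<close>, so
  \<open>L\<^sub>2\<^sub>2 = g exp(-t\<^sup>2) + c \<delta>\<^sub>0\<close>, and all moments of \<open>W\<close> are those of \<open>g W\<^sub>a + c \<delta>\<^sub>0 J\<close>, where \<open>J\<close> is the
  matrix of ones (\<open>symmetric_moments\<close>). The constants are real because \<open>W\<close> is Hermitian; \<open>g > 0\<close> follows from
  positivity of the second moment and nonsingularity.

  Moments determine a measure which has all exponential moments (\<open>moment_determinacy\<close>). If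
  \<open>c\<close> were negative, \<open>W\<^sub>2\<^sub>2 + \<bar>c\<bar> \<delta>\<^sub>0\<close> and \<open>g exp(-t\<^sup>2) dt\<close> would therefore be equal, but only the first has an
  atom at \<open>0\<close>. So \<open>c \<ge> 0\<close>, and determinacy, applied to enough positive combinations of the
  entries, gives \<open>W = g W\<^sub>a + c \<delta>\<^sub>0 J\<close> (\<open>moment_matrix_eqI\<close>).

  Conversely, for \<open>W\<^sub>a\<close> the integrand of \<open>\<integral> (PD\<^sub>a) W\<^sub>a Q\<^sup>* - \<integral> P W\<^sub>a (QD\<^sub>a)\<^sup>*\<close> is the derivative of
  \<open>exp(-t\<^sup>2) R\<close> for an explicit polynomial \<open>R\<close>, the bilinear concomitant (\<open>row_op_concomitant\<close>); for \<open>\<delta>\<^sub>0 J\<close>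
  one has \<open>F\<^sub>2(0) J = F\<^sub>1(0) J = 0\<close> and \<open>F\<^sub>0 J\<close> is Hermitian.

  The statement on orthogonal polynomials needs no formula for them: \<open>D\<^sub>a\<close> does not raise degrees, so \<open>P\<^sub>nD\<^sub>a\<close>
  has degree at most \<open>n\<close>, and by symmetry it is orthogonal to everything of lower degree. Hence it is
  \<open>\<Gamma>\<^sub>nP\<^sub>n\<close>, where \<open>\<Gamma>\<^sub>n\<close> is the coefficient of \<open>t\<^sup>n\<close> in \<open>P\<^sub>nD\<^sub>a\<close> (\<open>symmetric_imp_eigenfunction\<close>,
  \<open>Da_lead_coeff\<close>).\<close>


section \<open>Finite Borel measures and signed measures on the real line\<close>

lemma finite_borel_measureI:
  assumes "sets M = sets borel" "emeasure M UNIV \<noteq> \<infinity>"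
  shows "finite_borel_measure M"
proof -
  have "space M = UNIV" using sets_eq_imp_space_eq[OF assms(1)] by simp
  then show ?thesis
    using assms by (intro finite_borel_measure.intro finite_measureI finite_borel_measure_axioms.intro) auto
qed

lemma finite_borel_measureD:
  assumes "finite_borel_measure M"
  shows "sets M = sets borel" "space M = UNIV" "finite_measure M"
    "emeasure M \<Omega> = ennreal (measure M \<Omega>)"
proof -
  interpret finite_borel_measure M by fact
  show "sets M = sets borel" by (rule M_is_borel)
  then show "space M = UNIV" using sets_eq_imp_space_eq by fastforce
  show "finite_measure M" by unfold_locales
  show "emeasure M \<Omega> = ennreal (measure M \<Omega>)" by (rule emeasure_eq_measure)
qed

text \<open>The finite Borel measure with a given nonnegative, countably additive set function.\<close>

definition setfun_measure :: "(real set \<Rightarrow> real) \<Rightarrow> real measure" where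
  "setfun_measure \<nu> = measure_of UNIV (sets borel) (\<lambda>\<Omega>. ennreal (\<nu> \<Omega>))"

lemma emeasure_setfun_measure:
  assumes nonneg: "\<And>\<Omega>. \<Omega> \<in> sets borel \<Longrightarrow> 0 \<le> \<nu> \<Omega>"
    and sums: "\<And>A. range A \<subseteq> sets borel \<Longrightarrow> disjoint_family A \<Longrightarrow> (\<lambda>n. \<nu> (A n)) sums \<nu> (\<Union>n. A n)"
    and \<Omega>: "\<Omega> \<in> sets borel"
  shows "emeasure (setfun_measure \<nu>) \<Omega> = ennreal (\<nu> \<Omega>)"
proof -
  have "(\<lambda>n::nat. \<nu> {}) sums \<nu> {}"
    using sums[of "\<lambda>n. {}"] by (simp add: disjoint_family_on_def)
  then have "(\<lambda>n::nat. \<nu> {}) \<longlonglongrightarrow> 0" by (intro summable_LIMSEQ_zero) (rule sums_summable)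
  then have e: "\<nu> {} = 0" using LIMSEQ_const_iff by blast
  show ?thesis unfolding setfun_measure_def
  proof (rule emeasure_measure_of_sigma)
    show "sigma_algebra UNIV (sets (borel :: real measure))"
      using sets.sigma_algebra_axioms[of "borel :: real measure"] by simp
    show "positive (sets borel) (\<lambda>\<Omega>. ennreal (\<nu> \<Omega>))" by (simp add: positive_def e)
    show "countably_additive (sets borel) (\<lambda>\<Omega>. ennreal (\<nu> \<Omega>))"
    proof (rule countably_additiveI)
      fix A :: "nat \<Rightarrow> real set" assume A: "range A \<subseteq> sets borel" "disjoint_family A"
      have "(\<Sum>i. ennreal (\<nu> (A i))) = ennreal (\<Sum>i. \<nu> (A i))"
        using A by (intro suminf_ennreal2 nonneg sums_summable[OF sums]) auto
      then show "(\<Sum>i. ennreal (\<nu> (A i))) = ennreal (\<nu> (\<Union> (range A)))"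
        using sums_unique[OF sums[OF A]] by simp
    qed
  qed fact
qed

lemma setfun_measure:
  assumes nonneg: "\<And>\<Omega>. \<Omega> \<in> sets borel \<Longrightarrow> 0 \<le> \<nu> \<Omega>"
    and sums: "\<And>A. range A \<subseteq> sets borel \<Longrightarrow> disjoint_family A \<Longrightarrow> (\<lambda>n. \<nu> (A n)) sums \<nu> (\<Union>n. A n)"
  shows "finite_borel_measure (setfun_measure \<nu>)"
    and "\<Omega> \<in> sets borel \<Longrightarrow> measure (setfun_measure \<nu>) \<Omega> = \<nu> \<Omega>"
proof -
  have s: "sets (setfun_measure \<nu>) = sets borel"
    unfolding setfun_measure_def using sets.sigma_sets_eq[of "borel :: real measure"] by simp
  show "finite_borel_measure (setfun_measure \<nu>)"
    by (rule finite_borel_measureI[OF s]) (simp add: emeasure_setfun_measure[of \<nu>, OF nonneg sums])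
  show "measure (setfun_measure \<nu>) \<Omega> = \<nu> \<Omega>" if "\<Omega> \<in> sets borel"
    using that by (simp add: measure_def emeasure_setfun_measure[of \<nu>, OF nonneg sums] nonneg)
qed

lemma finite_borel_measure_sums:
  assumes "finite_borel_measure M" "range A \<subseteq> sets borel" "disjoint_family A"
  shows "(\<lambda>n. measure M (A n)) sums measure M (\<Union>n. A n)"
  using finite_measure.finite_measure_UNION[of M A] finite_borel_measureD[OF assms(1)] assms by simp

lemma finite_borel_measure_add:
  assumes "finite_borel_measure M" "A \<in> sets borel" "B \<in> sets borel"
  shows "measure M A = measure M (A \<inter> B) + measure M (A - B)"
  using finite_measure.finite_measure_Union[of M "A \<inter> B" "A - B"] finite_borel_measureD[OF assms(1)] assms
  by (auto simp: Int_Diff_Un Int_Diff_disjoint)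

lemma integrable_mono_measure:
  assumes M: "finite_borel_measure M" and N: "finite_borel_measure N"
    and le: "\<And>\<Omega>. \<Omega> \<in> sets borel \<Longrightarrow> measure M \<Omega> \<le> c * measure N \<Omega>"
    and f: "integrable N f"
  shows "integrable M (f :: real \<Rightarrow> 'b :: {banach, second_countable_topology})"
proof -
  note M' = finite_borel_measureD[OF M] and N' = finite_borel_measureD[OF N]
  define d where "d = max c 0"
  let ?N = "density N (\<lambda>_. ennreal d)"
  have "M \<le> ?N"
  proof (subst le_measure)
    show "\<forall>A\<in>sets M. emeasure M A \<le> emeasure ?N A"
    proof
      fix A assume "A \<in> sets M"
      then have A: "A \<in> sets borel" using M' by simp
      have "measure M A \<le> d * measure N A"
        using le[OF A] mult_right_mono[of c d "measure N A"] by (simp add: d_def)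
      then show "emeasure M A \<le> emeasure ?N A"
        using A N' by (subst emeasure_density_const)
          (auto simp: M'(4) N'(4) ennreal_mult''[symmetric] intro!: ennreal_leI)
    qed
  qed (simp add: M' N')
  then have "(\<integral>\<^sup>+x. norm (f x) \<partial>M) \<le> (\<integral>\<^sup>+x. norm (f x) \<partial>?N)"
    by (intro nn_integral_mono_measure) (simp_all add: M' N')
  also have "\<dots> = ennreal d * (\<integral>\<^sup>+x. norm (f x) \<partial>N)"
    using f by (subst nn_integral_density) (auto simp: nn_integral_cmult)
  also have "\<dots> < \<infinity>" using f
    by (auto simp: integrable_iff_bounded ennreal_mult_less_top)
  finally have "(\<integral>\<^sup>+x. norm (f x) \<partial>M) < \<infinity>" .
  moreover have "f \<in> borel_measurable M"
    using f M' N' measurable_cong_sets[of M N borel borel] by auto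
  ultimately show ?thesis by (simp add: integrable_iff_bounded)
qed

text \<open>The sum of two finite Borel measures.\<close>

definition add_measure :: "real measure \<Rightarrow> real measure \<Rightarrow> real measure" where
  "add_measure M N = setfun_measure (\<lambda>\<Omega>. measure M \<Omega> + measure N \<Omega>)"

lemma add_measure:
  assumes "finite_borel_measure M" "finite_borel_measure N"
  shows "finite_borel_measure (add_measure M N)"
    and "\<Omega> \<in> sets borel \<Longrightarrow> measure (add_measure M N) \<Omega> = measure M \<Omega> + measure N \<Omega>"
  unfolding add_measure_def
  by (rule setfun_measure; auto intro!: sums_add finite_borel_measure_sums assms)+

lemma add_measure_integral:
  fixes f :: "real \<Rightarrow> 'b :: {banach, second_countable_topology}"
  assumes M: "finite_borel_measure M" and N: "finite_borel_measure N"
    and f: "integrable (add_measure M N) f"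
  shows "integrable M f \<and> integrable N f \<and>
    integral\<^sup>L (add_measure M N) f = integral\<^sup>L M f + integral\<^sup>L N f"
proof -
  let ?S = "add_measure M N"
  note S = add_measure(1)[OF M N]
  note M' = finite_borel_measureD[OF M] and N' = finite_borel_measureD[OF N] and S' = finite_borel_measureD[OF S]
  have iM: "integrable M g" if "integrable ?S g" for g :: "real \<Rightarrow> 'b"
    by (rule integrable_mono_measure[OF M S _ that, of 1]) (simp add: add_measure(2)[OF M N])
  have iN: "integrable N g" if "integrable ?S g" for g :: "real \<Rightarrow> 'b"
    by (rule integrable_mono_measure[OF N S _ that, of 1]) (simp add: add_measure(2)[OF M N])
  have "integral\<^sup>L ?S f = integral\<^sup>L M f + integral\<^sup>L N f"
    using f
  proof (induct rule: integrable_induct)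
    case (base A c)
    then have A: "A \<in> sets borel" using S' by simp
    have [simp]: "emeasure K A < \<infinity>" if "finite_borel_measure K" for K
      using finite_borel_measureD(4)[OF that, of A] by simp
    show ?case using A M' N' S' M N S
      by (simp add: has_bochner_integral_integral_eq[OF has_bochner_integral_indicator]
        add_measure(2)[OF M N A] scaleR_add_left)
  next
    case (add f g)
    then show ?case by (simp add: iM iN)
  next
    case (lim f s)
    have l: "(\<lambda>i. integral\<^sup>L K (s i)) \<longlonglongrightarrow> integral\<^sup>L K f"
      if K: "finite_borel_measure K" and i: "\<And>g :: real \<Rightarrow> 'b. integrable ?S g \<Longrightarrow> integrable K g" for K
      by (rule integral_dominated_convergence[where w="\<lambda>x. 2 * norm (f x)"])
        (use lim(1,5)[THEN i] lim(3,4) S'(2) in auto)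
    show ?case
      using LIMSEQ_unique[OF l[OF S] tendsto_add[OF l[OF M iM] l[OF N iN], folded lim(2)]] by simp
  qed
  then show ?thesis using iM[OF f] iN[OF f] by simp
qed

lemma integrable_add_measure:
  fixes f :: "real \<Rightarrow> 'b :: {banach, second_countable_topology}"
  assumes M: "finite_borel_measure M" and N: "finite_borel_measure N"
    and f: "integrable M f" "integrable N f"
  shows "integrable (add_measure M N) f"
proof -
  note M' = finite_borel_measureD[OF M] and N' = finite_borel_measureD[OF N]
    and S' = finite_borel_measureD[OF add_measure(1)[OF M N]]
  have b[measurable]: "f \<in> borel_measurable borel"
    using f(1) M' measurable_cong_sets[of M borel borel borel] by auto
  have eq: "(\<integral>\<^sup>+x. g x \<partial>add_measure M N) = (\<integral>\<^sup>+x. g x \<partial>M) + (\<integral>\<^sup>+x. g x \<partial>N)"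
    if "g \<in> borel_measurable borel" for g
  proof -
    have mm: "u \<in> borel_measurable K" if "u \<in> borel_measurable borel" "sets K = sets borel"
      for u :: "real \<Rightarrow> ennreal" and K
      using that measurable_cong_sets[of K borel borel borel] by auto
    note mm' = mm[OF _ M'(1)] mm[OF _ N'(1)] mm[OF _ S'(1)]
    from that show ?thesis
    proof (induct rule: borel_measurable_induct)
      case (cong f g)
      then show ?case by simp
    next
      case (set A)
      then show ?case using M' N' S'
        by (simp add: add_measure(2)[OF M N] ennreal_plus)
    next
      case (mult u c)
      then show ?case by (simp add: nn_integral_cmult mm' distrib_left)
    next
      case (add u v)
      then show ?case by (simp add: nn_integral_add mm' ac_simps)
    next
      case (seq U)
      then have [measurable]: "\<And>i. U i \<in> borel_measurable borel" by auto
      have s: "(\<integral>\<^sup>+x. (SUP i. U i) x \<partial>K) = (SUP i. \<integral>\<^sup>+x. U i x \<partial>K)" if "sets K = sets borel" for K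
        unfolding SUP_apply
        by (rule nn_integral_monotone_convergence_SUP[OF seq(4)]) (rule mm[OF seq(1) that])
      have m: "incseq (\<lambda>i. \<integral>\<^sup>+x. U i x \<partial>K)" for K
        using seq by (auto simp: incseq_def le_fun_def intro!: nn_integral_mono)
      show ?case
        by (simp only: s M' N' S' seq ennreal_SUP_add[OF m m])
    qed
  qed
  show ?thesis
    unfolding integrable_iff_bounded
  proof
    show "f \<in> borel_measurable (add_measure M N)"
      using b S' measurable_cong_sets[of "add_measure M N" borel borel borel] by auto
    have "(\<integral>\<^sup>+x. norm (f x) \<partial>add_measure M N) = (\<integral>\<^sup>+x. norm (f x) \<partial>M) + (\<integral>\<^sup>+x. norm (f x) \<partial>N)"
      by (rule eq) measurable
    then show "(\<integral>\<^sup>+x. norm (f x) \<partial>add_measure M N) < \<infinity>"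
      using f by (simp add: integrable_iff_bounded)
  qed
qed

text \<open>By Hahn decomposition, the set functions which define the Jordan parts of a difference of finite
  measures are measures.\<close>

lemma jordan_decomposition:
  assumes M: "finite_borel_measure M" and N: "finite_borel_measure N"
    and \<nu>: "\<And>\<Omega>. \<Omega> \<in> sets borel \<Longrightarrow> \<nu> \<Omega> = measure M \<Omega> - measure N \<Omega>"
  shows "finite_borel_measure (jordan_pos \<nu>)" "finite_borel_measure (jordan_neg \<nu>)"
    "\<And>\<Omega>. \<Omega> \<in> sets borel \<Longrightarrow> measure (jordan_pos \<nu>) \<Omega> \<le> measure M \<Omega>"
    "\<And>\<Omega>. \<Omega> \<in> sets borel \<Longrightarrow> measure (jordan_neg \<nu>) \<Omega> \<le> measure N \<Omega>"
    "\<And>\<Omega>. \<Omega> \<in> sets borel \<Longrightarrow> \<nu> \<Omega> = measure (jordan_pos \<nu>) \<Omega> - measure (jordan_neg \<nu>) \<Omega>"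
proof -
  note M' = finite_borel_measureD[OF M] and N' = finite_borel_measureD[OF N]
  obtain Y where Y: "Y \<in> sets borel"
    and pos: "\<And>X. X \<in> sets borel \<Longrightarrow> X \<subseteq> Y \<Longrightarrow> 0 \<le> \<nu> X"
    and neg: "\<And>X. X \<in> sets borel \<Longrightarrow> X \<inter> Y = {} \<Longrightarrow> \<nu> X \<le> 0"
    using finite_unsigned_Hahn_decomposition[of M N] M' N' by (auto simp: \<nu>)
  have add: "\<nu> A = \<nu> (A \<inter> B) + \<nu> (A - B)" if "A \<in> sets borel" "B \<in> sets borel" for A B
    using finite_borel_measure_add[OF M that] finite_borel_measure_add[OF N that] that by (simp add: \<nu>)
  have sums: "(\<lambda>n. \<nu> (A n)) sums \<nu> (\<Union>n. A n)" if "range A \<subseteq> sets borel" "disjoint_family A" for A :: "nat \<Rightarrow> _"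
  proof -
    have "(\<lambda>n. measure M (A n) - measure N (A n)) sums (measure M (\<Union>n. A n) - measure N (\<Union>n. A n))"
      by (intro sums_diff finite_borel_measure_sums M N that)
    moreover have "A n \<in> sets borel" for n using that by auto
    ultimately show ?thesis by (simp add: \<nu>)
  qed
  \<comment> \<open>The suprema are attained at the intersections with the Hahn set and with its complement.\<close>
  have eqp: "(SUP B \<in> {B \<in> sets borel. B \<subseteq> \<Omega>}. ennreal (\<nu> B)) = ennreal (\<nu> (\<Omega> \<inter> Y))"
    if \<Omega>: "\<Omega> \<in> sets borel" for \<Omega>
  proof (rule antisym)
    show "(SUP B \<in> {B \<in> sets borel. B \<subseteq> \<Omega>}. ennreal (\<nu> B)) \<le> ennreal (\<nu> (\<Omega> \<inter> Y))"
    proof (rule SUP_least)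
      fix B assume B: "B \<in> {B \<in> sets borel. B \<subseteq> \<Omega>}"
      have "(\<Omega> \<inter> Y) \<inter> B = B \<inter> Y" "(\<Omega> \<inter> Y) - B = (\<Omega> - B) \<inter> Y" using B by auto
      then have "\<nu> (\<Omega> \<inter> Y) = \<nu> (B \<inter> Y) + \<nu> ((\<Omega> - B) \<inter> Y)"
        using add[of "\<Omega> \<inter> Y" B] \<Omega> Y B by simp
      moreover have "0 \<le> \<nu> ((\<Omega> - B) \<inter> Y)" "\<nu> (B - Y) \<le> 0" using B \<Omega> Y by (auto intro!: pos neg)
      moreover have "\<nu> B = \<nu> (B \<inter> Y) + \<nu> (B - Y)" using B Y by (intro add) auto
      ultimately show "ennreal (\<nu> B) \<le> ennreal (\<nu> (\<Omega> \<inter> Y))" by (intro ennreal_leI) linarith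
    qed
    show "ennreal (\<nu> (\<Omega> \<inter> Y)) \<le> (SUP B \<in> {B \<in> sets borel. B \<subseteq> \<Omega>}. ennreal (\<nu> B))"
      by (rule SUP_upper) (use \<Omega> Y in auto)
  qed
  have eqn: "(SUP B \<in> {B \<in> sets borel. B \<subseteq> \<Omega>}. ennreal (- \<nu> B)) = ennreal (- \<nu> (\<Omega> - Y))"
    if \<Omega>: "\<Omega> \<in> sets borel" for \<Omega>
  proof (rule antisym)
    show "(SUP B \<in> {B \<in> sets borel. B \<subseteq> \<Omega>}. ennreal (- \<nu> B)) \<le> ennreal (- \<nu> (\<Omega> - Y))"
    proof (rule SUP_least)
      fix B assume B: "B \<in> {B \<in> sets borel. B \<subseteq> \<Omega>}"
      have "(\<Omega> - Y) \<inter> B = B - Y" "(\<Omega> - Y) - B = (\<Omega> - B) - Y" using B by auto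
      then have "\<nu> (\<Omega> - Y) = \<nu> (B - Y) + \<nu> ((\<Omega> - B) - Y)"
        using add[of "\<Omega> - Y" B] \<Omega> Y B by simp
      moreover have "\<nu> ((\<Omega> - B) - Y) \<le> 0" "0 \<le> \<nu> (B \<inter> Y)" using B \<Omega> Y by (auto intro!: pos neg)
      moreover have "\<nu> B = \<nu> (B \<inter> Y) + \<nu> (B - Y)" using B Y by (intro add) auto
      ultimately show "ennreal (- \<nu> B) \<le> ennreal (- \<nu> (\<Omega> - Y))" by (intro ennreal_leI) linarith
    qed
    show "ennreal (- \<nu> (\<Omega> - Y)) \<le> (SUP B \<in> {B \<in> sets borel. B \<subseteq> \<Omega>}. ennreal (- \<nu> B))"
      by (rule SUP_upper) (use \<Omega> Y in auto)
  qed
  have dis: "disjoint_family (\<lambda>n. A n \<inter> Z)" if "disjoint_family A" for A :: "nat \<Rightarrow> real set" and Z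
    using that by (auto simp: disjoint_family_on_def)
  have pj: "jordan_pos \<nu> = setfun_measure (\<lambda>\<Omega>. \<nu> (\<Omega> \<inter> Y))"
    unfolding jordan_pos_def setfun_measure_def by (rule measure_of_eq) (auto simp: eqp sets.sigma_sets_eq[of borel, simplified])
  have nj: "jordan_neg \<nu> = setfun_measure (\<lambda>\<Omega>. - \<nu> (\<Omega> - Y))"
    unfolding jordan_pos_def jordan_neg_def setfun_measure_def
    by (rule measure_of_eq) (auto simp: eqn sets.sigma_sets_eq[of borel, simplified])
  have sp: "(\<lambda>n. \<nu> (A n \<inter> Y)) sums \<nu> (\<Union> (range A) \<inter> Y)"
    if "range A \<subseteq> sets borel" "disjoint_family A" for A
    using sums[of "\<lambda>n. A n \<inter> Y"] dis[OF that(2)] Y that(1) by (auto simp: image_subset_iff)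
  have sn: "(\<lambda>n. - \<nu> (A n - Y)) sums - \<nu> (\<Union> (range A) - Y)"
    if "range A \<subseteq> sets borel" "disjoint_family A" for A
    unfolding Diff_eq
    using sums[of "\<lambda>n. A n \<inter> - Y"] dis[OF that(2)] Y that(1) by (intro sums_minus) (auto simp: image_subset_iff)
  have pp: "0 \<le> \<nu> (\<Omega> \<inter> Y)" "0 \<le> - \<nu> (\<Omega> - Y)" if "\<Omega> \<in> sets borel" for \<Omega>
    using that Y pos[of "\<Omega> \<inter> Y"] neg[of "\<Omega> - Y"] by auto
  show "finite_borel_measure (jordan_pos \<nu>)"
    unfolding pj by (rule setfun_measure) (erule pp(1), erule (1) sp)
  show "finite_borel_measure (jordan_neg \<nu>)"
    unfolding nj by (rule setfun_measure) (erule pp(2), erule (1) sn)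
  fix \<Omega> :: "real set" assume \<Omega>: "\<Omega> \<in> sets borel"
  have P: "measure (jordan_pos \<nu>) \<Omega> = \<nu> (\<Omega> \<inter> Y)"
    unfolding pj by (rule setfun_measure) (erule pp(1), erule (1) sp, fact)
  have Ng: "measure (jordan_neg \<nu>) \<Omega> = - \<nu> (\<Omega> - Y)"
    unfolding nj by (rule setfun_measure) (erule pp(2), erule (1) sn, fact)
  show "measure (jordan_pos \<nu>) \<Omega> \<le> measure M \<Omega>"
    using finite_borel_measure_add[OF M \<Omega> Y] measure_nonneg[of M "\<Omega> - Y"] measure_nonneg[of N "\<Omega> \<inter> Y"]
    unfolding P using \<Omega> Y by (simp add: \<nu> del: measure_nonneg)
  show "measure (jordan_neg \<nu>) \<Omega> \<le> measure N \<Omega>"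
    using finite_borel_measure_add[OF N \<Omega> Y] measure_nonneg[of M "\<Omega> - Y"] measure_nonneg[of N "\<Omega> \<inter> Y"]
    unfolding Ng using \<Omega> Y by (simp add: \<nu> del: measure_nonneg)
  show "\<nu> \<Omega> = measure (jordan_pos \<nu>) \<Omega> - measure (jordan_neg \<nu>) \<Omega>"
    unfolding P Ng using add[OF \<Omega> Y] by simp
qed

lemma finite_borel_measure_eqI:
  assumes "finite_borel_measure M" "finite_borel_measure N"
    "\<And>\<Omega>. \<Omega> \<in> sets borel \<Longrightarrow> measure M \<Omega> = measure N \<Omega>"
  shows "M = N"
  by (rule measure_eqI) (use assms finite_borel_measureD[OF assms(1)] finite_borel_measureD[OF assms(2)] in auto)

text \<open>Integrals against a signed measure do not depend on how it is written as a difference of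
  positive measures.\<close>

lemma jordan_integral:
  fixes f :: "real \<Rightarrow> complex"
  assumes M: "finite_borel_measure M" and N: "finite_borel_measure N"
    and \<nu>: "\<And>\<Omega>. \<Omega> \<in> sets borel \<Longrightarrow> \<nu> \<Omega> = measure M \<Omega> - measure N \<Omega>"
    and f: "integrable M f" "integrable N f"
  shows "integrable (jordan_pos \<nu>) f" "integrable (jordan_neg \<nu>) f"
    "(LINT t|jordan_pos \<nu>. f t) - (LINT t|jordan_neg \<nu>. f t) = (LINT t|M. f t) - (LINT t|N. f t)"
proof -
  note J = jordan_decomposition[OF M N \<nu>]
  show ip: "integrable (jordan_pos \<nu>) f"
    by (rule integrable_mono_measure[OF J(1) M _ f(1), of 1]) (use J(3) in auto)
  show "integrable (jordan_neg \<nu>) f"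
    by (rule integrable_mono_measure[OF J(2) N _ f(2), of 1]) (use J(4) in auto)
  note ii = ip this
  have "add_measure (jordan_pos \<nu>) N = add_measure (jordan_neg \<nu>) M"
  proof (rule finite_borel_measure_eqI)
    fix \<Omega> :: "real set" assume "\<Omega> \<in> sets borel"
    then show "measure (add_measure (jordan_pos \<nu>) N) \<Omega> = measure (add_measure (jordan_neg \<nu>) M) \<Omega>"
      using J(5)[of \<Omega>] \<nu>[of \<Omega>] by (simp add: add_measure(2) J(1,2) M N)
  qed (simp_all add: add_measure(1) J(1,2) M N)
  then have "(LINT t|jordan_pos \<nu>. f t) + (LINT t|N. f t) = (LINT t|jordan_neg \<nu>. f t) + (LINT t|M. f t)"
    using add_measure_integral[OF J(1) N integrable_add_measure[OF J(1) N ii(1) f(2)]]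
      add_measure_integral[OF J(2) M integrable_add_measure[OF J(2) M ii(2) f(1)]]
    by metis
  then show "(LINT t|jordan_pos \<nu>. f t) - (LINT t|jordan_neg \<nu>. f t) = (LINT t|M. f t) - (LINT t|N. f t)"
    by algebra
qed


section \<open>Determinacy of moment problems\<close>

lemma power_div_fact_le_exp:
  assumes "0 \<le> (x::real)" shows "x ^ n / fact n \<le> exp x"
proof -
  have s: "summable (\<lambda>n. x ^ n / fact n)" using summable_exp[of x] by (simp add: field_simps)
  have "(\<Sum>k\<in>{n}. x ^ k / fact k) \<le> (\<Sum>k. x ^ k / fact k)"
    by (rule sum_le_suminf[OF s]) (use assms in auto)
  also have "\<dots> = exp x" by (simp add: exp_def divide_inverse mult.commute)
  finally show ?thesis by simp
qed

text \<open>The factor \<open>2\<close> in the exponent makes the bound decay geometrically in \<open>n\<close>.\<close>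

lemma even_moment_bound:
  assumes N: "finite_borel_measure N" and e: "integrable N (\<lambda>t. exp (2 * \<bar>u\<bar> * \<bar>t\<bar>))"
  shows "\<bar>u\<bar> ^ (2*n) / fact (2*n) * (LINT t|N. t ^ (2*n)) \<le> (1/4) ^ n * (LINT t|N. exp (2 * \<bar>u\<bar> * \<bar>t\<bar>))"
proof (cases "integrable N (\<lambda>t. t ^ (2*n))")
  case True
  have "\<bar>u\<bar> ^ (2*n) / fact (2*n) * (LINT t|N. t ^ (2*n)) = (LINT t|N. \<bar>u\<bar> ^ (2*n) / fact (2*n) * t ^ (2*n))"
    by simp
  also have "\<dots> \<le> (LINT t|N. (1/4) ^ n * exp (2 * \<bar>u\<bar> * \<bar>t\<bar>))"
  proof (intro integral_mono integrable_mult_right True e)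
    fix t :: real
    have "(2 * \<bar>u\<bar> * \<bar>t\<bar>) ^ (2*n) = 4 ^ n * (\<bar>u\<bar> ^ (2*n) * t ^ (2*n))"
      by (simp add: power_mult power_mult_distrib)
    then have "4 ^ n * (\<bar>u\<bar> ^ (2*n) * t ^ (2*n)) / fact (2*n) \<le> exp (2 * \<bar>u\<bar> * \<bar>t\<bar>)"
      using power_div_fact_le_exp[of "2 * \<bar>u\<bar> * \<bar>t\<bar>" "2*n"] by simp
    then show "\<bar>u\<bar> ^ (2*n) / fact (2*n) * t ^ (2*n) \<le> (1/4) ^ n * exp (2 * \<bar>u\<bar> * \<bar>t\<bar>)"
      by (simp add: power_divide field_simps)
  qed
  finally show ?thesis by simp
qed (simp add: not_integrable_integral_eq)

lemma char_eqI:
  assumes M: "real_distribution M" and N: "real_distribution N"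
    and iM: "\<And>n. integrable M (\<lambda>t. t ^ n)" and iN: "\<And>n. integrable N (\<lambda>t. t ^ n)"
    and eq: "\<And>n. (LINT t|M. t ^ n) = (LINT t|N. t ^ n)"
    and e: "\<And>u. integrable N (\<lambda>t. exp (u * \<bar>t\<bar>))"
  shows "char M = char N"
proof
  fix u :: real
  interpret M: real_distribution M by fact
  interpret N: real_distribution N by fact
  define C where "C = (LINT t|N. exp (2 * \<bar>u\<bar> * \<bar>t\<bar>))"
  have fin: "finite_borel_measure N" by (rule N.finite_borel_measure_M)
  have b: "norm (char M u - char N u) \<le> 4 * C * (1/4) ^ n" for n
  proof -
    define T where "T = (\<Sum>k\<le>2*n. ((\<i> * u)^k / fact k) * (LINT t|N. t ^ k))"
    have "(2*\<bar>u\<bar>^(2*n) / fact (2*n)) * (LINT t|N. t ^ (2*n)) \<le> 2 * ((1/4) ^ n * C)"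
      using even_moment_bound[OF fin e, of u n] by (simp add: C_def)
    moreover have "norm (char M u - T) \<le> (2*\<bar>u\<bar>^(2*n) / fact (2*n)) * (LINT t|N. t ^ (2*n))"
      using M.char_approx1[of "2*n" u] by (simp add: T_def iM eq power_even_abs)
    moreover have "norm (char N u - T) \<le> (2*\<bar>u\<bar>^(2*n) / fact (2*n)) * (LINT t|N. t ^ (2*n))"
      using N.char_approx1[of "2*n" u] by (simp add: T_def iN power_even_abs)
    moreover have "norm (char M u - char N u) \<le> norm (char M u - T) + norm (char N u - T)"
      using norm_triangle_ineq4[of "char M u - T" "char N u - T"] by simp
    ultimately show ?thesis by (simp add: mult_ac)
  qed
  have "(\<lambda>n. 4 * C * (1/4) ^ n) \<longlonglongrightarrow> 4 * C * 0"
    by (intro tendsto_intros LIMSEQ_power_zero) auto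
  then have "norm (char M u - char N u) \<le> 0"
    using LIMSEQ_le_const[of "\<lambda>n. 4 * C * (1/4) ^ n" 0 "norm (char M u - char N u)"] b by auto
  then show "char M u = char N u" by simp
qed

text \<open>Moments determine a measure with finite exponential moments: the Taylor polynomials at the
  origin of both characteristic functions agree, and their remainders tend to \<open>0\<close> everywhere.\<close>

lemma moment_determinacy:
  assumes M: "finite_borel_measure M" and N: "finite_borel_measure N"
    and iM: "\<And>n. integrable M (\<lambda>t. t ^ n)"
    and eq: "\<And>n. (LINT t|M. t ^ n) = (LINT t|N. t ^ n)"
    and e: "\<And>u. integrable N (\<lambda>t. exp (u * \<bar>t\<bar>))"
  shows "M = N"
proof -
  note M' = finite_borel_measureD[OF M] and N' = finite_borel_measureD[OF N]
  have mm: "f \<in> borel_measurable K" if "f \<in> borel_measurable borel" "finite_borel_measure K"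
    for f :: "real \<Rightarrow> real" and K
    using that measurable_cong_sets[of K borel borel borel] finite_borel_measureD(1)[OF that(2)] by auto
  have iN: "integrable N (\<lambda>t. t ^ n)" for n
  proof (rule Bochner_Integration.integrable_bound)
    show "integrable N (\<lambda>t. fact n * exp (1 * \<bar>t\<bar>))" by (intro integrable_mult_right e)
    show "AE t in N. norm (t ^ n) \<le> norm (fact n * exp (1 * \<bar>t\<bar>))"
      using power_div_fact_le_exp[of "\<bar>t\<bar>" n for t] by (auto simp: power_abs field_simps)
  qed (rule mm[OF _ N], measurable)
  \<comment> \<open>Characteristic functions identify probability measures, so both measures are divided by
    their common mass.\<close>
  define m where "m = measure M UNIV"
  have mN: "m = measure N UNIV" using eq[of 0] M' N' by (simp add: m_def)
  show ?thesis
  proof (cases "m = 0")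
    case True
    have "measure K \<Omega> = 0" if "finite_borel_measure K" "measure K UNIV = 0" "\<Omega> \<in> sets borel" for K \<Omega>
      using finite_measure.finite_measure_mono[of K \<Omega> UNIV] finite_borel_measureD[OF that(1)] that
      by (simp add: antisym)
    then show ?thesis using True mN m_def
      by (intro finite_borel_measure_eqI M N) (simp add: M N)
  next
    case False
    then have m: "m > 0" by (simp add: m_def less_le)
    define r where "r K = density K (\<lambda>_. ennreal (1/m))" for K :: "real measure"
    have int: "integrable K f \<longleftrightarrow> integrable (r K) f" "(LINT t|r K. f t) = (LINT t|K. f t) / m"
      if "finite_borel_measure K" "f \<in> borel_measurable borel" for K and f :: "real \<Rightarrow> real"
    proof -
      note f = mm[OF that(2,1)]
      have "integrable (r K) f \<longleftrightarrow> integrable K (\<lambda>t. (1/m) *\<^sub>R f t)"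
        unfolding r_def using f m by (intro integrable_density) auto
      also have "\<dots> \<longleftrightarrow> integrable K f"
        unfolding real_scaleR_def integrable_mult_left_iff using m by simp
      finally show "integrable K f \<longleftrightarrow> integrable (r K) f" by (rule sym)
      have "(LINT t|r K. f t) = (LINT t|K. (1/m) *\<^sub>R f t)"
        unfolding r_def using f m by (intro integral_density) auto
      then show "(LINT t|r K. f t) = (LINT t|K. f t) / m" by simp
    qed
    have em: "emeasure (r K) \<Omega> = ennreal (measure K \<Omega> / m)" if K: "finite_borel_measure K" and "\<Omega> \<in> sets borel" for K \<Omega>
    proof -
      have "emeasure (r K) \<Omega> = ennreal (1/m) * ennreal (measure K \<Omega>)"
        using that finite_borel_measureD(1)[OF K] unfolding r_def finite_borel_measureD(4)[OF K, symmetric]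
        by (intro emeasure_density_const) simp
      also have "\<dots> = ennreal (1/m * measure K \<Omega>)" using m by (intro ennreal_mult[symmetric]) auto
      finally show ?thesis by simp
    qed
    have real: "real_distribution (r K)" if K: "finite_borel_measure K" "m = measure K UNIV" for K
    proof (intro real_distribution.intro real_distribution_axioms.intro prob_spaceI)
      show "sets (r K) = sets borel" using finite_borel_measureD(1)[OF K(1)] by (simp add: r_def)
      show "emeasure (r K) (space (r K)) = 1"
        using em[OF K(1), of UNIV] finite_borel_measureD(2)[OF K(1)] K(2) m by (simp add: r_def)
    qed
    have "char (r M) = char (r N)"
    proof (rule char_eqI)
      show "real_distribution (r M)" "real_distribution (r N)" using M N m_def mN by (auto intro: real)
      show "integrable (r M) (\<lambda>t. t ^ n)" for n by (subst int(1)[symmetric]) (simp_all add: M iM)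
      show "integrable (r N) (\<lambda>t. t ^ n)" for n by (subst int(1)[symmetric]) (simp_all add: N iN)
      show "integrable (r N) (\<lambda>t. exp (u * \<bar>t\<bar>))" for u by (subst int(1)[symmetric]) (simp_all add: N e)
      show "(LINT t|r M. t ^ n) = (LINT t|r N. t ^ n)" for n by (simp add: int(2) M N eq)
    qed
    then have rr: "r M = r N" by (intro Levy_uniqueness real M N m_def mN)
    show ?thesis
    proof (rule finite_borel_measure_eqI[OF M N])
      fix \<Omega> :: "real set" assume "\<Omega> \<in> sets borel"
      with rr have "ennreal (measure M \<Omega> / m) = ennreal (measure N \<Omega> / m)"
        using em[OF M, of \<Omega>] em[OF N, of \<Omega>] by simp
      then show "measure M \<Omega> = measure N \<Omega>" using m by (simp add: ennreal_inj)
    qed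
  qed
qed


section \<open>Moment functionals of a weight matrix\<close>

lemma cm_integral_eq:
  fixes f :: "real \<Rightarrow> complex"
  assumes "finite_borel_measure M" "finite_borel_measure N" "finite_borel_measure M'" "finite_borel_measure N'"
    and re: "\<And>\<Omega>. \<Omega> \<in> sets borel \<Longrightarrow> Re (\<nu> \<Omega>) = measure M \<Omega> - measure N \<Omega>"
    and im: "\<And>\<Omega>. \<Omega> \<in> sets borel \<Longrightarrow> Im (\<nu> \<Omega>) = measure M' \<Omega> - measure N' \<Omega>"
    and f: "integrable M f" "integrable N f" "integrable M' f" "integrable N' f"
  shows "cm_integrable \<nu> f"
    and "cm_integral \<nu> f = ((LINT t|M. f t) - (LINT t|N. f t)) + \<i> * ((LINT t|M'. f t) - (LINT t|N'. f t))"
  unfolding cm_integrable_def cm_integral_def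
  using jordan_integral[where \<nu>="\<lambda>\<Omega>. Re (\<nu> \<Omega>)", OF assms(1,2) re f(1,2)]
    jordan_integral[where \<nu>="\<lambda>\<Omega>. Im (\<nu> \<Omega>)", OF assms(3,4) im f(3,4)]
  by auto

lemma cm_integral_cnj:
  assumes "\<And>\<Omega>. \<nu>' \<Omega> = cnj (\<nu> \<Omega>)"
  shows "cm_integral \<nu>' (\<lambda>t. cnj (f t)) = cnj (cm_integral \<nu> f)"
  by (simp add: cm_integral_def jordan_neg_def assms algebra_simps)

lemma zero_measure:
  shows "finite_borel_measure (setfun_measure (\<lambda>_. 0))"
    and "\<Omega> \<in> sets borel \<Longrightarrow> measure (setfun_measure (\<lambda>_. 0)) \<Omega> = 0"
  by (rule setfun_measure; simp)+

lemma complex_measure_sums: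
  assumes "complex_measure \<nu>" "range A \<subseteq> sets borel" "disjoint_family (A :: nat \<Rightarrow> _)"
  shows "(\<lambda>n. \<nu> (A n)) sums \<nu> (\<Union>n. A n)"
  using assms by (simp add: complex_measure_def)

text \<open>The quadratic form at \<open>e\<^sub>i + s e\<^sub>j\<close>, where \<open>i = j\<close> is allowed.\<close>

lemma pos_semidef_part:
  assumes M: "pos_semidef (M :: complex^'n^'n::finite)" and s: "norm s \<le> 1"
  shows "0 \<le> (Re (M $ i $ i) + Re (M $ j $ j)) / 2 + Re (s * M $ i $ j)"
proof -
  have *: "0 \<le> Re (M $ i $ i) + 2 * Re (s * M $ i $ j) + (norm s)\<^sup>2 * Re (M $ j $ j)" for s i j
  proof -
    define v :: "complex^'n" where "v = (\<chi> k. (if k = i then 1 else 0) + (if k = j then s else 0))"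
    have "(\<Sum>k\<in>UNIV. \<Sum>l\<in>UNIV. cnj (v $ k) * M $ k $ l * v $ l)
      = M $ i $ i + M $ i $ j * s + cnj s * M $ j $ i + cnj s * M $ j $ j * s"
      (is "?lhs = _")
    proof -
      have inner: "(\<Sum>l\<in>UNIV. A l * v $ l) = A i + A j * s" for A :: "'n \<Rightarrow> complex"
      proof -
        have "A l * v $ l = (if l = i then A i else 0) + (if l = j then A j * s else 0)" for l
          by (auto simp: v_def distrib_left)
        then show ?thesis by (simp add: sum.distrib)
      qed
      have outer: "(\<Sum>k\<in>UNIV. cnj (v $ k) * B k) = B i + cnj s * B j" for B :: "'n \<Rightarrow> complex"
      proof -
        have "cnj (v $ k) * B k = (if k = i then B i else 0) + (if k = j then cnj s * B j else 0)" for k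
          by (auto simp: v_def distrib_right)
        then show ?thesis by (simp add: sum.distrib)
      qed
      have "?lhs = (\<Sum>k\<in>UNIV. cnj (v $ k) * (\<Sum>l\<in>UNIV. M $ k $ l * v $ l))"
        by (simp add: sum_distrib_left mult.assoc)
      then show ?thesis unfolding inner outer by (simp add: distrib_left mult.assoc)
    qed
    moreover have "Re (cnj s * M $ j $ i) = Re (s * M $ i $ j)"
    proof -
      have "M $ j $ i = cnj (M $ i $ j)" using M unfolding pos_semidef_def by blast
      then show ?thesis by simp
    qed
    moreover have "Re (cnj s * M $ j $ j * s) = (norm s)\<^sup>2 * Re (M $ j $ j)"
      unfolding cmod_power2 by (simp add: algebra_simps power2_eq_square)
    moreover have "0 \<le> Re (\<Sum>k\<in>UNIV. \<Sum>l\<in>UNIV. cnj (v $ k) * M $ k $ l * v $ l)"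
      using M unfolding pos_semidef_def by blast
    ultimately show ?thesis by (simp add: mult.commute)
  qed
  have d: "0 \<le> Re (M $ j $ j)" using *[of j 0 j] by simp
  have "(norm s)\<^sup>2 * Re (M $ j $ j) \<le> Re (M $ j $ j)"
    using mult_right_mono[OF power_le_one[of "norm s" 2] d] s by simp
  then show ?thesis using *[of i s j] unfolding add_divide_distrib by linarith
qed

text \<open>Since \<open>\<bar>W\<^sub>i\<^sub>j\<bar> \<le> (W\<^sub>i\<^sub>i + W\<^sub>j\<^sub>j) / 2\<close>, the set functions \<open>(W\<^sub>i\<^sub>i + W\<^sub>j\<^sub>j) / 2 + Re (s W\<^sub>i\<^sub>j)\<close>
  with \<open>\<bar>s\<bar> \<le> 1\<close> are positive measures. Those with \<open>s = 1\<close>, \<open>s = - \<i>\<close> and \<open>s = 0\<close> recover \<open>W\<^sub>i\<^sub>j\<close>.\<close>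

definition part :: "'n::finite mat_setfun \<Rightarrow> 'n \<Rightarrow> 'n \<Rightarrow> complex \<Rightarrow> real measure" where
  "part W i j s = setfun_measure
     (\<lambda>\<Omega>. (Re (W \<Omega> $ i $ i) + Re (W \<Omega> $ j $ j)) / 2 + Re (s * W \<Omega> $ i $ j))"

text \<open>The moment functional of an entry of a matrix of measures, on polynomials.\<close>

definition mom :: "'n::finite mat_setfun \<Rightarrow> 'n \<Rightarrow> 'n \<Rightarrow> complex poly \<Rightarrow> complex" where
  "mom W i j p = cm_integral (entry W i j) (\<lambda>t. poly p (of_real t))"

text \<open>The common assumptions of the following lemmas: a positive semidefinite matrix of measures.\<close>

context
  fixes W :: "'n::finite mat_setfun"
  assumes meas: "\<And>i j. complex_measure (entry W i j)"
    and psd: "\<And>\<Omega>. \<Omega> \<in> sets borel \<Longrightarrow> pos_semidef (W \<Omega>)"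
begin

lemma part_measure:
  assumes s: "norm s \<le> 1"
  shows "finite_borel_measure (part W i j s)"
    and "\<Omega> \<in> sets borel \<Longrightarrow> measure (part W i j s) \<Omega> =
      (Re (W \<Omega> $ i $ i) + Re (W \<Omega> $ j $ j)) / 2 + Re (s * W \<Omega> $ i $ j)"
proof -
  have sums: "(\<lambda>n. (Re (W (A n) $ i $ i) + Re (W (A n) $ j $ j)) / 2 + Re (s * W (A n) $ i $ j))
    sums ((Re (W (\<Union>n. A n) $ i $ i) + Re (W (\<Union>n. A n) $ j $ j)) / 2 + Re (s * W (\<Union>n. A n) $ i $ j))"
    if "range A \<subseteq> sets borel" "disjoint_family A" for A :: "nat \<Rightarrow> _"
    using complex_measure_sums[OF meas that, unfolded entry_def]
    by (intro sums_add sums_divide sums_Re sums_mult) auto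
  show "finite_borel_measure (part W i j s)" unfolding part_def
    by (rule setfun_measure) (erule pos_semidef_part[OF psd s], erule (1) sums)
  show "measure (part W i j s) \<Omega> =
      (Re (W \<Omega> $ i $ i) + Re (W \<Omega> $ j $ j)) / 2 + Re (s * W \<Omega> $ i $ j)" if "\<Omega> \<in> sets borel"
    unfolding part_def
    by (rule setfun_measure) (erule pos_semidef_part[OF psd s], erule (1) sums, fact)
qed

lemma hermitian: "entry W j i \<Omega> = cnj (entry W i j \<Omega>)"
proof (cases "\<Omega> \<in> sets borel")
  case True
  then show ?thesis using psd[OF True] unfolding pos_semidef_def entry_def by blast
next
  case False
  then show ?thesis using meas[of i j] meas[of j i] by (simp add: complex_measure_def)
qed

lemma integrable_part:
  fixes f :: "real \<Rightarrow> 'b :: {banach, second_countable_topology}"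
  assumes s: "norm s \<le> 1" and f: "\<And>i. integrable (part W i i 0) f"
  shows "integrable (part W i j s) f"
proof (rule integrable_mono_measure)
  show "integrable (add_measure (part W i i 0) (part W j j 0)) f"
    by (intro integrable_add_measure f part_measure) simp_all
  show "finite_borel_measure (part W i j s)" by (rule part_measure[OF s])
  show "finite_borel_measure (add_measure (part W i i 0) (part W j j 0))"
    by (intro add_measure part_measure) simp_all
  fix \<Omega> :: "real set" assume \<Omega>: "\<Omega> \<in> sets borel"
  have "norm (- s) \<le> 1" using s by simp
  from pos_semidef_part[OF psd[OF \<Omega>] this, of i j]
  show "measure (part W i j s) \<Omega> \<le> 1 * measure (add_measure (part W i i 0) (part W j j 0)) \<Omega>"
    using \<Omega> s by (simp add: add_measure part_measure field_simps)
qed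

lemma cm_integral_entry:
  fixes f :: "real \<Rightarrow> complex"
  assumes f: "\<And>i. integrable (part W i i 0) f"
  shows "cm_integrable (entry W i j) f"
    and "cm_integral (entry W i j) f = ((LINT t|part W i j 1. f t) - (LINT t|part W i j 0. f t))
      + \<i> * ((LINT t|part W i j (- \<i>). f t) - (LINT t|part W i j 0. f t))"
proof -
  have p: "finite_borel_measure (part W i j s)" "integrable (part W i j s) f" if "norm s \<le> 1" for s
    using that by (simp_all add: part_measure integrable_part f)
  have re: "Re (entry W i j \<Omega>) = measure (part W i j 1) \<Omega> - measure (part W i j 0) \<Omega>"
    and im: "Im (entry W i j \<Omega>) = measure (part W i j (- \<i>)) \<Omega> - measure (part W i j 0) \<Omega>"
    if "\<Omega> \<in> sets borel" for \<Omega>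
    using that by (simp_all add: part_measure entry_def)
  note * = cm_integral_eq[OF p(1) p(1) p(1) p(1) re im p(2) p(2) p(2) p(2)]
  show "cm_integrable (entry W i j) f"
    and "cm_integral (entry W i j) f = ((LINT t|part W i j 1. f t) - (LINT t|part W i j 0. f t))
      + \<i> * ((LINT t|part W i j (- \<i>). f t) - (LINT t|part W i j 0. f t))"
    by (rule *; simp)+
qed

lemma cm_integral_diag:
  fixes f :: "real \<Rightarrow> complex"
  assumes f: "integrable (part W i i 0) f"
  shows "cm_integral (entry W i i) f = (LINT t|part W i i 0. f t)"
proof -
  let ?Z = "setfun_measure (\<lambda>_. 0)"
  note Z = zero_measure
  have i: "integrable ?Z f"
    by (rule integrable_mono_measure[OF Z(1) part_measure(1) _ f, of 1]) (simp_all add: Z)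
  have z: "integral\<^sup>L ?Z f = 0"
  proof -
    have "AE x in ?Z. f x = 0"
      using Z(2)[of UNIV] finite_borel_measureD[OF Z(1)] by (intro AE_I[of _ _ UNIV]) auto
    then show ?thesis by (simp add: integral_eq_zero_AE)
  qed
  have im: "Im (W \<Omega> $ i $ i) = 0" if "\<Omega> \<in> sets borel" for \<Omega>
    using hermitian[of i i \<Omega>] by (auto simp: complex_eq_iff entry_def)
  show ?thesis
    using cm_integral_eq(2)[of "part W i i 0" ?Z ?Z ?Z "entry W i i" f] f i z Z
    by (simp add: part_measure entry_def im)
qed

text \<open>Conversely, integrability in the sense of Jordan parts gives integrability against the
  diagonal entries.\<close>

lemma integrable_diag:
  assumes f: "cm_integrable (entry W i i) f"
  shows "integrable (part W i i 0) f"
proof -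
  let ?Z = "setfun_measure (\<lambda>_. 0)"
  note Z = zero_measure
  have e: "Re (entry W i i \<Omega>) = measure (part W i i 0) \<Omega> - measure ?Z \<Omega>" if "\<Omega> \<in> sets borel" for \<Omega>
    using that by (simp add: entry_def part_measure Z)
  note J = jordan_decomposition[OF part_measure(1) Z(1) e, simplified]
  show ?thesis
  proof (rule integrable_mono_measure[OF part_measure(1) J(1), where c=1])
    fix \<Omega> :: "real set" assume \<Omega>: "\<Omega> \<in> sets borel"
    show "measure (part W i i 0) \<Omega> \<le> 1 * measure (jordan_pos (\<lambda>a. Re (entry W i i a))) \<Omega>"
      using J(5)[OF \<Omega>] e[OF \<Omega>] Z(2)[OF \<Omega>]
        measure_nonneg[of "jordan_neg (\<lambda>a. Re (entry W i i a))" \<Omega>] by linarith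
  qed (use f in \<open>simp_all add: cm_integrable_def\<close>)
qed

end


lemma weight_matrixD:
  assumes "weight_matrix W"
  shows "complex_measure (entry W i j)" "\<Omega> \<in> sets borel \<Longrightarrow> pos_semidef (W \<Omega>)"
    "cm_integrable (entry W i j) (\<lambda>t. of_real (t ^ n))"
    "invertible (mp_lead_coeff P) \<Longrightarrow> invertible (mint W P P)"
  using assms unfolding weight_matrix_def by simp_all

lemma poly_of_real_eq_sum: "poly p (of_real t :: complex) = (\<Sum>n\<le>degree p. coeff p n * of_real (t ^ n))"
  by (simp add: poly_altdef)

text \<open>The part of the definition of a weight matrix which does not concern nonsingularity.\<close>

definition moment_matrix :: "'n::finite mat_setfun \<Rightarrow> bool" where
  "moment_matrix W \<longleftrightarrow> (\<forall>i j. complex_measure (entry W i j)) \<and> (\<forall>\<Omega> \<in> sets borel. pos_semidef (W \<Omega>)) \<and>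
     (\<forall>n i. integrable (part W i i 0) (\<lambda>t. t ^ n))"

lemma moment_matrixD:
  assumes "moment_matrix W"
  shows "complex_measure (entry W i j)" "\<Omega> \<in> sets borel \<Longrightarrow> pos_semidef (W \<Omega>)"
    "integrable (part W i i 0) (\<lambda>t. t ^ n)"
  using assms unfolding moment_matrix_def by simp_all

lemma weight_matrix_imp_moment_matrix:
  assumes W: "weight_matrix W" shows "moment_matrix W"
proof -
  note w = weight_matrixD[OF W]
  have "integrable (part W i i 0) (\<lambda>t. t ^ n)" for i n
    using integrable_diag[OF w(1,2,3), of i n] integrable_Re by fastforce
  then show ?thesis using w unfolding moment_matrix_def by blast
qed

lemma moment_matrix_integrable:
  assumes W: "moment_matrix W"
  shows "norm s \<le> 1 \<Longrightarrow> integrable (part W i j s) (\<lambda>t. t ^ n)"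
    and "norm s \<le> 1 \<Longrightarrow> integrable (part W i j s) (\<lambda>t. poly p (of_real t) :: complex)"
proof -
  note w = moment_matrixD[OF W]
  show *: "integrable (part W i j s) (\<lambda>t. t ^ n)" if "norm s \<le> 1" for n
    by (rule integrable_part[OF w(1,2) that w(3)])
  show "integrable (part W i j s) (\<lambda>t. poly p (of_real t) :: complex)" if "norm s \<le> 1"
    unfolding poly_of_real_eq_sum
    by (intro Bochner_Integration.integrable_sum integrable_mult_right integrable_of_real *[OF that])
qed

lemma mom_eq:
  assumes "moment_matrix W"
  shows "mom W i j p = ((LINT t|part W i j 1. poly p (of_real t)) - (LINT t|part W i j 0. poly p (of_real t)))
      + \<i> * ((LINT t|part W i j (- \<i>). poly p (of_real t)) - (LINT t|part W i j 0. poly p (of_real t)))"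
  unfolding mom_def
  by (rule cm_integral_entry[OF moment_matrixD(1,2)[OF assms]]) (simp_all add: moment_matrix_integrable[OF assms])

lemma mom_add:
  assumes "moment_matrix W" shows "mom W i j (p + q) = mom W i j p + mom W i j q"
  by (simp add: mom_eq[OF assms] moment_matrix_integrable[OF assms] algebra_simps)

lemma mom_smult:
  assumes "moment_matrix W" shows "mom W i j (smult c p) = c * mom W i j p"
  by (simp add: mom_eq[OF assms] moment_matrix_integrable[OF assms] algebra_simps)

lemma mom_0:
  assumes "moment_matrix W" shows "mom W i j 0 = 0"
  using mom_smult[OF assms, of i j 0 0] by simp

lemma mom_minus:
  assumes "moment_matrix W" shows "mom W i j (- p) = - mom W i j p"
  using mom_smult[OF assms, of i j "-1" p] by simp

lemma mom_diff:
  assumes "moment_matrix W" shows "mom W i j (p - q) = mom W i j p - mom W i j q"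
  using mom_add[OF assms, of i j p "- q"] by (simp add: mom_minus[OF assms])

lemma mom_sum:
  assumes "moment_matrix W" shows "mom W i j (\<Sum>x\<in>A. f x) = (\<Sum>x\<in>A. mom W i j (f x))"
  by (induct A rule: infinite_finite_induct) (simp_all add: mom_add[OF assms] mom_0[OF assms])

text \<open>The polynomial with conjugate coefficients, which takes conjugate values on the real line.\<close>

abbreviation cnj_poly :: "complex poly \<Rightarrow> complex poly" where
  "cnj_poly \<equiv> map_poly cnj"

lemma coeff_cnj_poly [simp]: "coeff (cnj_poly p) n = cnj (coeff p n)"
  by (simp add: coeff_map_poly)

lemma cnj_poly_cnj_poly [simp]: "cnj_poly (cnj_poly p) = p"
  by (rule poly_eqI) simp

lemma cnj_poly_add: "cnj_poly (p + q) = cnj_poly p + cnj_poly q"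
  and cnj_poly_diff: "cnj_poly (p - q) = cnj_poly p - cnj_poly q"
  and cnj_poly_mult: "cnj_poly (p * q) = cnj_poly p * cnj_poly q"
  and cnj_poly_pderiv: "cnj_poly (pderiv p) = pderiv (cnj_poly p)"
  by (rule poly_eqI; simp add: coeff_mult coeff_pderiv)+

lemma mom_cnj:
  assumes "moment_matrix W" shows "mom W j i (cnj_poly p) = cnj (mom W i j p)"
  unfolding mom_def
  using cm_integral_cnj[OF hermitian[OF moment_matrixD(1,2)[OF assms]], where f="\<lambda>t. poly p (of_real t)"]
  by simp

lemma mint_eq:
  "mint W P Q $ i $ j = (\<Sum>k\<in>UNIV. \<Sum>l\<in>UNIV. mom W k l (P $ i $ k * cnj_poly (Q $ j $ l)))"
  by (simp add: mint_def mom_def)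

lemma mom_diag:
  assumes "moment_matrix W"
  shows "mom W i i p = (LINT t|part W i i 0. poly p (of_real t))"
  unfolding mom_def
  by (rule cm_integral_diag[OF moment_matrixD(1,2)[OF assms]]) (simp_all add: moment_matrix_integrable[OF assms])

lemma part_moment:
  assumes W: "moment_matrix W" and s: "s = 0 \<or> s = 1 \<or> s = - \<i>"
  shows "(LINT t|part W i j s. t ^ n) =
    Re (mom W i i (monom 1 n) + mom W j j (monom 1 n)) / 2 + Re (s * mom W i j (monom 1 n))"
proof -
  note w = moment_matrixD(1,2)[OF W] and int = moment_matrix_integrable(1)[OF W]
  define r where "r i j s = (LINT t|part W i j s. t ^ n)" for i j s
  have c: "(LINT t|part W i j s. poly (monom 1 n) (of_real t)) = complex_of_real (r i j s)" for i j s
    by (simp add: poly_monom r_def flip: of_real_power)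
  have d: "mom W i i (monom 1 n) = r i i 0" for i
    by (simp add: mom_diag[OF W] c)
  have f: "finite_borel_measure (part W i j 0)" "finite_borel_measure (part W i i 0)"
    "finite_borel_measure (part W j j 0)"
    by (simp_all add: part_measure[OF w])
  have "add_measure (part W i j 0) (part W i j 0) = add_measure (part W i i 0) (part W j j 0)"
    by (intro finite_borel_measure_eqI) (simp_all add: add_measure f part_measure(2)[OF w])
  then have "2 * r i j 0 = r i i 0 + r j j 0"
    using add_measure_integral[OF f(1,1) integrable_add_measure[OF f(1,1) int int], of n]
      add_measure_integral[OF f(2,3) integrable_add_measure[OF f(2,3) int int], of n]
    by (simp add: r_def)
  moreover have "mom W i j (monom 1 n) = (r i j 1 - r i j 0) + \<i> * (r i j (- \<i>) - r i j 0)"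
    by (simp add: mom_eq[OF W] c)
  ultimately show ?thesis using s unfolding r_def[symmetric] by (auto simp: d)
qed

text \<open>The moments determine the matrix of measures if the diagonal entries of one of the two matrices
  have exponential moments; these dominate the other entries.\<close>

lemma moment_matrix_eqI:
  assumes W: "moment_matrix W" and V: "moment_matrix V"
    and eq: "\<And>i j n. mom W i j (monom 1 n) = mom V i j (monom 1 n)"
    and e: "\<And>i u. integrable (part V i i 0) (\<lambda>t. exp (u * \<bar>t\<bar>))"
  shows "W = V"
proof -
  note w = moment_matrixD(1,2)[OF W] and v = moment_matrixD(1,2)[OF V]
  have part: "part W i j s = part V i j s" if s: "s = 0 \<or> s = 1 \<or> s = - \<i>" for i j s
  proof (rule moment_determinacy)
    have n: "norm s \<le> 1" using s by auto
    show "finite_borel_measure (part W i j s)" "finite_borel_measure (part V i j s)"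
      by (simp_all add: part_measure[OF w n] part_measure[OF v n])
    show "integrable (part W i j s) (\<lambda>t. t ^ k)" for k by (rule moment_matrix_integrable[OF W n])
    show "integrable (part V i j s) (\<lambda>t. exp (u * \<bar>t\<bar>))" for u
      by (rule integrable_part[OF v n]) (auto intro: e)
    show "(LINT t|part W i j s. t ^ k) = (LINT t|part V i j s. t ^ k)" for k
      unfolding part_moment[OF W s] part_moment[OF V s] eq ..
  qed
  have "W \<Omega> $ i $ j = V \<Omega> $ i $ j" for \<Omega> i j
  proof (cases "\<Omega> \<in> sets borel")
    case True
    have "measure (part W i j s) \<Omega> = measure (part V i j s) \<Omega>" if "s = 0 \<or> s = 1 \<or> s = - \<i>" for s
      using part[OF that] by simp
    from this[of 0] this[of 1] this[of "- \<i>"] show ?thesis using True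
      by (simp add: part_measure(2)[OF w] part_measure(2)[OF v] complex_eq_iff field_simps)
  next
    case False
    then show ?thesis using w(1)[of i j] v(1)[of i j] by (simp add: complex_measure_def entry_def)
  qed
  then show ?thesis by (simp add: fun_eq_iff vec_eq_iff)
qed


section \<open>Monic orthogonal matrix polynomials\<close>

lemma mint_add_left:
  assumes "moment_matrix W" shows "mint W (P + P') Q = mint W P Q + mint W P' Q"
  by (simp add: vec_eq_iff mint_eq distrib_right mom_add[OF assms] sum.distrib)

lemma mint_diff_left:
  assumes "moment_matrix W" shows "mint W (P - P') Q = mint W P Q - mint W P' Q"
  by (simp add: vec_eq_iff mint_eq left_diff_distrib mom_diff[OF assms] sum_subtractf)

lemma mint_0_left:
  assumes "moment_matrix W" shows "mint W 0 Q = 0"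
  by (simp add: vec_eq_iff mint_eq mom_0[OF assms])

lemma mint_sum_left:
  assumes "moment_matrix W" shows "mint W (\<Sum>x\<in>A. f x) Q = (\<Sum>x\<in>A. mint W (f x) Q)"
  by (induct A rule: infinite_finite_induct) (simp_all add: mint_add_left[OF assms] mint_0_left[OF assms])

lemma mint_const_left:
  assumes "moment_matrix W" shows "mint W (mp_const A ** P) Q = A ** mint W P Q"
proof -
  have "mint W (mp_const A ** P) Q $ i $ j = (A ** mint W P Q) $ i $ j" for i j
  proof -
    have "mint W (mp_const A ** P) Q $ i $ j =
      (\<Sum>k\<in>UNIV. \<Sum>l\<in>UNIV. \<Sum>m\<in>UNIV. A $ i $ m * mom W k l (P $ m $ k * cnj_poly (Q $ j $ l)))"
      by (simp add: mint_eq matrix_matrix_mult_def mp_const_def map_matrix_def sum_distrib_right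
        mom_sum[OF assms] mom_smult[OF assms])
    also have "\<dots> = (\<Sum>m\<in>UNIV. \<Sum>k\<in>UNIV. \<Sum>l\<in>UNIV. A $ i $ m * mom W k l (P $ m $ k * cnj_poly (Q $ j $ l)))"
      by (subst sum.swap[of _ UNIV UNIV], rule sum.cong[OF refl], subst sum.swap) (rule refl)
    finally show ?thesis by (simp add: matrix_matrix_mult_def mint_eq sum_distrib_left)
  qed
  then show ?thesis by (simp add: vec_eq_iff)
qed

lemma mint_cnj:
  assumes "moment_matrix W" shows "mint W Q P $ j $ i = cnj (mint W P Q $ i $ j)"
proof -
  have "cnj (mint W P Q $ i $ j) = (\<Sum>k\<in>UNIV. \<Sum>l\<in>UNIV. mom W l k (Q $ j $ l * cnj_poly (P $ i $ k)))"
    by (simp add: mint_eq cnj_poly_mult mult.commute flip: mom_cnj[OF assms])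
  also have "\<dots> = mint W Q P $ j $ i" unfolding mint_eq by (rule sum.swap)
  finally show ?thesis by simp
qed

lemma mint_eq_0_commute:
  assumes "moment_matrix W" shows "mint W P Q = 0 \<longleftrightarrow> mint W Q P = 0"
  using mint_cnj[OF assms, of P Q] mint_cnj[OF assms, of Q P] by (simp add: vec_eq_iff) metis

text \<open>Degree less than \<open>n\<close>, the zero polynomial included.\<close>

definition mp_degree_less :: "nat \<Rightarrow> 'n::finite matpoly \<Rightarrow> bool" where
  "mp_degree_less n P \<longleftrightarrow> (\<forall>k\<ge>n. mp_coeff P k = 0)"

text \<open>Degree \<open>n\<close> with the identity matrix as leading coefficient.\<close>

definition mp_monic :: "nat \<Rightarrow> 'n::finite matpoly \<Rightarrow> bool" where
  "mp_monic n P \<longleftrightarrow> mp_coeff P n = mat 1 \<and> mp_degree_less (Suc n) P"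

lemma mp_coeff_nth: "mp_coeff P k $ i $ j = coeff (P $ i $ j) k"
  by (simp add: mp_coeff_def map_matrix_def)

lemma mp_coeff_add [simp]: "mp_coeff (P + Q) k = mp_coeff P k + mp_coeff Q k"
  and mp_coeff_diff [simp]: "mp_coeff (P - Q) k = mp_coeff P k - mp_coeff Q k"
  and mp_coeff_0 [simp]: "mp_coeff 0 k = 0"
  by (simp_all add: vec_eq_iff mp_coeff_nth)

lemma mp_coeff_sum [simp]: "mp_coeff (\<Sum>x\<in>A. f x) k = (\<Sum>x\<in>A. mp_coeff (f x) k)"
  by (induct A rule: infinite_finite_induct) simp_all

lemma mp_coeff_const_mult [simp]: "mp_coeff (mp_const A ** P) k = A ** mp_coeff P k"
  by (simp add: vec_eq_iff mp_coeff_nth matrix_matrix_mult_def mp_const_def map_matrix_def coeff_sum)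

lemma mp_degree_less_0: "mp_degree_less 0 P \<longleftrightarrow> P = 0"
  by (simp add: mp_degree_less_def vec_eq_iff mp_coeff_nth poly_eq_iff) metis

lemma mat_1_neq_0: "(mat 1 :: complex^'n^'n::finite) \<noteq> 0"
  by (simp add: vec_eq_iff mat_def)

lemma coeff_eq_0_above_mp_degree: "mp_degree P < k \<Longrightarrow> mp_coeff P k = 0"
proof -
  assume k: "mp_degree P < k"
  have "degree (P $ i $ j) \<le> mp_degree P" for i j
    unfolding mp_degree_def by (rule Max_ge) auto
  then show ?thesis using k by (auto simp: vec_eq_iff mp_coeff_nth intro!: coeff_eq_0 intro: le_less_trans)
qed

lemma mp_monic_iff: "mp_degree P = n \<and> mp_lead_coeff P = mat 1 \<longleftrightarrow> mp_monic n P"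
proof
  assume "mp_degree P = n \<and> mp_lead_coeff P = mat 1"
  then show "mp_monic n P"
    using coeff_eq_0_above_mp_degree[of P] unfolding mp_monic_def mp_degree_less_def mp_lead_coeff_def
    by (metis Suc_le_lessD)
next
  assume P: "mp_monic n P"
  have "mp_degree P \<le> n"
  proof -
    have "degree (P $ i $ j) \<le> n" for i j
    proof (rule degree_le)
      show "\<forall>k>n. coeff (P $ i $ j) k = 0"
        using P unfolding mp_monic_def mp_degree_less_def
        by (metis Suc_leI mp_coeff_nth zero_index)
    qed
    then show ?thesis unfolding mp_degree_def by (subst Max_le_iff) auto
  qed
  moreover have "\<not> mp_degree P < n"
    using coeff_eq_0_above_mp_degree[of P n] P mat_1_neq_0 unfolding mp_monic_def by metis
  ultimately show "mp_degree P = n \<and> mp_lead_coeff P = mat 1"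
    using P unfolding mp_monic_def mp_lead_coeff_def by simp
qed

lemma invertible_mint_monic:
  assumes "weight_matrix W" "mp_monic n P" shows "invertible (mint W P P)"
proof -
  have "mp_lead_coeff P = mat 1" using assms(2) by (simp flip: mp_monic_iff)
  moreover have "invertible (mat 1 :: complex^'n^'n)" unfolding invertible_def by (intro exI[of _ "mat 1"]) simp
  ultimately show ?thesis using weight_matrixD(4)[OF assms(1), of P] by simp
qed

lemma invertible_mult_eq_0:
  assumes "invertible (B :: complex^'n^'n)" "A ** B = 0" shows "A = 0"
proof -
  obtain C where "B ** C = mat 1" using assms(1) unfolding invertible_def by blast
  then have "A = (A ** B) ** C" by (simp flip: matrix_mul_assoc)
  then show ?thesis using assms(2) by simp
qed

lemma mp_degree_less_mono: "mp_degree_less m P \<Longrightarrow> m \<le> n \<Longrightarrow> mp_degree_less n P"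
  by (simp add: mp_degree_less_def)

lemma mp_monic_degree_less: "mp_monic k P \<Longrightarrow> k < n \<Longrightarrow> mp_degree_less n P"
  using mp_degree_less_mono[of "Suc k" P n] by (simp add: mp_monic_def)

lemma mp_degree_less_monic_reduce:
  assumes "mp_monic n P" "mp_degree_less (Suc n) R"
  shows "mp_degree_less n (R - mp_const (mp_coeff R n) ** P)"
  unfolding mp_degree_less_def
proof (intro allI impI)
  fix k assume "n \<le> k"
  then show "mp_coeff (R - mp_const (mp_coeff R n) ** P) k = 0"
    using assms by (cases "k = n") (auto simp: mp_monic_def mp_degree_less_def)
qed

lemma monic_expansion:
  assumes "\<And>k. k < n \<Longrightarrow> mp_monic k (P k)" "mp_degree_less n R"
  shows "\<exists>A. R = (\<Sum>k<n. mp_const (A k) ** P k)"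
  using assms
proof (induct n arbitrary: R)
  case 0
  then show ?case by (simp add: mp_degree_less_0)
next
  case (Suc m)
  define B where "B = mp_coeff R m"
  have "mp_degree_less m (R - mp_const B ** P m)"
    unfolding B_def using Suc by (intro mp_degree_less_monic_reduce) auto
  then obtain A where A: "R - mp_const B ** P m = (\<Sum>k<m. mp_const (A k) ** P k)"
    using Suc by fastforce
  have "R = (\<Sum>k<Suc m. mp_const ((A(m := B)) k) ** P k)"
    using A by (simp add: algebra_simps)
  then show ?case by blast
qed

lemma mp_const_0_mult [simp]: "mp_const 0 ** P = 0"
  by (simp add: vec_eq_iff mp_const_def map_matrix_def matrix_matrix_mult_def)

text \<open>A matrix polynomial of degree less than \<open>n\<close> which is orthogonal to the first \<open>n\<close> members of a
  monic orthogonal family vanishes, because its coefficients in that family do.\<close>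

lemma orthogonal_imp_eq_0:
  assumes W: "weight_matrix W"
    and P: "\<And>k. k < n \<Longrightarrow> mp_monic k (P k)" "\<And>k l. k < n \<Longrightarrow> l < n \<Longrightarrow> k \<noteq> l \<Longrightarrow> mint W (P k) (P l) = 0"
    and R: "mp_degree_less n R" "\<And>k. k < n \<Longrightarrow> mint W R (P k) = 0"
  shows "R = 0"
proof -
  note W' = weight_matrix_imp_moment_matrix[OF W]
  obtain A where A: "R = (\<Sum>k<n. mp_const (A k) ** P k)" using monic_expansion[OF P(1) R(1)] by blast
  have "A l = 0" if l: "l < n" for l
  proof -
    have "mint W R (P l) = (\<Sum>k<n. A k ** mint W (P k) (P l))"
      by (simp add: A mint_sum_left[OF W'] mint_const_left[OF W'])
    also have "\<dots> = (\<Sum>k<n. if k = l then A l ** mint W (P l) (P l) else 0)"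
      by (rule sum.cong) (use P(2) l in auto)
    also have "\<dots> = A l ** mint W (P l) (P l)" using l by simp
    finally show ?thesis using R(2)[OF l] invertible_mint_monic[OF W P(1)[OF l]] invertible_mult_eq_0 by metis
  qed
  then have "R = (\<Sum>k<n. 0)" unfolding A by (intro sum.cong) auto
  then show ?thesis by simp
qed

lemma mint_lower_eq_0:
  assumes W: "moment_matrix W" and P: "\<And>k. k < n \<Longrightarrow> mp_monic k (P k)"
    and R: "\<And>k. k < n \<Longrightarrow> mint W R (P k) = 0" and Q: "mp_degree_less n Q"
  shows "mint W R Q = 0"
proof -
  obtain A where A: "Q = (\<Sum>k<n. mp_const (A k) ** P k)" using monic_expansion[OF P Q] by blast
  have "mint W (P k) R = 0" if "k < n" for k using R[OF that] mint_eq_0_commute[OF W] by blast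
  then have "mint W Q R = 0"
    by (simp add: A mint_sum_left[OF W] mint_const_left[OF W])
  then show ?thesis using mint_eq_0_commute[OF W] by blast
qed

lemma monic_orthogonal_iff:
  "monic_orthogonal W P \<longleftrightarrow> (\<forall>n. mp_monic n (P n)) \<and> (\<forall>n m. n \<noteq> m \<longrightarrow> mint W (P n) (P m) = 0)"
  unfolding monic_orthogonal_def mp_monic_iff ..

lemma monic_orthogonal_lower:
  assumes W: "moment_matrix W" and P: "monic_orthogonal W P" and Q: "mp_degree_less n Q"
  shows "mint W (P n) Q = 0"
  using P by (intro mint_lower_eq_0[OF W _ _ Q, of P]) (auto simp: monic_orthogonal_iff)

lemma monic_orthogonal_unique:
  assumes W: "weight_matrix W" and P: "monic_orthogonal W P" and Q: "monic_orthogonal W Q"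
  shows "P = Q"
proof
  fix n
  note W' = weight_matrix_imp_moment_matrix[OF W]
  have m: "mp_monic n (P n)" "mp_monic n (Q n)" for n
    using P Q unfolding monic_orthogonal_iff by blast+
  have o: "mint W (P k) (P l) = 0" if "k \<noteq> l" for k l
    using P that unfolding monic_orthogonal_iff by blast
  have "P n - Q n = 0"
  proof (rule orthogonal_imp_eq_0[OF W, of n P])
    have "mp_degree_less n (P n - mp_const (mp_coeff (P n) n) ** Q n)"
      using m by (intro mp_degree_less_monic_reduce) (auto simp: mp_monic_def)
    moreover have "mp_const (mat 1) ** Q n = Q n"
    proof -
      have "mp_const (mat 1) = (mat 1 :: 'a matpoly)"
        by (simp add: vec_eq_iff mp_const_def map_matrix_def mat_def one_pCons)
      then show ?thesis by simp
    qed
    ultimately show "mp_degree_less n (P n - Q n)" using m(1)[of n] by (simp add: mp_monic_def)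
    fix k assume k: "k < n"
    have "mint W (Q n) (P k) = 0"
      by (rule monic_orthogonal_lower[OF W' Q mp_monic_degree_less[OF m(1) k]])
    then show "mint W (P n - Q n) (P k) = 0"
      using o[of n k] k by (simp add: mint_diff_left[OF W'])
  qed (use m o in auto)
  then show "P n = Q n" by simp
qed

text \<open>Existence is the Gram--Schmidt process.\<close>

lemma monic_orthogonal_exists:
  fixes W :: "'n::finite mat_setfun"
  assumes W: "weight_matrix W"
  shows "\<exists>P. monic_orthogonal W P"
proof -
  note W' = weight_matrix_imp_moment_matrix[OF W]
  define good where "good n P \<longleftrightarrow> mp_monic n P \<and> (\<forall>Q. mp_degree_less n Q \<longrightarrow> mint W P Q = 0)" for n P
  have "\<exists>P. good n P" for n
  proof (induct n rule: less_induct)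
    case (less n)
    then obtain P where P: "\<And>k. k < n \<Longrightarrow> good k (P k)" by metis
    then have m: "mp_monic k (P k)" if "k < n" for k using that by (simp add: good_def)
    have o: "mint W (P k) (P l) = 0" if kl: "k < n" "l < n" "k \<noteq> l" for k l
    proof (cases "l < k")
      case True
      then show ?thesis using P[OF kl(1)] mp_monic_degree_less[OF m[OF kl(2)] True] by (simp add: good_def)
    next
      case False
      then have "k < l" using kl by simp
      then have "mint W (P l) (P k) = 0"
        using P[OF kl(2)] mp_monic_degree_less[OF m[OF kl(1)]] by (simp add: good_def)
      then show ?thesis using mint_eq_0_commute[OF W'] by blast
    qed
    have "\<forall>k<n. \<exists>C. C ** mint W (P k) (P k) = mat 1"
      using invertible_mint_monic[OF W m] unfolding invertible_def by blast
    then obtain C where C: "\<And>k. k < n \<Longrightarrow> C k ** mint W (P k) (P k) = mat 1" by metis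
    \<comment> \<open>\<open>X\<close> is \<open>t\<^sup>n\<close> times the identity, and \<open>R\<close> is \<open>X\<close> minus its projection.\<close>
    define X :: "'n matpoly" where "X = (\<chi> i j. if i = j then monom 1 n else 0)"
    have X: "mp_coeff X k = (if k = n then mat 1 else 0)" for k
      by (auto simp: vec_eq_iff mp_coeff_nth X_def mat_def)
    define R where "R = X - (\<Sum>k<n. mp_const (mint W X (P k) ** C k) ** P k)"
    have c: "(\<Sum>k<n. (mint W X (P k) ** C k) ** mp_coeff (P k) l) = 0" if "n \<le> l" for l
    proof (rule sum.neutral, rule ballI)
      fix k assume k: "k \<in> {..<n}"
      then have "mp_coeff (P k) l = 0"
        using mp_monic_degree_less[OF m, of k n] that by (simp add: mp_degree_less_def)
      then show "(mint W X (P k) ** C k) ** mp_coeff (P k) l = 0" by simp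
    qed
    have R: "mp_monic n R"
      using c by (simp add: R_def mp_monic_def mp_degree_less_def X)
    have Ro: "mint W R (P l) = 0" if l: "l < n" for l
    proof -
      have "mint W R (P l) = mint W X (P l) - (\<Sum>k<n. (mint W X (P k) ** C k) ** mint W (P k) (P l))"
        by (simp add: R_def mint_diff_left[OF W'] mint_sum_left[OF W'] mint_const_left[OF W'])
      also have "(\<Sum>k<n. (mint W X (P k) ** C k) ** mint W (P k) (P l)) =
        (\<Sum>k<n. if k = l then mint W X (P l) else 0)"
      proof (rule sum.cong)
        fix k assume "k \<in> {..<n}"
        then show "(mint W X (P k) ** C k) ** mint W (P k) (P l) = (if k = l then mint W X (P l) else 0)"
          using o[of k l] l C[of l] by (auto simp flip: matrix_mul_assoc)
      qed simp
      finally show ?thesis using l by simp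
    qed
    have "good n R" unfolding good_def using R mint_lower_eq_0[OF W' m Ro] by blast
    then show ?case by blast
  qed
  then obtain P where P: "\<And>n. good n (P n)" by metis
  then have m: "mp_monic n (P n)" for n by (simp add: good_def)
  have l: "mint W (P n) (P k) = 0" if "k < n" for n k
    using P[of n] mp_monic_degree_less[OF m that] by (simp add: good_def)
  have "mint W (P n) (P k) = 0" if "n \<noteq> k" for n k
    using l[of k n] l[of n k] that mint_eq_0_commute[OF W', of "P n" "P k"] by (metis linorder_neqE_nat)
  then show ?thesis using m unfolding monic_orthogonal_iff by blast
qed

text \<open>A symmetric operator which does not raise degrees has the monic orthogonal polynomials as
  eigenfunctions: \<open>P\<^sub>nD\<close> is orthogonal to all polynomials of degree less than \<open>n\<close>.\<close>

lemma symmetric_imp_eigenfunction: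
  assumes W: "weight_matrix W" and P: "monic_orthogonal W P" and D: "symmetric_wrt D W"
    and deg: "\<And>n Q. mp_degree_less n Q \<Longrightarrow> mp_degree_less n (D Q)"
  shows "D (P n) = mp_const (mp_coeff (D (P n)) n) ** P n"
proof -
  note W' = weight_matrix_imp_moment_matrix[OF W]
  have m: "mp_monic n (P n)" for n using P unfolding monic_orthogonal_iff by blast
  have o: "mint W (P k) (P l) = 0" if "k \<noteq> l" for k l
    using P that unfolding monic_orthogonal_iff by blast
  have "D (P n) - mp_const (mp_coeff (D (P n)) n) ** P n = 0"
  proof (rule orthogonal_imp_eq_0[OF W, of n P])
    show "mp_degree_less n (D (P n) - mp_const (mp_coeff (D (P n)) n) ** P n)"
      by (intro mp_degree_less_monic_reduce m deg mp_monic_degree_less[OF m]) simp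
    fix k assume k: "k < n"
    have "mint W (D (P n)) (P k) = mint W (P n) (D (P k))" using D by (simp add: symmetric_wrt_def)
    also have "\<dots> = 0"
      by (intro monic_orthogonal_lower[OF W' P] deg mp_monic_degree_less[OF m k])
    finally show "mint W (D (P n) - mp_const (mp_coeff (D (P n)) n) ** P n) (P k) = 0"
      using o[of n k] k by (simp add: mint_diff_left[OF W'] mint_const_left[OF W'])
  qed (use m o in auto)
  then show ?thesis by simp
qed


section \<open>The Gaussian moment functional\<close>

text \<open>Completing the square in \<open>- t\<^sup>2 + u \<bar>t\<bar>\<close> leaves half of the exponent, a standard normal density.\<close>

lemma integrable_gauss:
  "integrable lborel (\<lambda>t::real. exp (- t\<^sup>2) * (t ^ n * exp (u * \<bar>t\<bar>)))"
proof (rule Bochner_Integration.integrable_bound)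
  let ?c = "exp (u\<^sup>2 / 2) * sqrt (2 * pi)"
  show "integrable lborel (\<lambda>t. ?c * (normal_density 0 1 t * \<bar>t - 0\<bar> ^ n))"
    by (intro integrable_mult_right integrable_normal_moment_abs) simp
  show "AE t in lborel. norm (exp (- t\<^sup>2) * (t ^ n * exp (u * \<bar>t\<bar>))) \<le>
    norm (?c * (normal_density 0 1 t * \<bar>t - 0\<bar> ^ n))"
  proof (rule AE_I2)
    fix t :: real
    have "0 \<le> (\<bar>t\<bar> - u)\<^sup>2" by simp
    then have "- t\<^sup>2 + u * \<bar>t\<bar> \<le> u\<^sup>2 / 2 + - t\<^sup>2 / 2"
      by (simp add: power2_diff algebra_simps)
    then have "exp (- t\<^sup>2 + u * \<bar>t\<bar>) \<le> exp (u\<^sup>2 / 2 + - t\<^sup>2 / 2)" by simp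
    then have "(exp (- t\<^sup>2) * exp (u * \<bar>t\<bar>)) * \<bar>t\<bar> ^ n \<le> (exp (u\<^sup>2 / 2) * exp (- t\<^sup>2 / 2)) * \<bar>t\<bar> ^ n"
      unfolding exp_add by (rule mult_right_mono) simp
    moreover have "?c * (normal_density 0 1 t * \<bar>t - 0\<bar> ^ n) = (exp (u\<^sup>2 / 2) * exp (- t\<^sup>2 / 2)) * \<bar>t\<bar> ^ n"
      by (simp add: normal_density_def)
    moreover have "norm (exp (- t\<^sup>2) * (t ^ n * exp (u * \<bar>t\<bar>))) = (exp (- t\<^sup>2) * exp (u * \<bar>t\<bar>)) * \<bar>t\<bar> ^ n"
      by (simp add: abs_mult power_abs)
    ultimately show "norm (exp (- t\<^sup>2) * (t ^ n * exp (u * \<bar>t\<bar>))) \<le>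
      norm (?c * (normal_density 0 1 t * \<bar>t - 0\<bar> ^ n))"
      unfolding real_norm_def[of "?c * _"] by linarith
  qed
qed measurable

lemma integrable_gauss_power: "integrable lborel (\<lambda>t::real. exp (- t\<^sup>2) * t ^ n)"
  using integrable_gauss[of n 0] by simp

lemma integrable_gauss_poly:
  "integrable lborel (\<lambda>t. exp (- t\<^sup>2) *\<^sub>R (poly p (of_real t) :: complex))"
proof -
  have "exp (- t\<^sup>2) *\<^sub>R (poly p (of_real t) :: complex) =
    (\<Sum>n\<le>degree p. coeff p n * of_real (exp (- t\<^sup>2) * t ^ n))" for t
    unfolding poly_of_real_eq_sum by (simp add: scaleR_conv_of_real sum_distrib_left mult_ac)
  then show ?thesis
    by (simp only:) (intro Bochner_Integration.integrable_sum integrable_mult_right integrable_of_real integrable_gauss_power)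
qed

text \<open>Integration of a polynomial against \<open>exp(-t\<^sup>2) dt\<close>.\<close>

definition gauss_mom :: "complex poly \<Rightarrow> complex" where
  "gauss_mom p = (LINT t|lborel. exp (- t\<^sup>2) *\<^sub>R poly p (of_real t))"

lemma gauss_mom_add: "gauss_mom (p + q) = gauss_mom p + gauss_mom q"
  unfolding gauss_mom_def by (simp add: scaleR_add_right integrable_gauss_poly)

lemma gauss_mom_diff: "gauss_mom (p - q) = gauss_mom p - gauss_mom q"
  unfolding gauss_mom_def by (simp add: scaleR_diff_right integrable_gauss_poly)

lemma gauss_mom_smult: "gauss_mom (smult c p) = c * gauss_mom p"
  unfolding gauss_mom_def by (simp flip: mult_scaleR_right)

lemma gauss_mom_0 [simp]: "gauss_mom 0 = 0"
  by (simp add: gauss_mom_def)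

lemma gauss_mom_sum: "gauss_mom (\<Sum>x\<in>A. f x) = (\<Sum>x\<in>A. gauss_mom (f x))"
  by (induct A rule: infinite_finite_induct) (simp_all add: gauss_mom_add)

lemma gauss_mom_norm:
  shows "gauss_mom (p * cnj_poly p) = of_real (LINT t|lborel. exp (- t\<^sup>2) * (norm (poly p (of_real t)))\<^sup>2)"
    and "integrable lborel (\<lambda>t. exp (- t\<^sup>2) * (norm (poly p (of_real t)))\<^sup>2)"
proof -
  have *: "exp (- t\<^sup>2) *\<^sub>R poly (p * cnj_poly p) (of_real t) =
    complex_of_real (exp (- t\<^sup>2) * (norm (poly p (of_real t)))\<^sup>2)" for t :: real
    by (simp add: scaleR_conv_of_real flip: complex_norm_square)
  show "gauss_mom (p * cnj_poly p) = of_real (LINT t|lborel. exp (- t\<^sup>2) * (norm (poly p (of_real t)))\<^sup>2)"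
    unfolding gauss_mom_def * by (rule integral_complex_of_real)
  show "integrable lborel (\<lambda>t. exp (- t\<^sup>2) * (norm (poly p (of_real t)))\<^sup>2)"
    using integrable_gauss_poly[of "p * cnj_poly p"] unfolding * complex_of_real_integrable_eq .
qed

lemma gauss_mom_norm_nonneg: "gauss_mom (p * cnj_poly p) = of_real (Re (gauss_mom (p * cnj_poly p)))" "0 \<le> Re (gauss_mom (p * cnj_poly p))"
  by (simp_all add: gauss_mom_norm)

lemma gauss_mom_norm_eq_0:
  assumes "gauss_mom (p * cnj_poly p) = 0" shows "p = 0"
proof (rule ccontr)
  assume p: "p \<noteq> 0"
  have "(LINT t|lborel. exp (- t\<^sup>2) * (norm (poly p (of_real t)))\<^sup>2) = 0"
    using assms by (simp add: gauss_mom_norm)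
  then have ae: "AE t in lborel. exp (- t\<^sup>2) * (norm (poly p (of_real t)))\<^sup>2 = 0"
    by (subst (asm) integral_nonneg_eq_0_iff_AE) (auto simp: gauss_mom_norm)
  define F where "F = {t::real. poly p (of_real t) = 0}"
  have "finite (of_real ` F :: complex set)"
    by (rule finite_subset[OF _ poly_roots_finite[OF p]]) (auto simp: F_def)
  then have F: "finite F" by (rule finite_imageD) (simp add: inj_on_def)
  then have "F \<in> null_sets lborel" by (simp add: finite_imp_null_set_lborel)
  then have "AE t in lborel. t \<notin> F" by (rule AE_not_in)
  with ae have "AE t in (lborel :: real measure). t \<noteq> t" by eventually_elim (simp add: F_def)
  then show False by (simp add: AE_iff_null null_sets_def)
qed

lemma gauss_mom_monom: "gauss_mom (monom 1 n) = of_real (LINT t|lborel. exp (- t\<^sup>2) * t ^ n)"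
proof -
  have "exp (- t\<^sup>2) *\<^sub>R poly (monom 1 n) (of_real t) = complex_of_real (exp (- t\<^sup>2) * t ^ n)" for t :: real
    by (simp add: poly_monom scaleR_conv_of_real)
  then show ?thesis unfolding gauss_mom_def by (simp only: integral_complex_of_real)
qed

lemma gauss_mom_monom_rec: "gauss_mom (monom 1 (n + 2)) = of_nat (n + 1) / 2 * gauss_mom (monom 1 n)"
  and gauss_mom_X: "gauss_mom (monom 1 1) = 0"
  and gauss_mom_1: "gauss_mom 1 = of_real (sqrt pi)"
proof -
  define g where "g n = (LINT t|lborel. exp (- t\<^sup>2) * t ^ n :: real)" for n :: nat
  note g = gauss_mom_monom[folded g_def]
  have ev: "g (2 * k) = sqrt pi * (fact (2 * k) / (2 ^ (2 * k) * fact k))" for k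
    using has_bochner_integral_even_function[OF gaussian_moment_even_pos[where k=k]]
    by (simp add: g_def has_bochner_integral_iff)
  have od: "g (2 * k + 1) = 0" for k
    using has_bochner_integral_odd_function[OF gaussian_moment_odd_pos[where k=k]]
    by (simp add: g_def has_bochner_integral_iff)
  have "g (n + 2) = (n + 1) / 2 * g n"
  proof (cases "even n")
    case True
    then obtain k where k: "n = 2 * k" by (elim evenE)
    have "g (2 * (k + 1)) = (2 * k + 1) / 2 * g (2 * k)"
    proof -
      have "fact (2 * (k + 1)) = 2 * (real k + 1) * ((2 * real k + 1) * fact (2 * k))"
        by (simp add: algebra_simps)
      moreover have "2 ^ (2 * (k + 1)) * fact (k + 1) = 2 * (real k + 1) * (2 * (2 ^ (2 * k) * fact k))"
        by (simp add: algebra_simps)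
      moreover have "2 * (real k + 1) \<noteq> 0" by simp
      ultimately have "fact (2 * (k + 1)) / (2 ^ (2 * (k + 1)) * fact (k + 1)) =
        ((2 * real k + 1) * fact (2 * k)) / (2 * (2 ^ (2 * k) * fact k))"
        by (metis mult_divide_mult_cancel_left)
      then show ?thesis unfolding ev by simp
    qed
    then show ?thesis by (simp add: k)
  next
    case False
    then obtain k where k: "n = 2 * k + 1" by (elim oddE)
    show ?thesis using od[of "k + 1"] od[of k] by (simp add: k)
  qed
  then have "complex_of_real (g (n + 2)) = of_real (real (n + 1) / 2 * g n)" by (simp only:)
  also have "\<dots> = of_nat (n + 1) / 2 * complex_of_real (g n)" by simp
  finally show "gauss_mom (monom 1 (n + 2)) = of_nat (n + 1) / 2 * gauss_mom (monom 1 n)" unfolding g .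
  show "gauss_mom (monom 1 1) = 0" unfolding g using od[of 0] by simp
  show "gauss_mom 1 = of_real (sqrt pi)" using ev[of 0] g[of 0] by (simp add: monom_0 one_pCons)
qed

text \<open>The polynomial \<open>t\<close>.\<close>

abbreviation polyX :: "complex poly" where
  "polyX \<equiv> [:0, 1:]"

text \<open>Integration by parts, here read off from the values of the moments.\<close>

lemma gauss_mom_pderiv: "gauss_mom (pderiv p) = 2 * gauss_mom (polyX * p)"
proof -
  have m: "gauss_mom (pderiv (monom c n)) = 2 * gauss_mom (polyX * monom c n)" for c n
  proof -
    have c: "gauss_mom (monom c k) = c * gauss_mom (monom 1 k)" for c k
      using gauss_mom_smult[of c "monom 1 k"] by (simp add: smult_monom)
    have X: "polyX * monom c n = monom c (n + 1)" by (simp add: monom_altdef)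
    show ?thesis
    proof (cases n)
      case 0
      then show ?thesis unfolding X using gauss_mom_X c[of c 1] by (simp add: pderiv_monom)
    next
      case (Suc k)
      then show ?thesis unfolding X pderiv_monom
        using gauss_mom_monom_rec[of k] c[of c "k + 2"] c[of "of_nat (Suc k) * c" k]
        by (simp add: field_simps)
    qed
  qed
  have "gauss_mom (pderiv (\<Sum>i\<le>degree p. monom (coeff p i) i)) = 2 * gauss_mom (polyX * (\<Sum>i\<le>degree p. monom (coeff p i) i))"
    unfolding higher_pderiv_sum[of 1, simplified] sum_distrib_left gauss_mom_sum m ..
  then show ?thesis unfolding poly_as_sum_of_monoms .
qed

text \<open>The relation \<open>L(p') = 2 L(t p)\<close> determines a linear functional up to a factor: it reduces
  \<open>L(t r)\<close> to \<open>L(r')\<close>, which has a lower degree.\<close>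

lemma gauss_mom_relation_eq_0:
  fixes L :: "complex poly \<Rightarrow> complex"
  assumes add: "\<And>p q. L (p + q) = L p + L q" and smult: "\<And>c p. L (smult c p) = c * L p"
    and rel: "\<And>p. L (pderiv p) = 2 * L (polyX * p)" and one: "L 1 = 0"
  shows "L p = 0"
proof (induct "degree p" arbitrary: p rule: less_induct)
  case less
  obtain c r where p: "p = pCons c r" by (cases p)
  have "p = smult c 1 + polyX * r" by (simp add: p)
  then have "L p = L (polyX * r)" by (simp only: add smult one) simp
  moreover have "L (polyX * r) = 0"
  proof (cases "r = 0")
    case True
    then show ?thesis using smult[of 0 0] by simp
  next
    case False
    have "degree (pderiv r) < degree p" using False by (simp add: p degree_pderiv)
    from less[OF this] show ?thesis using rel[of r] by simp
  qed
  ultimately show ?case by simp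
qed


section \<open>Densities with a point mass\<close>

lemma density_lborel:
  assumes [measurable]: "h \<in> borel_measurable borel" and nonneg: "\<And>t. 0 \<le> h t" and int: "integrable lborel h"
  shows "finite_borel_measure (density lborel h)"
    and "\<Omega> \<in> sets borel \<Longrightarrow> measure (density lborel h) \<Omega> = (LINT t:\<Omega>|lborel. h t)"
proof -
  have e: "emeasure (density lborel h) \<Omega> = ennreal (LINT t:\<Omega>|lborel. h t)"
    if [measurable]: "\<Omega> \<in> sets borel" for \<Omega> :: "real set"
  proof -
    have "emeasure (density lborel h) \<Omega> = (\<integral>\<^sup>+t. ennreal (indicator \<Omega> t * h t) \<partial>lborel)"
      by (subst emeasure_density) (auto intro!: nn_integral_cong simp: indicator_def)
    also have "\<dots> = ennreal (LINT t|lborel. indicator \<Omega> t * h t)"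
      using integrable_mult_indicator[OF _ int, of \<Omega>]
      by (intro nn_integral_eq_integral) (auto simp: nonneg)
    finally show ?thesis by (simp add: set_lebesgue_integral_def)
  qed
  show "finite_borel_measure (density lborel h)"
    by (rule finite_borel_measureI) (simp_all add: e)
  show "measure (density lborel h) \<Omega> = (LINT t:\<Omega>|lborel. h t)" if "\<Omega> \<in> sets borel"
    using e[OF that] by (simp add: measure_def set_lebesgue_integral_def nonneg)
qed

text \<open>The measure \<open>\<zeta> \<delta>\<^sub>0\<close>, for \<open>\<zeta> \<ge> 0\<close>.\<close>

definition point_mass :: "real \<Rightarrow> real measure" where
  "point_mass \<zeta> = density (return borel 0) (\<lambda>_. ennreal \<zeta>)"

lemma point_mass:
  assumes \<zeta>: "0 \<le> \<zeta>"
  shows "finite_borel_measure (point_mass \<zeta>)"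
    and "\<Omega> \<in> sets borel \<Longrightarrow> measure (point_mass \<zeta>) \<Omega> = \<zeta> * indicator \<Omega> 0"
proof -
  have e: "emeasure (point_mass \<zeta>) \<Omega> = ennreal (\<zeta> * indicator \<Omega> 0)" if "\<Omega> \<in> sets borel" for \<Omega>
    using that by (simp add: point_mass_def emeasure_density_const indicator_def)
  show "finite_borel_measure (point_mass \<zeta>)"
    by (rule finite_borel_measureI) (simp_all add: e point_mass_def[THEN arg_cong[where f=sets]])
  show "measure (point_mass \<zeta>) \<Omega> = \<zeta> * indicator \<Omega> 0" if "\<Omega> \<in> sets borel"
    using that \<zeta> by (simp add: measure_def e)
qed

lemma point_mass_integral:
  fixes f :: "real \<Rightarrow> 'b :: {banach, second_countable_topology}"
  assumes \<zeta>: "0 \<le> \<zeta>" and [measurable]: "f \<in> borel_measurable borel"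
  shows "integrable (point_mass \<zeta>) f" "(LINT t|point_mass \<zeta>. f t) = \<zeta> *\<^sub>R f 0"
proof -
  have "integrable (return borel 0) (\<lambda>t. \<zeta> *\<^sub>R f t)"
    by (subst integrable_iff_bounded) (auto simp: nn_integral_return)
  then show "integrable (point_mass \<zeta>) f"
    unfolding point_mass_def using \<zeta> by (subst integrable_density) auto
  show "(LINT t|point_mass \<zeta>. f t) = \<zeta> *\<^sub>R f 0"
    unfolding point_mass_def using \<zeta> by (subst integral_density) (auto simp: integral_return)
qed

text \<open>The density \<open>g\<close> may change sign, so the signed measure \<open>g dt + \<zeta> \<delta>\<^sub>0\<close> is written as a difference of
  positive measures.\<close>

lemma density_point_mass:
  fixes g :: "real \<Rightarrow> real"
  assumes \<zeta>: "0 \<le> \<zeta>" and g [measurable]: "g \<in> borel_measurable borel" and int: "integrable lborel g"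
  defines "M \<equiv> add_measure (density lborel (\<lambda>t. max 0 (g t))) (point_mass \<zeta>)"
    and "N \<equiv> density lborel (\<lambda>t. max 0 (- g t))"
  shows "finite_borel_measure M" "finite_borel_measure N"
    and "\<And>\<Omega>. \<Omega> \<in> sets borel \<Longrightarrow> (LINT t:\<Omega>|lborel. g t) + \<zeta> * indicator \<Omega> 0 = measure M \<Omega> - measure N \<Omega>"
proof -
  have i: "integrable lborel (\<lambda>t. max 0 (g t))" "integrable lborel (\<lambda>t. max 0 (- g t))"
    using int by auto
  have d1: "finite_borel_measure (density lborel (\<lambda>t. max 0 (g t)))"
    by (rule density_lborel) (use i in auto)
  show "finite_borel_measure M" unfolding M_def by (intro add_measure d1 point_mass \<zeta>)
  show "finite_borel_measure N" unfolding N_def by (rule density_lborel) (use i in auto)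
  fix \<Omega> :: "real set" assume \<Omega>: "\<Omega> \<in> sets borel"
  have "(LINT t:\<Omega>|lborel. max 0 (g t)) - (LINT t:\<Omega>|lborel. max 0 (- g t)) =
    (LINT t:\<Omega>|lborel. max 0 (g t) - max 0 (- g t))"
    unfolding set_lebesgue_integral_def
    using Bochner_Integration.integral_diff[OF integrable_mult_indicator[OF _ i(1), of \<Omega>] integrable_mult_indicator[OF _ i(2), of \<Omega>]] \<Omega>
    by (simp add: right_diff_distrib)
  also have "(\<lambda>t. max 0 (g t) - max 0 (- g t)) = g" by (auto simp: max_def)
  finally have "(LINT t:\<Omega>|lborel. max 0 (g t)) - (LINT t:\<Omega>|lborel. max 0 (- g t)) = (LINT t:\<Omega>|lborel. g t)" .
  moreover have "measure M \<Omega> = (LINT t:\<Omega>|lborel. max 0 (g t)) + \<zeta> * indicator \<Omega> 0"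
    unfolding M_def add_measure(2)[OF d1 point_mass(1)[OF \<zeta>] \<Omega>] point_mass(2)[OF \<zeta> \<Omega>]
    using \<Omega> i by (subst density_lborel(2)) auto
  moreover have "measure N \<Omega> = (LINT t:\<Omega>|lborel. max 0 (- g t))"
    unfolding N_def using \<Omega> i by (intro density_lborel(2)) auto
  ultimately show "(LINT t:\<Omega>|lborel. g t) + \<zeta> * indicator \<Omega> 0 = measure M \<Omega> - measure N \<Omega>" by simp
qed

lemma
  fixes g :: "real \<Rightarrow> real"
  assumes \<zeta>: "0 \<le> \<zeta>" and g [measurable]: "g \<in> borel_measurable borel" and int: "integrable lborel g"
    and \<nu>: "\<And>\<Omega>. \<Omega> \<in> sets borel \<Longrightarrow> \<nu> \<Omega> = complex_of_real ((LINT t:\<Omega>|lborel. g t) + \<zeta> * indicator \<Omega> 0)"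
  shows complex_measure_density_point_mass: "(\<And>\<Omega>. \<Omega> \<notin> sets borel \<Longrightarrow> \<nu> \<Omega> = 0) \<Longrightarrow> complex_measure \<nu>"
    and cm_integral_density_point_mass:
      "\<And>f. f \<in> borel_measurable borel \<Longrightarrow> integrable lborel (\<lambda>t. g t *\<^sub>R f t) \<Longrightarrow>
        cm_integral \<nu> f = (LINT t|lborel. g t *\<^sub>R f t) + \<zeta> *\<^sub>R f 0"
proof -
  let ?M1 = "density lborel (\<lambda>t. max 0 (g t))"
  let ?M = "add_measure ?M1 (point_mass \<zeta>)" and ?N = "density lborel (\<lambda>t. max 0 (- g t))"
  note d = density_point_mass[OF \<zeta> g int]
  show "complex_measure \<nu>" if "\<And>\<Omega>. \<Omega> \<notin> sets borel \<Longrightarrow> \<nu> \<Omega> = 0"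
    unfolding complex_measure_def
  proof (intro conjI allI impI that)
    fix A :: "nat \<Rightarrow> real set" assume A: "range A \<subseteq> sets borel" "disjoint_family A"
    have "(\<lambda>n. complex_of_real (measure ?M (A n) - measure ?N (A n))) sums
      complex_of_real (measure ?M (\<Union>n. A n) - measure ?N (\<Union>n. A n))"
      by (intro sums_of_real sums_diff finite_borel_measure_sums d(1,2) A)
    moreover have "\<nu> \<Omega> = complex_of_real (measure ?M \<Omega> - measure ?N \<Omega>)" if "\<Omega> \<in> sets borel" for \<Omega>
      using \<nu>[OF that] d(3)[OF that] by simp
    moreover have "A n \<in> sets borel" for n using A by auto
    ultimately show "(\<lambda>n. \<nu> (A n)) sums \<nu> (\<Union>n. A n)" by simp
  qed
  fix f :: "real \<Rightarrow> complex" assume f [measurable]: "f \<in> borel_measurable borel"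
    and fi: "integrable lborel (\<lambda>t. g t *\<^sub>R f t)"
  have i: "integrable lborel (\<lambda>t. max 0 (g t) *\<^sub>R f t)" "integrable lborel (\<lambda>t. max 0 (- g t) *\<^sub>R f t)"
    by (rule Bochner_Integration.integrable_bound[OF fi]; auto intro!: mult_right_mono)+
  have M1: "finite_borel_measure ?M1" by (rule density_lborel) (use int in auto)
  have I1: "integrable ?M1 f" "integrable ?N f"
    by (rule integrable_density[THEN iffD2, OF _ _ _ i(1)] integrable_density[THEN iffD2, OF _ _ _ i(2)]; simp)+
  have IM: "integrable ?M f"
    by (intro integrable_add_measure M1 point_mass \<zeta> I1 point_mass_integral) simp
  have e1: "integral\<^sup>L ?M f = (LINT t|lborel. max 0 (g t) *\<^sub>R f t) + \<zeta> *\<^sub>R f 0"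
    using add_measure_integral[OF M1 point_mass(1)[OF \<zeta>] IM] point_mass_integral(2)[OF \<zeta> f]
      integral_density[of f lborel "\<lambda>t. max 0 (g t)"] by simp
  have e2: "integral\<^sup>L ?N f = (LINT t|lborel. max 0 (- g t) *\<^sub>R f t)"
    using integral_density[of f lborel "\<lambda>t. max 0 (- g t)"] by simp
  have e3: "(LINT t|lborel. max 0 (g t) *\<^sub>R f t) - (LINT t|lborel. max 0 (- g t) *\<^sub>R f t)
    = (LINT t|lborel. g t *\<^sub>R f t)"
    by (subst Bochner_Integration.integral_diff[symmetric, OF i])
      (auto intro!: Bochner_Integration.integral_cong simp: max_def)
  have e4: "cm_integral \<nu> f = integral\<^sup>L ?M f - integral\<^sup>L ?N f"
  proof -
    let ?Z = "setfun_measure (\<lambda>_. 0)"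
    have Z: "integrable ?Z f"
      by (rule integrable_mono_measure[OF zero_measure(1) d(1) _ IM, of 1]) (simp add: zero_measure)
    have re: "Re (\<nu> \<Omega>) = measure ?M \<Omega> - measure ?N \<Omega>" if "\<Omega> \<in> sets borel" for \<Omega>
      using \<nu>[OF that] d(3)[OF that] by simp
    have im: "Im (\<nu> \<Omega>) = measure ?Z \<Omega> - measure ?Z \<Omega>" if "\<Omega> \<in> sets borel" for \<Omega>
      using \<nu>[OF that] by simp
    have "cm_integral \<nu> f = (integral\<^sup>L ?M f - integral\<^sup>L ?N f) + \<i> * (integral\<^sup>L ?Z f - integral\<^sup>L ?Z f)"
      by (rule cm_integral_eq(2)) (fact d(1,2) zero_measure(1) IM I1(2) Z | erule re im)+
    then show ?thesis unfolding diff_self mult_zero_right add_0_right .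
  qed
  show "cm_integral \<nu> f = (LINT t|lborel. g t *\<^sub>R f t) + \<zeta> *\<^sub>R f 0"
    unfolding e4 e1 e2 e3[symmetric] by (rule diff_add_eq[symmetric])
qed


section \<open>The weight matrices of the example\<close>

lemma mat22_nth [simp]:
  "mat22 a b c d $ 1 $ 1 = a" "mat22 a b c d $ 1 $ 2 = b"
  "mat22 a b c d $ 2 $ 1 = c" "mat22 a b c d $ 2 $ 2 = d"
  by (simp_all add: mat22_def)

text \<open>The matrix \<open>exp(t\<^sup>2) W\<^sub>a(t)\<close>, with real values and with polynomial entries.\<close>

definition weight_fun :: "real \<Rightarrow> real \<Rightarrow> real^2^2" where
  "weight_fun a t = mat22 (1 + a\<^sup>2 * t\<^sup>2) (a * t) (a * t) 1"

definition weight_poly :: "real \<Rightarrow> 2 matpoly" where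
  "weight_poly a = mat22 [:1, 0, of_real (a\<^sup>2):] [:0, of_real a:] [:0, of_real a:] 1"

lemma poly_weight_poly:
  "poly (weight_poly a $ i $ j) (of_real t) = of_real (weight_fun a t $ i $ j)"
proof -
  have "\<forall>i j. poly (weight_poly a $ i $ j) (of_real t) = of_real (weight_fun a t $ i $ j)"
    by (simp add: forall_2 weight_poly_def weight_fun_def power2_eq_square)
  then show ?thesis by blast
qed

lemma weight_fun_measurable [measurable]: "(\<lambda>t. weight_fun a t $ i $ j) \<in> borel_measurable borel"
proof -
  have "\<forall>i j. (\<lambda>t. weight_fun a t $ i $ j) \<in> borel_measurable borel"
    by (simp add: forall_2 weight_fun_def)
  then show ?thesis by blast
qed

lemma weight_density_poly:
  "(\<gamma> * (exp (- t\<^sup>2) * weight_fun a t $ i $ j)) *\<^sub>R (poly p (of_real t) :: complex) =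
    \<gamma> *\<^sub>R (exp (- t\<^sup>2) *\<^sub>R poly (weight_poly a $ i $ j * p) (of_real t))"
  by (simp add: poly_weight_poly scaleR_conv_of_real mult_ac)

lemma integrable_weight_density:
  "integrable lborel (\<lambda>t. \<gamma> * (exp (- t\<^sup>2) * weight_fun a t $ i $ j))"
proof -
  have "integrable lborel (\<lambda>t. complex_of_real (\<gamma> * (exp (- t\<^sup>2) * weight_fun a t $ i $ j)))"
    using integrable_scaleR_right[of \<gamma> lborel, OF integrable_gauss_poly[of "weight_poly a $ i $ j * 1"]]
    unfolding weight_density_poly[symmetric] by (simp add: scaleR_conv_of_real)
  then show ?thesis unfolding complex_of_real_integrable_eq .
qed

lemma Wa_dirac_entry:
  assumes "\<Omega> \<in> sets borel"
  shows "Wa_dirac a \<gamma> \<zeta> \<Omega> $ i $ j = complex_of_real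
    ((LINT t:\<Omega>|lborel. \<gamma> * (exp (- t\<^sup>2) * weight_fun a t $ i $ j)) + \<zeta> * indicator \<Omega> 0)"
proof -
  have "\<forall>i j. (exp (- t\<^sup>2) *\<^sub>R mat22 (of_real (1 + a\<^sup>2 * t\<^sup>2)) (of_real (a * t)) (of_real (a * t)) 1) $ i $ j
    = complex_of_real (exp (- t\<^sup>2) * weight_fun a t $ i $ j)" for t
    by (simp add: forall_2 weight_fun_def) (simp add: scaleR_conv_of_real)
  then have "Wa a \<Omega> $ i $ j = (LINT t:\<Omega>|lborel. complex_of_real (exp (- t\<^sup>2) * weight_fun a t $ i $ j))"
    using assms by (simp add: Wa_def density_matrix_def del: of_real_mult)
  moreover have "\<forall>i j. mat22 1 1 1 1 $ i $ j = (1::complex)" by (simp add: forall_2)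
  ultimately show ?thesis
    using assms by (simp add: Wa_dirac_def dirac_matrix_def set_integral_complex_of_real
      measure_return del: of_real_mult) (simp add: indicator_def scaleR_conv_of_real)
qed

lemma Wa_dirac_not_borel: "\<Omega> \<notin> sets borel \<Longrightarrow> Wa_dirac a \<gamma> \<zeta> \<Omega> = 0"
  by (simp add: Wa_dirac_def Wa_def density_matrix_def dirac_matrix_def measure_notin_sets)

lemma complex_measure_Wa_dirac:
  assumes "0 \<le> \<zeta>" shows "complex_measure (entry (Wa_dirac a \<gamma> \<zeta>) i j)"
  by (rule complex_measure_density_point_mass[OF assms _ integrable_weight_density[of \<gamma> a i j]])
    (simp_all add: entry_def Wa_dirac_entry Wa_dirac_not_borel)

lemma mom_Wa_dirac:
  assumes "0 \<le> \<zeta>"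
  shows "mom (Wa_dirac a \<gamma> \<zeta>) i j p = \<gamma> * gauss_mom (weight_poly a $ i $ j * p) + \<zeta> * poly p 0"
proof -
  have "mom (Wa_dirac a \<gamma> \<zeta>) i j p =
    (LINT t|lborel. (\<gamma> * (exp (- t\<^sup>2) * weight_fun a t $ i $ j)) *\<^sub>R poly p (of_real t)) + \<zeta> *\<^sub>R poly p (of_real 0)"
    unfolding mom_def
  proof (rule cm_integral_density_point_mass[OF assms _ integrable_weight_density[of \<gamma> a i j]])
    show "(\<lambda>t. poly p (of_real t) :: complex) \<in> borel_measurable borel"
      by (intro borel_measurable_continuous_onI continuous_intros)
    show "integrable lborel (\<lambda>t. (\<gamma> * (exp (- t\<^sup>2) * weight_fun a t $ i $ j)) *\<^sub>R (poly p (of_real t) :: complex))"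
      unfolding weight_density_poly by (intro integrable_scaleR_right integrable_gauss_poly)
  qed (simp_all add: entry_def Wa_dirac_entry)
  also have "\<dots> = \<gamma> *\<^sub>R gauss_mom (weight_poly a $ i $ j * p) + \<zeta> *\<^sub>R poly p (of_real 0)"
    unfolding weight_density_poly gauss_mom_def using integrable_gauss_poly
    by (subst integral_scaleR_right) auto
  finally show ?thesis by (simp add: scaleR_conv_of_real)
qed

lemma pos_semidef_Wa_dirac:
  assumes \<gamma>: "0 \<le> \<gamma>" and \<zeta>: "0 \<le> \<zeta>" and \<Omega>: "\<Omega> \<in> sets borel"
  shows "pos_semidef (Wa_dirac a \<gamma> \<zeta> \<Omega>)"
proof -
  define g where "g i j t = \<gamma> * (exp (- t\<^sup>2) * weight_fun a t $ i $ j)" for i j t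
  define E where "E i j = (LINT t:\<Omega>|lborel. g i j t) + \<zeta> * indicator \<Omega> 0" for i j
  have e: "Wa_dirac a \<gamma> \<zeta> \<Omega> $ i $ j = complex_of_real (E i j)" for i j
    unfolding Wa_dirac_entry[OF \<Omega>] E_def g_def ..
  have g12: "g 2 1 = g 1 2" by (simp add: g_def weight_fun_def fun_eq_iff)
  have int: "integrable lborel (\<lambda>t. indicator \<Omega> t * g i j t)" for i j
    using integrable_mult_indicator[OF _ integrable_weight_density[of \<gamma> a i j], of \<Omega>] \<Omega> by (simp add: g_def)
  have quad: "0 \<le> A * E 1 1 + 2 * B * E 1 2 + C * E 2 2"
    if nn: "\<And>s. 0 \<le> A * (1 + s\<^sup>2) + 2 * B * s + C" "0 \<le> A + 2 * B + C" for A B C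
  proof -
    have "A * E 1 1 + 2 * B * E 1 2 + C * E 2 2 =
      (LINT t|lborel. A * (indicator \<Omega> t * g 1 1 t) + 2 * B * (indicator \<Omega> t * g 1 2 t) + C * (indicator \<Omega> t * g 2 2 t))
      + (A + 2 * B + C) * (\<zeta> * indicator \<Omega> 0)"
    proof -
      have "(LINT t|lborel. A * (indicator \<Omega> t * g 1 1 t) + 2 * B * (indicator \<Omega> t * g 1 2 t) + C * (indicator \<Omega> t * g 2 2 t))
        = A * (LINT t|lborel. indicator \<Omega> t * g 1 1 t) + 2 * B * (LINT t|lborel. indicator \<Omega> t * g 1 2 t)
          + C * (LINT t|lborel. indicator \<Omega> t * g 2 2 t)"
        by (simp add: int)
      then show ?thesis unfolding E_def set_lebesgue_integral_def by (simp add: algebra_simps)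
    qed
    moreover have "0 \<le> (LINT t|lborel. A * (indicator \<Omega> t * g 1 1 t) + 2 * B * (indicator \<Omega> t * g 1 2 t) + C * (indicator \<Omega> t * g 2 2 t))"
    proof (rule Bochner_Integration.integral_nonneg)
      fix t :: real
      have "A * (indicator \<Omega> t * g 1 1 t) + 2 * B * (indicator \<Omega> t * g 1 2 t) + C * (indicator \<Omega> t * g 2 2 t)
        = indicator \<Omega> t * (\<gamma> * exp (- t\<^sup>2)) * (A * (1 + (a * t)\<^sup>2) + 2 * B * (a * t) + C)"
        by (simp add: g_def weight_fun_def algebra_simps)
      also have "\<dots> \<ge> 0" using \<gamma> nn(1)[of "a * t"] by (intro mult_nonneg_nonneg) auto
      finally show "0 \<le> A * (indicator \<Omega> t * g 1 1 t) + 2 * B * (indicator \<Omega> t * g 1 2 t) + C * (indicator \<Omega> t * g 2 2 t)" .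
    qed
    ultimately show ?thesis using nn(2) \<zeta> by simp
  qed
  show ?thesis unfolding pos_semidef_def e
  proof (intro conjI allI)
    have "\<forall>i j. E i j = E j i" by (simp add: forall_2 E_def g12)
    then show "complex_of_real (E i j) = cnj (complex_of_real (E j i))" for i j by simp
    fix v :: "complex^2"
    let ?x = "Re (v $ 1)" and ?y = "Im (v $ 1)" and ?z = "Re (v $ 2)" and ?w = "Im (v $ 2)"
    have "0 \<le> (?x\<^sup>2 + ?y\<^sup>2) * E 1 1 + 2 * (?x * ?z + ?y * ?w) * E 1 2 + (?z\<^sup>2 + ?w\<^sup>2) * E 2 2"
    proof (rule quad)
      fix s
      have "(?x\<^sup>2 + ?y\<^sup>2) * (1 + s\<^sup>2) + 2 * (?x * ?z + ?y * ?w) * s + (?z\<^sup>2 + ?w\<^sup>2) =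
        ?x\<^sup>2 + ?y\<^sup>2 + (s * ?x + ?z)\<^sup>2 + (s * ?y + ?w)\<^sup>2"
        by (simp add: power2_eq_square algebra_simps)
      then show "0 \<le> (?x\<^sup>2 + ?y\<^sup>2) * (1 + s\<^sup>2) + 2 * (?x * ?z + ?y * ?w) * s + (?z\<^sup>2 + ?w\<^sup>2)" by simp
      have "?x\<^sup>2 + ?y\<^sup>2 + 2 * (?x * ?z + ?y * ?w) + (?z\<^sup>2 + ?w\<^sup>2) = (?x + ?z)\<^sup>2 + (?y + ?w)\<^sup>2"
        by (simp add: power2_eq_square algebra_simps)
      then show "0 \<le> ?x\<^sup>2 + ?y\<^sup>2 + 2 * (?x * ?z + ?y * ?w) + (?z\<^sup>2 + ?w\<^sup>2)" by simp
    qed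
    also have "\<dots> = Re (\<Sum>i\<in>UNIV. \<Sum>j\<in>UNIV. cnj (v $ i) * complex_of_real (E i j) * v $ j)"
      by (simp add: sum_2 E_def g12 power2_eq_square algebra_simps)
    finally show "0 \<le> Re (\<Sum>i\<in>UNIV. \<Sum>j\<in>UNIV. cnj (v $ i) * complex_of_real (E i j) * v $ j)" .
  qed
qed

lemma integrable_part_Wa_dirac:
  assumes \<gamma>: "0 \<le> \<gamma>" and \<zeta>: "0 \<le> \<zeta>"
  shows "integrable (part (Wa_dirac a \<gamma> \<zeta>) i i 0) (\<lambda>t. t ^ n * exp (u * \<bar>t\<bar>))"
proof -
  let ?g = "\<lambda>t. \<gamma> * (exp (- t\<^sup>2) * weight_fun a t $ i $ i)"
  have "\<forall>i. 0 \<le> weight_fun a t $ i $ i" for t by (simp add: forall_2 weight_fun_def)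
  then have nn: "0 \<le> ?g t" for t using \<gamma> by simp
  have D: "finite_borel_measure (density lborel ?g)"
    by (rule density_lborel(1)[OF _ nn integrable_weight_density]) measurable
  have p: "part (Wa_dirac a \<gamma> \<zeta>) i i 0 = add_measure (density lborel ?g) (point_mass \<zeta>)"
    using pos_semidef_Wa_dirac[OF \<gamma> \<zeta>] complex_measure_Wa_dirac[OF \<zeta>] D
    by (intro finite_borel_measure_eqI)
      (auto simp: part_measure add_measure point_mass \<zeta> Wa_dirac_entry
        density_lborel(2)[OF _ nn integrable_weight_density])
  have "\<forall>i. integrable lborel (\<lambda>t. exp (- t\<^sup>2) * weight_fun a t $ i $ i * (t ^ n * exp (u * \<bar>t\<bar>)))"
  proof -
    have "integrable lborel (\<lambda>t. exp (- t\<^sup>2) * (t ^ n * exp (u * \<bar>t\<bar>)) + a\<^sup>2 * (exp (- t\<^sup>2) * (t ^ (n + 2) * exp (u * \<bar>t\<bar>))))"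
      by (intro Bochner_Integration.integrable_add integrable_mult_right integrable_gauss)
    then show ?thesis
      using integrable_gauss[of n u]
      by (simp add: forall_2 weight_fun_def power2_eq_square algebra_simps)
  qed
  then have "integrable lborel (\<lambda>t. \<gamma> * (exp (- t\<^sup>2) * weight_fun a t $ i $ i * (t ^ n * exp (u * \<bar>t\<bar>))))"
    by (intro integrable_mult_right) blast
  then have "integrable (density lborel ?g) (\<lambda>t. t ^ n * exp (u * \<bar>t\<bar>))"
    using nn by (subst integrable_density) (auto simp: mult.assoc)
  then show ?thesis unfolding p
    by (intro integrable_add_measure D point_mass \<zeta> point_mass_integral) auto
qed

lemma moment_matrix_Wa_dirac:
  assumes "0 \<le> \<gamma>" "0 \<le> \<zeta>" shows "moment_matrix (Wa_dirac a \<gamma> \<zeta>)"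
  unfolding moment_matrix_def
proof (intro conjI allI ballI)
  show "integrable (part (Wa_dirac a \<gamma> \<zeta>) i i 0) (\<lambda>t. t ^ n)" for n i
    using integrable_part_Wa_dirac[OF assms, of a i n 0] by simp
qed (intro complex_measure_Wa_dirac pos_semidef_Wa_dirac assms; assumption)+

text \<open>Nonsingularity for all matrix polynomials with invertible leading coefficient follows from
  definiteness on single rows: a vector in the kernel of \<open>\<integral> P dW P\<^sup>*\<close> yields a combination of the rows of \<open>P\<close> with
  square norm zero.\<close>

lemma moment_matrix_nonsingular:
  fixes W :: "'n::finite mat_setfun"
  assumes W: "moment_matrix W"
    and pos: "\<And>R i k. mint W R R $ i $ i = 0 \<Longrightarrow> R $ i $ k = 0"
    and P: "invertible (mp_lead_coeff P)"
  shows "invertible (mint W P P)"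
proof -
  have "x = 0" if x: "mint W P P *v x = 0" for x
  proof -
    \<comment> \<open>All rows of \<open>A\<close> are \<open>x\<^sup>*\<close>.\<close>
    define A :: "complex^'n^'n" where "A = (\<chi> i j. cnj (x $ j))"
    define R where "R = mp_const A ** P"
    have "mint W P R $ j $ i = 0" for i j
    proof -
      have "mint W R P $ i $ j = (\<Sum>k\<in>UNIV. cnj (x $ k) * mint W P P $ k $ j)"
        unfolding R_def mint_const_left[OF W] by (simp add: matrix_matrix_mult_def A_def)
      then have "mint W P R $ j $ i = (\<Sum>k\<in>UNIV. x $ k * cnj (mint W P P $ k $ j))"
        unfolding mint_cnj[OF W, of P R j i] by simp
      also have "\<dots> = (mint W P P *v x) $ j"
        by (simp add: matrix_vector_mult_def mult.commute flip: mint_cnj[OF W])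
      finally show ?thesis using x by simp
    qed
    then have "mint W R R $ i $ i = 0" for i
      unfolding R_def mint_const_left[OF W] unfolding R_def[symmetric]
      by (simp add: matrix_matrix_mult_def)
    then have "R = 0" by (simp add: vec_eq_iff pos)
    then have "A ** mp_lead_coeff P = 0"
      unfolding mp_lead_coeff_def by (metis R_def mp_coeff_0 mp_coeff_const_mult)
    then have "A = 0" using invertible_mult_eq_0[OF P] by blast
    then show "x = 0" by (simp add: vec_eq_iff A_def)
  qed
  then obtain B where "B ** mint W P P = mat 1" using matrix_left_invertible_ker by blast
  then show ?thesis unfolding invertible_def using matrix_left_right_inverse by blast
qed

lemma weight_matrix_Wa_dirac:
  assumes \<gamma>: "0 < \<gamma>" and \<zeta>: "0 \<le> \<zeta>"
  shows "weight_matrix (Wa_dirac a \<gamma> \<zeta>)"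
proof -
  let ?V = "Wa_dirac a \<gamma> \<zeta>"
  have V: "moment_matrix ?V" using moment_matrix_Wa_dirac[of \<gamma> \<zeta> a] \<gamma> \<zeta> by simp
  have pos: "R $ i $ k = 0" if z: "mint ?V R R $ i $ i = 0" for R i k
  proof -
    \<comment> \<open>The quadratic form of \<open>exp(t\<^sup>2) W\<^sub>a\<close> at the row \<open>(p, q)\<close> is \<open>\<bar>p\<bar>\<^sup>2 + \<bar>atp + q\<bar>\<^sup>2\<close>.\<close>
    define p q where "p = R $ i $ 1" and "q = R $ i $ 2"
    define s where "s = [:0, of_real a:] * p + q"
    have s: "cnj_poly s = [:0, of_real a:] * cnj_poly p + cnj_poly q"
    proof -
      have "cnj_poly [:0, of_real a:] = [:0, of_real a:]" by (rule poly_eqI) (simp add: coeff_pCons split: nat.split)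
      then show ?thesis unfolding s_def cnj_poly_add cnj_poly_mult by (simp only:)
    qed
    have w: "weight_poly a $ 1 $ 1 = 1 + [:0, of_real a:] * [:0, of_real a:]"
      "weight_poly a $ 1 $ 2 = [:0, of_real a:]" "weight_poly a $ 2 $ 1 = [:0, of_real a:]" "weight_poly a $ 2 $ 2 = 1"
      by (simp_all add: weight_poly_def power2_eq_square one_pCons)
    have "weight_poly a $ 1 $ 1 * (p * cnj_poly p) + weight_poly a $ 1 $ 2 * (p * cnj_poly q)
        + weight_poly a $ 2 $ 1 * (q * cnj_poly p) + weight_poly a $ 2 $ 2 * (q * cnj_poly q)
      = p * cnj_poly p + s * cnj_poly s"
      unfolding s w unfolding s_def by (simp only: algebra_simps mult_1_left)
    then have sum: "gauss_mom (weight_poly a $ 1 $ 1 * (p * cnj_poly p)) + gauss_mom (weight_poly a $ 1 $ 2 * (p * cnj_poly q))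
      + gauss_mom (weight_poly a $ 2 $ 1 * (q * cnj_poly p)) + gauss_mom (weight_poly a $ 2 $ 2 * (q * cnj_poly q))
      = gauss_mom (p * cnj_poly p) + gauss_mom (s * cnj_poly s)"
      unfolding gauss_mom_add[symmetric] by simp
    have "mint ?V R R $ i $ i = \<gamma> * (gauss_mom (weight_poly a $ 1 $ 1 * (p * cnj_poly p))
        + gauss_mom (weight_poly a $ 1 $ 2 * (p * cnj_poly q)) + gauss_mom (weight_poly a $ 2 $ 1 * (q * cnj_poly p))
        + gauss_mom (weight_poly a $ 2 $ 2 * (q * cnj_poly q)))
      + \<zeta> * ((poly p 0 + poly q 0) * cnj (poly p 0 + poly q 0))"
      unfolding mint_eq sum_2 mom_Wa_dirac[OF \<zeta>] p_def[symmetric] q_def[symmetric]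
      by (simp add: distrib_left distrib_right)
    then have "mint ?V R R $ i $ i = \<gamma> * (gauss_mom (p * cnj_poly p) + gauss_mom (s * cnj_poly s))
      + \<zeta> * ((poly p 0 + poly q 0) * cnj (poly p 0 + poly q 0))"
      unfolding sum .
    then have "0 = Re (\<gamma> * (gauss_mom (p * cnj_poly p) + gauss_mom (s * cnj_poly s))
      + \<zeta> * ((poly p 0 + poly q 0) * cnj (poly p 0 + poly q 0)))" using z by simp
    also have "\<dots> = \<gamma> * (Re (gauss_mom (p * cnj_poly p)) + Re (gauss_mom (s * cnj_poly s)))
      + \<zeta> * (norm (poly p 0 + poly q 0))\<^sup>2"
      unfolding complex_norm_square[symmetric] by simp
    finally have "\<gamma> * (Re (gauss_mom (p * cnj_poly p)) + Re (gauss_mom (s * cnj_poly s))) \<le> 0"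
      using \<zeta> by (smt (verit) mult_nonneg_nonneg zero_le_power2)
    then have "Re (gauss_mom (p * cnj_poly p)) = 0" "Re (gauss_mom (s * cnj_poly s)) = 0"
      using \<gamma> gauss_mom_norm_nonneg(2)[of p] gauss_mom_norm_nonneg(2)[of s]
      by (simp_all add: mult_le_0_iff)
    then have "p = 0" "s = 0"
      using gauss_mom_norm_nonneg(1)[of p] gauss_mom_norm_nonneg(1)[of s] gauss_mom_norm_eq_0 by auto
    then have "\<forall>k. R $ i $ k = 0" by (simp add: forall_2 s_def p_def q_def)
    then show ?thesis by blast
  qed
  have "cm_integrable (entry ?V i j) (\<lambda>t. of_real (t ^ n))" for i j n
    by (rule cm_integral_entry(1)[OF moment_matrixD(1,2)[OF V]])
      (auto intro!: integrable_of_real moment_matrixD(3)[OF V] simp del: of_real_power)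
  then show ?thesis
    unfolding weight_matrix_def
    using moment_matrixD(1,2)[OF V] moment_matrix_nonsingular[OF V pos] by blast
qed


section \<open>The differential operator\<close>

text \<open>The constant polynomials \<open>a\<close> and \<open>1 / a\<^sup>2\<close>. They are constants of the logic, so that polynomial
  identities involving them are identities of commutative rings, modulo \<open>a\<^sup>2 (1 / a\<^sup>2) = 1\<close>.\<close>

definition polyA :: "real \<Rightarrow> complex poly" where
  "polyA a = [:of_real a:]"

definition polyK :: "real \<Rightarrow> complex poly" where
  "polyK a = [:of_real (1 / a\<^sup>2):]"

text \<open>The two entries of \<open>(p, q) D\<^sub>a\<close> for a row \<open>(p, q)\<close> of polynomials.\<close>

definition row_op1 :: "real \<Rightarrow> complex poly \<Rightarrow> complex poly \<Rightarrow> complex poly" where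
  "row_op1 a p q = (1 - polyA a * polyX) * pderiv (pderiv p) - pderiv (pderiv q)
     - (2 * polyA a + 2 * polyX) * pderiv p - p + 4 * polyK a * q"

definition row_op2 :: "real \<Rightarrow> complex poly \<Rightarrow> complex poly \<Rightarrow> complex poly" where
  "row_op2 a p q = (polyA a * polyA a * polyX * polyX - 1) * pderiv (pderiv p)
     + (1 + polyA a * polyX) * pderiv (pderiv q)
     + (2 * polyA a + 2 * (2 + polyA a * polyA a) * polyX) * pderiv p - 2 * polyX * pderiv q
     + 2 * (2 * polyK a + 1) * p + q"

lemma polyA_polyK: "a \<noteq> 0 \<Longrightarrow> polyA a * polyA a * polyK a = 1"
  by (simp add: polyA_def polyK_def one_pCons power2_eq_square)

lemma Da_row:
  assumes "a \<noteq> 0"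
  shows "Da a P $ i $ 1 = row_op1 a (P $ i $ 1) (P $ i $ 2)"
    and "Da a P $ i $ 2 = row_op2 a (P $ i $ 1) (P $ i $ 2)"
proof -
  have c: "[:1, complex_of_real (- a):] = 1 - polyA a * polyX"
    "[:- 1, 0, complex_of_real (a\<^sup>2):] = polyA a * polyA a * polyX * polyX - 1"
    "[:1, complex_of_real a:] = 1 + polyA a * polyX"
    "[:complex_of_real (- 2 * a), - 2:] = - (2 * polyA a + 2 * polyX)"
    "[:complex_of_real (2 * a), complex_of_real (2 * (2 + a\<^sup>2)):] = 2 * polyA a + 2 * (2 + polyA a * polyA a) * polyX"
    "[:0, - 2:] = - (2 * polyX)" "[:- 1:] = - (1 :: complex poly)"
    by (simp_all add: polyA_def one_pCons numeral_poly power2_eq_square)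
  have k: "[:complex_of_real (2 * ((2 + a\<^sup>2) / a\<^sup>2)):] = 2 * (2 * polyK a + 1)"
    "[:complex_of_real (4 / a\<^sup>2):] = 4 * polyK a" "[:1:] = (1 :: complex poly)"
    using assms by (simp_all add: polyK_def one_pCons numeral_poly field_simps)
  have "Da a P $ i $ 1 = pderiv (pderiv (P $ i $ 1)) * [:1, of_real (- a):] + pderiv (pderiv (P $ i $ 2)) * [:- 1:]
    + (pderiv (P $ i $ 1) * [:of_real (- 2 * a), - 2:] + pderiv (P $ i $ 2) * 0)
    + (P $ i $ 1 * [:- 1:] + P $ i $ 2 * [:of_real (4 / a\<^sup>2):])"
    by (simp only: Da_def diffop2_def mp_deriv_def map_matrix_def mp_const_def matrix_matrix_mult_def sum_2
      vector_add_component vec_lambda_beta mat22_nth)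
  then show "Da a P $ i $ 1 = row_op1 a (P $ i $ 1) (P $ i $ 2)"
    unfolding c k row_op1_def by algebra
  have "Da a P $ i $ 2 = pderiv (pderiv (P $ i $ 1)) * [:- 1, 0, of_real (a\<^sup>2):] + pderiv (pderiv (P $ i $ 2)) * [:1, of_real a:]
    + (pderiv (P $ i $ 1) * [:of_real (2 * a), of_real (2 * (2 + a\<^sup>2)):] + pderiv (P $ i $ 2) * [:0, - 2:])
    + (P $ i $ 1 * [:of_real (2 * ((2 + a\<^sup>2) / a\<^sup>2)):] + P $ i $ 2 * [:1:])"
    by (simp only: Da_def diffop2_def mp_deriv_def map_matrix_def mp_const_def matrix_matrix_mult_def sum_2
      vector_add_component vec_lambda_beta mat22_nth)
  then show "Da a P $ i $ 2 = row_op2 a (P $ i $ 1) (P $ i $ 2)"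
    unfolding c k row_op2_def by algebra
qed

text \<open>The coefficient of \<open>t\<^sup>n\<close> for rows of degree at most \<open>n\<close>. It shows both that degrees are not raised
  and what the eigenvalues are.\<close>

lemma coeff_row_op:
  assumes "\<And>k. n < k \<Longrightarrow> coeff p k = 0" "\<And>k. n < k \<Longrightarrow> coeff q k = 0"
  shows "coeff (row_op1 a p q) n = - (2 * of_nat n + 1) * coeff p n + 4 / of_real (a\<^sup>2) * coeff q n"
    and "coeff (row_op2 a p q) n = (of_real (a\<^sup>2) * of_nat (n * (n - 1)) + 2 * (2 + of_real (a\<^sup>2)) * of_nat n
      + 4 / of_real (a\<^sup>2) + 2) * coeff p n + (1 - 2 * of_nat n) * coeff q n"
proof -
  have r1: "row_op1 a p q = pderiv (pderiv p) - smult (of_real a) (pCons 0 (pderiv (pderiv p))) - pderiv (pderiv q)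
     - smult (2 * of_real a) (pderiv p) - smult 2 (pCons 0 (pderiv p)) - p + smult (4 / of_real (a\<^sup>2)) q"
    unfolding row_op1_def polyA_def polyK_def
    by (simp add: algebra_simps numeral_poly)
  have r2: "row_op2 a p q = smult (of_real (a\<^sup>2)) (pCons 0 (pCons 0 (pderiv (pderiv p)))) - pderiv (pderiv p)
     + pderiv (pderiv q) + smult (of_real a) (pCons 0 (pderiv (pderiv q)))
     + smult (2 * of_real a) (pderiv p) + smult (2 * (2 + of_real (a\<^sup>2))) (pCons 0 (pderiv p)) - smult 2 (pCons 0 (pderiv q))
     + smult (4 / of_real (a\<^sup>2) + 2) p + q"
    unfolding row_op2_def polyA_def polyK_def
    by (simp add: algebra_simps numeral_poly power2_eq_square smult_add_left)
  consider "n = 0" | "n = 1" | m where "n = Suc (Suc m)" by (metis One_nat_def not0_implies_Suc)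
  then show "coeff (row_op1 a p q) n = - (2 * of_nat n + 1) * coeff p n + 4 / of_real (a\<^sup>2) * coeff q n"
    "coeff (row_op2 a p q) n = (of_real (a\<^sup>2) * of_nat (n * (n - 1)) + 2 * (2 + of_real (a\<^sup>2)) * of_nat n
      + 4 / of_real (a\<^sup>2) + 2) * coeff p n + (1 - 2 * of_nat n) * coeff q n"
    unfolding r1 r2 by (cases; simp add: coeff_pderiv assms algebra_simps)+
qed

lemma Da_degree:
  assumes a: "a \<noteq> 0" and Q: "mp_degree_less n Q" shows "mp_degree_less n (Da a Q)"
  unfolding mp_degree_less_def
proof (intro allI impI)
  fix k assume "n \<le> k"
  have z: "coeff (Q $ i $ j) l = 0" if "k \<le> l" for i j l
  proof -
    have "mp_coeff Q l = 0" using Q that \<open>n \<le> k\<close> by (simp add: mp_degree_less_def)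
    then show ?thesis by (metis mp_coeff_nth zero_index)
  qed
  have "\<forall>i j. coeff (Da a Q $ i $ j) k = 0"
    unfolding forall_2 Da_row[OF a] by (simp add: coeff_row_op z)
  then show "mp_coeff (Da a Q) k = 0" by (simp add: vec_eq_iff mp_coeff_nth)
qed

lemma Da_lead_coeff:
  assumes a: "a \<noteq> 0" and P: "mp_monic n P" shows "mp_coeff (Da a P) n = Gamma_na n a"
proof -
  have z: "coeff (P $ i $ j) k = 0" if "n < k" for i j k
    using P that unfolding mp_monic_def mp_degree_less_def by (metis Suc_leI mp_coeff_nth zero_index)
  have l: "coeff (P $ i $ j) n = (if i = j then 1 else 0)" for i j
    using P unfolding mp_monic_def by (simp add: mat_def flip: mp_coeff_nth)
  have c: "coeff (row_op1 a (P $ i $ 1) (P $ i $ 2)) n =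
      - (2 * of_nat n + 1) * coeff (P $ i $ 1) n + 4 / of_real (a\<^sup>2) * coeff (P $ i $ 2) n"
    "coeff (row_op2 a (P $ i $ 1) (P $ i $ 2)) n =
      (of_real (a\<^sup>2) * of_nat (n * (n - 1)) + 2 * (2 + of_real (a\<^sup>2)) * of_nat n + 4 / of_real (a\<^sup>2) + 2)
        * coeff (P $ i $ 1) n + (1 - 2 * of_nat n) * coeff (P $ i $ 2) n" for i
    by (rule coeff_row_op; erule z)+
  have n: "of_nat (n * (n - 1)) = (of_nat n * (of_nat n - 1) :: complex)" by (cases n) (simp_all add: algebra_simps)
  have "\<forall>i j. coeff (Da a P $ i $ j) n = Gamma_na n a $ i $ j"
    unfolding forall_2 Da_row[OF a] c n l Gamma_na_def mat22_nth
    using a by (simp add: field_simps power2_eq_square)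
  then show ?thesis by (simp add: vec_eq_iff mp_coeff_nth)
qed

lemma cnj_poly_consts:
  "cnj_poly (polyA a) = polyA a" "cnj_poly (polyK a) = polyK a" "cnj_poly polyX = polyX"
  "cnj_poly 1 = 1" "cnj_poly (numeral k) = numeral k"
  by (rule poly_eqI; simp add: polyA_def polyK_def coeff_pCons one_pCons numeral_poly split: nat.split)+

lemma cnj_poly_row_op:
  "cnj_poly (row_op1 a p q) = row_op1 a (cnj_poly p) (cnj_poly q)"
  "cnj_poly (row_op2 a p q) = row_op2 a (cnj_poly p) (cnj_poly q)"
  unfolding row_op1_def row_op2_def
  by (simp_all only: cnj_poly_add cnj_poly_diff cnj_poly_mult cnj_poly_pderiv cnj_poly_consts)

text \<open>The difference \<open>\<integral> (p D\<^sub>a) dW q\<^sup>T - \<integral> p dW (q D\<^sub>a)\<^sup>T\<close> for rows \<open>p\<close> and \<open>q\<close>. It is bilinear: since the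
  coefficients of \<open>D\<^sub>a\<close> are real, conjugation of the second argument can be absorbed into \<open>q\<close>.\<close>

definition defect :: "real \<Rightarrow> 2 mat_setfun \<Rightarrow> complex poly \<Rightarrow> complex poly \<Rightarrow> complex poly \<Rightarrow> complex poly \<Rightarrow> complex" where
  "defect a W p1 p2 q1 q2 =
     mom W 1 1 (row_op1 a p1 p2 * q1 - p1 * row_op1 a q1 q2) + mom W 1 2 (row_op1 a p1 p2 * q2 - p1 * row_op2 a q1 q2)
     + mom W 2 1 (row_op2 a p1 p2 * q1 - p2 * row_op1 a q1 q2) + mom W 2 2 (row_op2 a p1 p2 * q2 - p2 * row_op2 a q1 q2)"

lemma mint_Da_diff:
  assumes a: "a \<noteq> 0" and W: "moment_matrix W"
  shows "mint W (Da a P) Q $ i $ j - mint W P (Da a Q) $ i $ j =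
    defect a W (P $ i $ 1) (P $ i $ 2) (cnj_poly (Q $ j $ 1)) (cnj_poly (Q $ j $ 2))"
  unfolding mint_eq sum_2 Da_row[OF a] cnj_poly_row_op defect_def mom_diff[OF W] by simp

lemma symmetric_iff_defect:
  assumes a: "a \<noteq> 0" and W: "moment_matrix W"
  shows "symmetric_wrt (Da a) W \<longleftrightarrow> (\<forall>p1 p2 q1 q2. defect a W p1 p2 q1 q2 = 0)"
proof
  assume s: "symmetric_wrt (Da a) W"
  show "\<forall>p1 p2 q1 q2. defect a W p1 p2 q1 q2 = 0"
  proof (intro allI)
    fix p1 p2 q1 q2
    define P Q :: "2 matpoly" where "P = mat22 p1 p2 0 0" and "Q = mat22 (cnj_poly q1) (cnj_poly q2) 0 0"
    have "mint W (Da a P) Q $ 1 $ 1 - mint W P (Da a Q) $ 1 $ 1 = 0"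
      using s by (simp add: symmetric_wrt_def)
    then show "defect a W p1 p2 q1 q2 = 0"
      unfolding mint_Da_diff[OF a W] by (simp add: P_def Q_def)
  qed
next
  assume "\<forall>p1 p2 q1 q2. defect a W p1 p2 q1 q2 = 0"
  then have "mint W (Da a P) Q $ i $ j - mint W P (Da a Q) $ i $ j = 0" for P Q i j
    unfolding mint_Da_diff[OF a W] by blast
  then show "symmetric_wrt (Da a) W" unfolding symmetric_wrt_def by (simp add: vec_eq_iff)
qed

lemma pderiv_consts [simp]: "pderiv (polyA a) = 0" "pderiv (polyK a) = 0" "pderiv polyX = 1"
  by (simp_all add: polyA_def polyK_def pderiv_pCons one_pCons)

lemma pderiv_numeral [simp]: "pderiv (numeral k :: complex poly) = 0"
  by (simp add: numeral_poly pderiv_pCons)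

text \<open>The bilinear concomitant of \<open>D\<^sub>a\<close>, divided by \<open>exp(-t\<^sup>2)\<close>. With \<open>w = exp(t\<^sup>2) W\<^sub>a\<close> it is
  \<open>p' F\<^sub>2w q\<^sup>T - p F\<^sub>2w q'\<^sup>T + p (F\<^sub>1w - wF\<^sub>1\<^sup>*) q\<^sup>T / 2\<close>.\<close>

definition concomitant :: "real \<Rightarrow> complex poly \<Rightarrow> complex poly \<Rightarrow> complex poly \<Rightarrow> complex poly \<Rightarrow> complex poly" where
  "concomitant a p1 p2 q1 q2 =
     (1 - polyA a * polyX) * (1 - polyA a * polyX) * (pderiv p1 * q1 - p1 * pderiv q1)
     + (polyA a * polyX - 1) * (pderiv p1 * q2 - p1 * pderiv q2 + pderiv p2 * q1 - p2 * pderiv q1)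
     + (pderiv p2 * q2 - p2 * pderiv q2) + (polyA a + 2 * polyX) * (p1 * q2 - p2 * q1)"

text \<open>The derivatives are independent variables here. The right-hand side is \<open>R' - 2xR\<close> for the
  concomitant \<open>R\<close>, with \<open>R'\<close> expanded by the product rule.\<close>

lemma concomitant_identity:
  fixes x c k :: "'a :: idom"
  assumes "c * c * k = 1"
    and "d1 = (1 - c * x) * p1'' - p2'' - (2 * c + 2 * x) * p1' - p1 + 4 * k * p2"
    and "d2 = (c * c * x * x - 1) * p1'' + (1 + c * x) * p2'' + (2 * c + 2 * (2 + c * c) * x) * p1' - 2 * x * p2'
      + 2 * (2 * k + 1) * p1 + p2"
    and "e1 = (1 - c * x) * q1'' - q2'' - (2 * c + 2 * x) * q1' - q1 + 4 * k * q2"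
    and "e2 = (c * c * x * x - 1) * q1'' + (1 + c * x) * q2'' + (2 * c + 2 * (2 + c * c) * x) * q1' - 2 * x * q2'
      + 2 * (2 * k + 1) * q1 + q2"
  shows "(1 + c * x * (c * x)) * (d1 * q1 - p1 * e1) + c * x * (d1 * q2 - p1 * e2) + c * x * (d2 * q1 - p2 * e1) + (d2 * q2 - p2 * e2)
    = (- c * (1 - c * x) - (1 - c * x) * c) * (p1' * q1 - p1 * q1') + (1 - c * x) * (1 - c * x) * (p1'' * q1 - p1 * q1'')
      + c * (p1' * q2 - p1 * q2' + p2' * q1 - p2 * q1')
      + (c * x - 1) * (p1'' * q2 + p1' * q2' - p1' * q2' - p1 * q2'' + p2'' * q1 + p2' * q1' - p2' * q1' - p2 * q1'')
      + (p2'' * q2 - p2 * q2'') + 2 * (p1 * q2 - p2 * q1)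
      + (c + 2 * x) * (p1' * q2 + p1 * q2' - p2' * q1 - p2 * q1')
      - 2 * x * ((1 - c * x) * (1 - c * x) * (p1' * q1 - p1 * q1')
        + (c * x - 1) * (p1' * q2 - p1 * q2' + p2' * q1 - p2 * q1')
        + (p2' * q2 - p2 * q2') + (c + 2 * x) * (p1 * q2 - p2 * q1))"
  using assms(1) unfolding assms(2-5) by algebra


lemma pderiv_one [simp]: "pderiv (1 :: complex poly) = 0"
  by (simp add: one_pCons pderiv_pCons)

lemma row_op_concomitant:
  assumes "a \<noteq> 0"
  shows "(1 + polyA a * polyX * (polyA a * polyX)) * (row_op1 a p1 p2 * q1 - p1 * row_op1 a q1 q2)
    + polyA a * polyX * (row_op1 a p1 p2 * q2 - p1 * row_op2 a q1 q2)
    + polyA a * polyX * (row_op2 a p1 p2 * q1 - p2 * row_op1 a q1 q2)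
    + (row_op2 a p1 p2 * q2 - p2 * row_op2 a q1 q2)
    = pderiv (concomitant a p1 p2 q1 q2) - 2 * polyX * concomitant a p1 p2 q1 q2"
  unfolding concomitant_identity[OF polyA_polyK[OF assms] row_op1_def row_op2_def row_op1_def row_op2_def]
    concomitant_def pderiv_add pderiv_diff pderiv_mult pderiv_consts pderiv_one pderiv_numeral
  by algebra

lemma weight_poly_nth:
  "weight_poly a $ 1 $ 1 = 1 + polyA a * polyX * (polyA a * polyX)"
  "weight_poly a $ 1 $ 2 = polyA a * polyX" "weight_poly a $ 2 $ 1 = polyA a * polyX" "weight_poly a $ 2 $ 2 = 1"
  by (simp_all add: weight_poly_def polyA_def power2_eq_square one_pCons)

lemma poly_0_consts:
  "poly polyX 0 = 0" "poly (polyA a) 0 = of_real a" "poly (polyK a) 0 = of_real (1 / a\<^sup>2)"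
  by (simp_all add: polyA_def polyK_def)

lemma symmetric_Wa_dirac:
  assumes a: "a \<noteq> 0" and \<gamma>: "0 \<le> \<gamma>" and \<zeta>: "0 \<le> \<zeta>"
  shows "symmetric_wrt (Da a) (Wa_dirac a \<gamma> \<zeta>)"
  unfolding symmetric_iff_defect[OF a moment_matrix_Wa_dirac[OF \<gamma> \<zeta>]]
proof (intro allI)
  fix p1 p2 q1 q2
  define D1 D2 E1 E2 where "D1 = row_op1 a p1 p2" and "D2 = row_op2 a p1 p2"
    and "E1 = row_op1 a q1 q2" and "E2 = row_op2 a q1 q2"
  let ?R = "concomitant a p1 p2 q1 q2"
  have "gauss_mom (weight_poly a $ 1 $ 1 * (D1 * q1 - p1 * E1)) + gauss_mom (weight_poly a $ 1 $ 2 * (D1 * q2 - p1 * E2))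
    + gauss_mom (weight_poly a $ 2 $ 1 * (D2 * q1 - p2 * E1)) + gauss_mom (weight_poly a $ 2 $ 2 * (D2 * q2 - p2 * E2))
    = gauss_mom (pderiv ?R - 2 * polyX * ?R)"
    unfolding gauss_mom_add[symmetric] weight_poly_nth mult_1_left D1_def D2_def E1_def E2_def
      row_op_concomitant[OF a] ..
  also have "\<dots> = 0"
  proof -
    have "2 * polyX * ?R = polyX * ?R + polyX * ?R" by algebra
    then show ?thesis unfolding gauss_mom_diff gauss_mom_pderiv by (simp only: gauss_mom_add) simp
  qed
  finally have g: "gauss_mom (weight_poly a $ 1 $ 1 * (D1 * q1 - p1 * E1)) + gauss_mom (weight_poly a $ 1 $ 2 * (D1 * q2 - p1 * E2))
    + gauss_mom (weight_poly a $ 2 $ 1 * (D2 * q1 - p2 * E1)) + gauss_mom (weight_poly a $ 2 $ 2 * (D2 * q2 - p2 * E2)) = 0" .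
  \<comment> \<open>At \<open>0\<close> the derivatives cancel in the sum of the two entries, and \<open>(1, 1)\<^sup>T\<close> is an eigenvector of \<open>F\<^sub>0\<close>.\<close>
  have z: "poly (row_op1 a p q) 0 + poly (row_op2 a p q) 0 = (4 / of_real (a\<^sup>2) + 1) * (poly p 0 + poly q 0)" for p q
    unfolding row_op1_def row_op2_def poly_add poly_diff poly_mult poly_0_consts poly_1 poly_numeral
    by (simp add: algebra_simps add_divide_distrib)
  have "poly (D1 * q1 - p1 * E1) 0 + poly (D1 * q2 - p1 * E2) 0 + poly (D2 * q1 - p2 * E1) 0 + poly (D2 * q2 - p2 * E2) 0
    = (poly D1 0 + poly D2 0) * (poly q1 0 + poly q2 0) - (poly p1 0 + poly p2 0) * (poly E1 0 + poly E2 0)"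
    unfolding poly_diff poly_mult by algebra
  also have "\<dots> = 0" unfolding D1_def D2_def E1_def E2_def z by algebra
  finally have p: "poly (D1 * q1 - p1 * E1) 0 + poly (D1 * q2 - p1 * E2) 0 + poly (D2 * q1 - p2 * E1) 0 + poly (D2 * q2 - p2 * E2) 0 = 0" .
  show "defect a (Wa_dirac a \<gamma> \<zeta>) p1 p2 q1 q2 = 0"
    unfolding defect_def mom_Wa_dirac[OF \<zeta>] D1_def[symmetric] D2_def[symmetric] E1_def[symmetric] E2_def[symmetric]
    using g p by algebra
qed


section \<open>The weight matrices which make the operator symmetric\<close>

text \<open>The two entries of the commutator \<open>(tp) D\<^sub>a - t (p D\<^sub>a) = 2p' F\<^sub>2 + p F\<^sub>1\<close>, for the row with entries \<open>p\<close> and \<open>q\<close>.\<close>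

definition comm1 :: "real \<Rightarrow> complex poly \<Rightarrow> complex poly \<Rightarrow> complex poly" where
  "comm1 a p q = 2 * ((1 - polyA a * polyX) * pderiv p - pderiv q) - (2 * polyA a + 2 * polyX) * p"

definition comm2 :: "real \<Rightarrow> complex poly \<Rightarrow> complex poly \<Rightarrow> complex poly" where
  "comm2 a p q = 2 * ((polyA a * polyA a * polyX * polyX - 1) * pderiv p + (1 + polyA a * polyX) * pderiv q)
    + (2 * polyA a + 2 * (2 + polyA a * polyA a) * polyX) * p - 2 * polyX * q"

text \<open>The two entries of the row times \<open>F\<^sub>2\<close>, which is half of the second commutator.\<close>

definition lead1 :: "real \<Rightarrow> complex poly \<Rightarrow> complex poly \<Rightarrow> complex poly" where
  "lead1 a p q = (1 - polyA a * polyX) * p - q"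

definition lead2 :: "real \<Rightarrow> complex poly \<Rightarrow> complex poly \<Rightarrow> complex poly" where
  "lead2 a p q = (polyA a * polyA a * polyX * polyX - 1) * p + (1 + polyA a * polyX) * q"

lemma row_op_X:
  "row_op1 a (polyX * p) (polyX * q) = polyX * row_op1 a p q + comm1 a p q"
  "row_op2 a (polyX * p) (polyX * q) = polyX * row_op2 a p q + comm2 a p q"
  unfolding row_op1_def row_op2_def comm1_def comm2_def pderiv_mult pderiv_add pderiv_consts pderiv_one
  by algebra+

lemma comm_X:
  "comm1 a (polyX * p) (polyX * q) = polyX * comm1 a p q + 2 * lead1 a p q"
  "comm2 a (polyX * p) (polyX * q) = polyX * comm2 a p q + 2 * lead2 a p q"
  unfolding comm1_def comm2_def lead1_def lead2_def pderiv_mult pderiv_consts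
  by algebra+

lemma mom_numeral:
  assumes "moment_matrix W" shows "mom W i j (numeral k * p) = numeral k * mom W i j p"
  using mom_smult[OF assms, of i j "numeral k" p] by (simp add: numeral_poly)

lemma first_commutator:
  assumes W: "moment_matrix W" and sym: "\<And>p1 p2 q1 q2. defect a W p1 p2 q1 q2 = 0"
  shows "mom W 1 1 (comm1 a p1 p2 * q1 + p1 * comm1 a q1 q2) + mom W 1 2 (comm1 a p1 p2 * q2 + p1 * comm2 a q1 q2)
    + mom W 2 1 (comm2 a p1 p2 * q1 + p2 * comm1 a q1 q2) + mom W 2 2 (comm2 a p1 p2 * q2 + p2 * comm2 a q1 q2) = 0"
    (is "?T = 0")
proof -
  have m: "mom W i j (D * (polyX * v) - u * (polyX * E + e)) - mom W i j ((polyX * D + d) * v - polyX * u * E)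
    = - mom W i j (d * v + u * e)" for i j D u v d E e
  proof -
    have "D * (polyX * v) - u * (polyX * E + e) - ((polyX * D + d) * v - polyX * u * E) = - (d * v + u * e)"
      by algebra
    then show ?thesis unfolding mom_diff[OF W, symmetric] mom_minus[OF W, symmetric] by (rule arg_cong)
  qed
  have gen: "(A1 + A2 + A3 + A4) - (B1 + B2 + B3 + B4) = - (C1 + C2 + C3 + C4)"
    if "A1 - B1 = - C1" "A2 - B2 = - C2" "A3 - B3 = - C3" "A4 - B4 = - C4" for A1 A2 A3 A4 B1 B2 B3 B4 C1 C2 C3 C4 :: complex
    using that by algebra
  have "defect a W p1 p2 (polyX * q1) (polyX * q2) - defect a W (polyX * p1) (polyX * p2) q1 q2 = - ?T"
    unfolding defect_def row_op_X by (rule gen; rule m)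
  then have "0 - 0 = - ?T" unfolding sym .
  then show ?thesis by algebra
qed

lemma second_commutator:
  assumes W: "moment_matrix W" and sym: "\<And>p1 p2 q1 q2. defect a W p1 p2 q1 q2 = 0"
  shows "mom W 1 1 (lead1 a p1 p2 * q1 - p1 * lead1 a q1 q2) + mom W 1 2 (lead1 a p1 p2 * q2 - p1 * lead2 a q1 q2)
    + mom W 2 1 (lead2 a p1 p2 * q1 - p2 * lead1 a q1 q2) + mom W 2 2 (lead2 a p1 p2 * q2 - p2 * lead2 a q1 q2) = 0"
    (is "?T = 0")
proof -
  have m: "mom W i j ((polyX * d + 2 * f) * v + polyX * u * e) - mom W i j (d * (polyX * v) + u * (polyX * e + 2 * g))
    = 2 * mom W i j (f * v - u * g)" for i j d f u v e g
  proof -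
    have "(polyX * d + 2 * f) * v + polyX * u * e - (d * (polyX * v) + u * (polyX * e + 2 * g)) = 2 * (f * v - u * g)"
      by algebra
    then show ?thesis unfolding mom_diff[OF W, symmetric] mom_numeral[OF W, symmetric] by (rule arg_cong)
  qed
  have gen: "C1 + C2 + C3 + C4 = 0"
    if "A1 + A2 + A3 + A4 = 0" "B1 + B2 + B3 + B4 = 0"
      "A1 - B1 = 2 * C1" "A2 - B2 = 2 * C2" "A3 - B3 = 2 * C3" "A4 - B4 = 2 * C4" for A1 A2 A3 A4 B1 B2 B3 B4 C1 C2 C3 C4 :: complex
  proof -
    have "2 * (C1 + C2 + C3 + C4) = 0" using that by algebra
    then show ?thesis by (metis mult_eq_0_iff zero_neq_numeral)
  qed
  show ?thesis
    by (rule gen[OF first_commutator[OF W sym, of "polyX * p1" "polyX * p2" q1 q2, unfolded comm_X]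
      first_commutator[OF W sym, of p1 p2 "polyX * q1" "polyX * q2", unfolded comm_X]]; rule m)
qed

text \<open>Evaluated at the rows \<open>(0, r)\<close> or \<open>(r, 0)\<close> and \<open>(0, 1)\<close>, the commutator relations determine the moment
  functionals up to two constants.\<close>

lemma symmetric_moments:
  assumes W: "moment_matrix W" and sym: "\<And>p1 p2 q1 q2. defect a W p1 p2 q1 q2 = 0"
  obtains g c where
    "\<And>i j p. mom W i j p = g * gauss_mom (weight_poly a $ i $ j * p) + c * poly p 0"
proof -
  define A where "A = polyA a"
  note linear = mom_add[OF W] mom_diff[OF W] mom_minus[OF W] mom_numeral[OF W] mom_0[OF W]
  have Y': "mom W 2 1 r = mom W 1 2 r" for r
  proof -
    have "lead1 a 0 r * 0 - 0 * lead1 a 0 1 = 0" "lead1 a 0 r * 1 - 0 * lead2 a 0 1 = - r"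
      "lead2 a 0 r * 0 - r * lead1 a 0 1 = r" "lead2 a 0 r * 1 - r * lead2 a 0 1 = 0"
      unfolding lead1_def lead2_def by (algebra | simp add: algebra_simps)+
    then show ?thesis using second_commutator[OF W sym, of 0 r 0 1] by (simp only: linear) simp
  qed
  have X: "mom W 1 1 r = mom W 1 2 (2 * (A * polyX * r)) + mom W 2 2 ((1 - A * polyX * (A * polyX)) * r)" for r
  proof -
    have e: "lead1 a r 0 * 0 - r * lead1 a 0 1 = r" "lead1 a r 0 * 1 - r * lead2 a 0 1 = - (2 * (A * polyX * r))"
      "lead2 a r 0 * 0 - 0 * lead1 a 0 1 = 0" "lead2 a r 0 * 1 - 0 * lead2 a 0 1 = - ((1 - A * polyX * (A * polyX)) * r)"
      unfolding lead1_def lead2_def A_def by (algebra | simp add: algebra_simps)+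
    have "mom W 1 1 r + - mom W 1 2 (2 * (A * polyX * r)) + 0 + - mom W 2 2 ((1 - A * polyX * (A * polyX)) * r) = 0"
      using second_commutator[OF W sym, of r 0 0 1] unfolding e mom_minus[OF W] mom_0[OF W] .
    then show ?thesis by algebra
  qed
  define U where "U p = mom W 1 2 p - mom W 2 2 (A * polyX * p)" for p
  have rel: "mom W 2 2 (pderiv r) - U (pderiv r) = 2 * mom W 2 2 (polyX * r)" for r
  proof -
    have e: "comm1 a 0 r * 0 + 0 * comm1 a 0 1 = 0" "comm1 a 0 r * 1 + 0 * comm2 a 0 1 = - (2 * pderiv r)"
      "comm2 a 0 r * 0 + r * comm1 a 0 1 = 0"
      "comm2 a 0 r * 1 + r * comm2 a 0 1 = 2 * pderiv r + 2 * (A * polyX * pderiv r) - 4 * (polyX * r)"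
      unfolding comm1_def comm2_def A_def pderiv_one pderiv_0 by (algebra | simp add: algebra_simps)+
    have "0 + - (2 * mom W 1 2 (pderiv r)) + 0 + (2 * mom W 2 2 (pderiv r) + 2 * mom W 2 2 (A * polyX * pderiv r)
      - 4 * mom W 2 2 (polyX * r)) = 0"
      using first_commutator[OF W sym, of 0 r 0 1] unfolding e linear .
    then have "2 * (mom W 2 2 (pderiv r) - U (pderiv r)) = 2 * (2 * mom W 2 2 (polyX * r))"
      unfolding U_def by algebra
    then show ?thesis by (metis mult_cancel_left zero_neq_numeral)
  qed
  \<comment> \<open>The remaining first order relation, from which \<open>rel\<close> with \<open>s = (1 - at) r\<close> removes all but \<open>t U\<close>.\<close>
  have UX: "U (polyX * r) = 0" for r
  proof -
    let ?s = "(1 - A * polyX) * r"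
    have ds: "pderiv ?s = (1 - A * polyX) * pderiv r - A * r"
      unfolding A_def pderiv_mult pderiv_diff pderiv_one pderiv_consts by algebra
    have e: "comm1 a r 0 * 0 + r * comm1 a 0 1 = 0" "comm1 a r 0 * 1 + r * comm2 a 0 1 = 2 * pderiv ?s - 4 * (polyX * r)"
      "comm2 a r 0 * 0 + 0 * comm1 a 0 1 = 0"
      "comm2 a r 0 * 1 + 0 * comm2 a 0 1 = 4 * (A * polyX * (polyX * r)) + 4 * (polyX * ?s) - 2 * pderiv ?s - 2 * (A * polyX * pderiv ?s)"
      unfolding ds unfolding comm1_def comm2_def A_def pderiv_one pderiv_0 by (algebra | simp add: algebra_simps)+
    have "0 + (2 * mom W 1 2 (pderiv ?s) - 4 * mom W 1 2 (polyX * r)) + 0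
      + (4 * mom W 2 2 (A * polyX * (polyX * r)) + 4 * mom W 2 2 (polyX * ?s) - 2 * mom W 2 2 (pderiv ?s) - 2 * mom W 2 2 (A * polyX * pderiv ?s)) = 0"
      using first_commutator[OF W sym, of r 0 0 1] unfolding e
      unfolding mom_add[OF W, of 2 2 "4 * _"] mom_diff[OF W, of _ _ _ "2 * _"] mom_diff[OF W, of _ _ _ "4 * _"] mom_numeral[OF W] mom_0[OF W] .
    then have "4 * U (polyX * r) = 0" using rel[of ?s] unfolding U_def by algebra
    then show ?thesis by (metis mult_eq_0_iff zero_neq_numeral)
  qed
  define c where "c = U 1"
  have U: "U p = c * poly p 0" for p
  proof -
    obtain b r where p: "p = pCons b r" by (cases p)
    have "U p = U (smult b 1 + polyX * r)" by (simp add: p)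
    also have "\<dots> = b * U 1 + U (polyX * r)"
      unfolding U_def distrib_left mult_smult_right mom_add[OF W] mom_smult[OF W] by algebra
    also have "\<dots> = c * poly p 0" unfolding UX c_def by (simp add: p)
    finally show ?thesis .
  qed
  define g where "g = (mom W 2 2 1 - c) / gauss_mom 1"
  have Z: "mom W 2 2 p = g * gauss_mom p + c * poly p 0" for p
  proof -
    define N where "N p = mom W 2 2 p - c * poly p 0 - g * gauss_mom p" for p
    have "N p = 0"
    proof (rule gauss_mom_relation_eq_0)
      show "N (p + q) = N p + N q" for p q
        by (simp add: N_def mom_add[OF W] gauss_mom_add algebra_simps)
      show "N (smult b p) = b * N p" for b p
        by (simp add: N_def mom_smult[OF W] gauss_mom_smult algebra_simps)
      show "N 1 = 0" by (simp add: N_def g_def gauss_mom_1)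
      fix r
      have "poly (polyX * r) 0 = 0" by simp
      then show "N (pderiv r) = 2 * N (polyX * r)"
        using rel[of r] unfolding N_def U gauss_mom_pderiv by algebra
    qed
    then show ?thesis unfolding N_def by algebra
  qed
  have Y: "mom W 1 2 p = g * gauss_mom (A * polyX * p) + c * poly p 0" for p
  proof -
    have "poly (A * polyX * p) 0 = 0" by simp
    then show ?thesis using U[of p] unfolding U_def Z by algebra
  qed
  have X': "mom W 1 1 p = g * gauss_mom ((1 + A * polyX * (A * polyX)) * p) + c * poly p 0" for p
  proof -
    have e: "A * polyX * (2 * (A * polyX * p)) + (1 - A * polyX * (A * polyX)) * p = (1 + A * polyX * (A * polyX)) * p"
      by algebra
    have "poly (2 * (A * polyX * p)) 0 = 0" "poly ((1 - A * polyX * (A * polyX)) * p) 0 = poly p 0" by simp_all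
    then show ?thesis unfolding X Y Z e[symmetric] gauss_mom_add by algebra
  qed
  have "\<forall>i j. mom W i j p = g * gauss_mom (weight_poly a $ i $ j * p) + c * poly p 0" for p
    unfolding forall_2 weight_poly_nth A_def[symmetric] mult_1_left using X' Y Z by (simp only: Y')
  then show ?thesis using that by blast
qed


section \<open>Identification of the weight matrices\<close>

lemma gauss_mom_polyX: "gauss_mom polyX = 0" "gauss_mom (polyX * polyX) = of_real (sqrt pi / 2)"
  using gauss_mom_pderiv[of 1] gauss_mom_pderiv[of polyX] unfolding pderiv_one pderiv_consts gauss_mom_1
  by (simp_all add: gauss_mom_0)

lemma Upsilon_Da_imp:
  assumes a: "a \<noteq> 0" and W: "W \<in> Upsilon (Da a)"
  shows "\<exists>\<gamma> \<zeta>. W = Wa_dirac a \<gamma> \<zeta> \<and> \<gamma> > 0 \<and> \<zeta> \<ge> 0"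
proof -
  have w: "weight_matrix W" and s: "symmetric_wrt (Da a) W" using W by (simp_all add: Upsilon_def)
  note m = weight_matrix_imp_moment_matrix[OF w]
  obtain g c where mom: "\<And>i j p. mom W i j p = g * gauss_mom (weight_poly a $ i $ j * p) + c * poly p 0"
    using symmetric_moments[OF m] s[unfolded symmetric_iff_defect[OF a m]] by metis
  define \<gamma> \<zeta> where "\<gamma> = Re g" and "\<zeta> = Re c"
  have diag: "mom W i i p = (LINT t|part W i i 0. poly p (of_real t))" for i p by (rule mom_diag[OF m])
  \<comment> \<open>The total mass of \<open>W\<^sub>1\<^sub>2\<close> is \<open>c\<close>, since the Gaussian part of \<open>W\<^sub>1\<^sub>2\<close> is odd.\<close>
  have c: "c = of_real \<zeta>"
  proof -
    have z: "gauss_mom (weight_poly a $ i $ j * 1) = 0" if "i \<noteq> j" for i j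
    proof -
      have "gauss_mom (polyA a * polyX * 1) = 0"
        using gauss_mom_smult[of "of_real a" polyX] gauss_mom_polyX by (simp add: polyA_def)
      moreover have "\<forall>i j. i \<noteq> j \<longrightarrow> weight_poly a $ i $ j = polyA a * polyX"
        unfolding forall_2 weight_poly_nth by simp
      ultimately show ?thesis using that by metis
    qed
    have "mom W 1 2 1 = c" "mom W 2 1 1 = c" unfolding mom by (simp_all add: z del: mult_1_right)
    then have "c = cnj c" using mom_cnj[OF m, of 2 1 1] cnj_poly_consts(4) by simp
    then show ?thesis by (simp add: \<zeta>_def complex_eq_iff)
  qed
  have g: "g = of_real \<gamma>"
  proof -
    have "g * of_real (sqrt pi) = mom W 2 2 1 - c"
      unfolding mom weight_poly_nth by (simp add: gauss_mom_1)
    also have "\<dots> = of_real ((LINT t|part W 2 2 0. 1) - \<zeta>)"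
      using integral_complex_of_real[of "part W 2 2 0" "\<lambda>_. 1"] unfolding diag c
      by (simp del: lebesgue_integral_const integral_complex_of_real)
    finally have "g = of_real (((LINT t|part W 2 2 0. 1) - \<zeta>) / sqrt pi)"
      by (simp add: field_simps)
    then show ?thesis unfolding \<gamma>_def by (metis Re_complex_of_real)
  qed
  have "0 \<le> \<gamma>"
  proof -
    have "poly (polyX * polyX) (of_real t) = complex_of_real (t * t)" for t by simp
    then have "mom W 2 2 (polyX * polyX) = of_real (LINT t|part W 2 2 0. t * t)"
      unfolding diag by (simp only: integral_complex_of_real)
    moreover have "mom W 2 2 (polyX * polyX) = of_real (\<gamma> * (sqrt pi / 2))"
      unfolding mom weight_poly_nth mult_1_left gauss_mom_polyX g by simp
    ultimately have "\<gamma> * (sqrt pi / 2) = (LINT t|part W 2 2 0. t * t)"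
      by (metis of_real_eq_iff)
    also have "\<dots> \<ge> 0" by (rule Bochner_Integration.integral_nonneg) simp
    finally show ?thesis using pi_gt_zero by (simp add: zero_le_mult_iff not_le)
  qed
  \<comment> \<open>Otherwise \<open>\<integral> t\<^sup>2 dW = 0\<close>, which is excluded by nonsingularity for \<open>P = t I\<close>.\<close>
  moreover have "\<gamma> \<noteq> 0"
  proof
    assume "\<gamma> = 0"
    define P :: "2 matpoly" where "P = mat22 polyX 0 0 polyX"
    have "\<forall>i j. poly (P $ i $ j) 0 = 0" by (simp add: P_def forall_2)
    then have "mint W P P = 0"
      by (simp add: vec_eq_iff mint_eq mom g \<open>\<gamma> = 0\<close>)
    moreover have "mp_monic 1 P"
    proof -
      have "\<forall>i j. mp_coeff P 1 $ i $ j = mat 1 $ i $ j"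
        unfolding forall_2 mp_coeff_nth P_def mat_def by simp
      moreover have "\<forall>i j. mp_coeff P k $ i $ j = 0" if "Suc 1 \<le> k" for k
        unfolding forall_2 mp_coeff_nth P_def using that by (simp add: coeff_pCons split: nat.split)
      ultimately show ?thesis unfolding mp_monic_def mp_degree_less_def by (simp add: vec_eq_iff)
    qed
    ultimately have "invertible (0 :: complex^2^2)" using invertible_mint_monic[OF w] by metis
    then have "(mat 1 :: complex^2^2) = 0" by (rule invertible_mult_eq_0) simp
    then show False using mat_1_neq_0 by blast
  qed
  ultimately have \<gamma>: "0 < \<gamma>" by simp
  have part: "finite_borel_measure (part W 2 2 0)"
    by (rule part_measure) (simp_all add: moment_matrixD[OF m])
  \<comment> \<open>Otherwise \<open>W\<^sub>2\<^sub>2 + \<bar>\<zeta>\<bar> \<delta>\<^sub>0\<close> would have the moments of a Gaussian density, which has no atom at \<open>0\<close>.\<close>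
  have \<zeta>: "0 \<le> \<zeta>"
  proof (rule ccontr)
    assume neg: "\<not> 0 \<le> \<zeta>"
    let ?A = "add_measure (part W 2 2 0) (point_mass (- \<zeta>))"
    let ?B = "density lborel (\<lambda>t. ennreal (\<gamma> * exp (- t\<^sup>2)))"
    have pm: "finite_borel_measure (point_mass (- \<zeta>))" using neg by (intro point_mass) simp
    have gi: "integrable lborel (\<lambda>t. \<gamma> * exp (- t\<^sup>2))"
      using integrable_mult_right[OF integrable_gauss_power[of 0], of \<gamma>] by simp
    have B: "finite_borel_measure ?B"
      using \<gamma> gi by (intro density_lborel) auto
    have iA: "integrable ?A (\<lambda>t. t ^ n)" for n
      using neg by (intro integrable_add_measure part pm moment_matrixD[OF m] point_mass_integral) auto
    have "?A = ?B"
    proof (rule moment_determinacy[OF add_measure(1)[OF part pm] B iA])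
      fix n
      have "(LINT t|?A. t ^ n) = (LINT t|part W 2 2 0. t ^ n) + (LINT t|point_mass (- \<zeta>). t ^ n)"
        using add_measure_integral[OF part pm iA] by blast
      also have "(LINT t|point_mass (- \<zeta>). t ^ n) = - \<zeta> * 0 ^ n"
        using neg by (subst point_mass_integral) auto
      also have "(LINT t|part W 2 2 0. t ^ n) = Re (mom W 2 2 (monom 1 n))"
        by (subst part_moment[OF m]) simp_all
      also have "\<dots> = \<gamma> * (LINT t|lborel. exp (- t\<^sup>2) * t ^ n) + \<zeta> * 0 ^ n"
        unfolding mom weight_poly_nth mult_1_left gauss_mom_monom g c poly_monom
        by (cases n) simp_all
      finally have A: "(LINT t|?A. t ^ n) = \<gamma> * (LINT t|lborel. exp (- t\<^sup>2) * t ^ n)" by simp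
      have "(LINT t|?B. t ^ n) = (LINT t|lborel. (\<gamma> * exp (- t\<^sup>2)) *\<^sub>R t ^ n)"
        using \<gamma> by (intro integral_density) auto
      also have "\<dots> = \<gamma> * (LINT t|lborel. exp (- t\<^sup>2) * t ^ n)" by (simp add: mult.assoc)
      finally show "(LINT t|?A. t ^ n) = (LINT t|?B. t ^ n)" using A by simp
    next
      fix u
      have "integrable lborel (\<lambda>t. \<gamma> * (exp (- t\<^sup>2) * (t ^ 0 * exp (u * \<bar>t\<bar>))))"
        by (intro integrable_mult_right integrable_gauss)
      then have "integrable lborel (\<lambda>t. (\<gamma> * exp (- t\<^sup>2)) *\<^sub>R exp (u * \<bar>t\<bar>))"
        by (simp add: mult.assoc)
      then show "integrable ?B (\<lambda>t. exp (u * \<bar>t\<bar>))"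
        using \<gamma> by (intro integrable_density[THEN iffD2]) auto
    qed
    then have "measure (part W 2 2 0) {0} + measure (point_mass (- \<zeta>)) {0} = measure ?B {0}"
      using add_measure(2)[OF part pm, of "{0}"] by simp
    also have "measure ?B {0} = 0"
    proof -
      have "AE t in lborel. t \<noteq> (0::real)" by (rule AE_lborel_singleton)
      then have "AE t in lborel. indicator {0::real} t *\<^sub>R (\<gamma> * exp (- t\<^sup>2)) = 0"
        by eventually_elim simp
      then have "(LINT t:{0}|lborel. \<gamma> * exp (- t\<^sup>2)) = 0"
        unfolding set_lebesgue_integral_def by (rule integral_eq_zero_AE)
      then show ?thesis using density_lborel(2)[OF _ _ gi, of "{0}"] \<gamma> by simp
    qed
    also have "measure (point_mass (- \<zeta>)) {0} = - \<zeta>" using neg by (subst point_mass) auto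
    finally show False using neg measure_nonneg[of "part W 2 2 0" "{0}"] by linarith
  qed
  have "W = Wa_dirac a \<gamma> \<zeta>"
  proof (rule moment_matrix_eqI[OF m moment_matrix_Wa_dirac])
    show "mom W i j (monom 1 n) = mom (Wa_dirac a \<gamma> \<zeta>) i j (monom 1 n)" for i j n
      unfolding mom mom_Wa_dirac[OF \<zeta>] g c ..
    show "integrable (part (Wa_dirac a \<gamma> \<zeta>) i i 0) (\<lambda>t. exp (u * \<bar>t\<bar>))" for i u
      using integrable_part_Wa_dirac[of \<gamma> \<zeta> a i 0 u] \<gamma> \<zeta> by simp
  qed (use \<gamma> \<zeta> in simp_all)
  then show ?thesis using \<gamma> \<zeta> by blast
qed

lemma Upsilon_Da:
  assumes a: "a \<noteq> 0"
  shows "Upsilon (Da a) = {Wa_dirac a \<gamma> \<zeta> | \<gamma> \<zeta>. \<gamma> > 0 \<and> \<zeta> \<ge> 0}"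
proof (intro equalityI subsetI)
  fix W assume "W \<in> Upsilon (Da a)"
  then show "W \<in> {Wa_dirac a \<gamma> \<zeta> | \<gamma> \<zeta>. \<gamma> > 0 \<and> \<zeta> \<ge> 0}" using Upsilon_Da_imp[OF a] by blast
next
  fix W assume "W \<in> {Wa_dirac a \<gamma> \<zeta> | \<gamma> \<zeta>. \<gamma> > 0 \<and> \<zeta> \<ge> 0}"
  then obtain \<gamma> \<zeta> where "W = Wa_dirac a \<gamma> \<zeta>" "0 < \<gamma>" "0 \<le> \<zeta>" by blast
  then show "W \<in> Upsilon (Da a)"
    by (simp add: Upsilon_def weight_matrix_Wa_dirac symmetric_Wa_dirac[OF a])
qed

text \<open>Only the ratio \<open>\<zeta> / \<gamma>\<close> matters for orthogonality.\<close>

lemma monic_orthogonal_Wa_dirac_scale: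
  assumes \<gamma>: "0 < \<gamma>" and \<zeta>: "0 \<le> \<zeta>"
  shows "monic_orthogonal (Wa_dirac a \<gamma> \<zeta>) P \<longleftrightarrow> monic_orthogonal (Wa_dirac a 1 (\<zeta> / \<gamma>)) P"
proof -
  have r: "0 \<le> \<zeta> / \<gamma>" using \<gamma> \<zeta> by simp
  have mom: "mom (Wa_dirac a \<gamma> \<zeta>) i j p = \<gamma> * mom (Wa_dirac a 1 (\<zeta> / \<gamma>)) i j p" for i j p
    unfolding mom_Wa_dirac[OF \<zeta>] mom_Wa_dirac[OF r] using \<gamma> by (simp add: field_simps)
  have "mint (Wa_dirac a \<gamma> \<zeta>) P Q $ i $ j = \<gamma> * mint (Wa_dirac a 1 (\<zeta> / \<gamma>)) P Q $ i $ j" for P Q i j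
    unfolding mint_eq mom sum_distrib_left ..
  then have "mint (Wa_dirac a \<gamma> \<zeta>) P Q = 0 \<longleftrightarrow> mint (Wa_dirac a 1 (\<zeta> / \<gamma>)) P Q = 0" for P Q
    using \<gamma> by (simp add: vec_eq_iff)
  then show ?thesis unfolding monic_orthogonal_iff by simp
qed

theorem mainTheorem2:
  fixes a :: real
  assumes "a \<noteq> 0"
  shows "Upsilon (Da a) = {Wa_dirac a \<gamma> \<zeta> | \<gamma> \<zeta>. \<gamma> > 0 \<and> \<zeta> \<ge> 0} \<and>
    (\<exists>P :: real \<Rightarrow> nat \<Rightarrow> 2 matpoly. \<forall>\<gamma>>0. \<forall>\<zeta>\<ge>0.
       (\<forall>Q. monic_orthogonal (Wa_dirac a \<gamma> \<zeta>) Q \<longleftrightarrow> Q = P (\<zeta> / \<gamma>)) \<and>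
       (\<forall>n. Da a (P (\<zeta> / \<gamma>) n) = mp_const (Gamma_na n a) ** P (\<zeta> / \<gamma>) n))"
proof (intro conjI)
  show "Upsilon (Da a) = {Wa_dirac a \<gamma> \<zeta> | \<gamma> \<zeta>. \<gamma> > 0 \<and> \<zeta> \<ge> 0}"
    by (rule Upsilon_Da) fact
  define P where "P r = (SOME P. monic_orthogonal (Wa_dirac a 1 r) P)" for r
  have P: "monic_orthogonal (Wa_dirac a 1 r) (P r)" if "0 \<le> r" for r
    unfolding P_def using someI_ex[OF monic_orthogonal_exists[OF weight_matrix_Wa_dirac[of 1 r a]]] that by simp
  show "\<exists>P :: real \<Rightarrow> nat \<Rightarrow> 2 matpoly. \<forall>\<gamma>>0. \<forall>\<zeta>\<ge>0.
       (\<forall>Q. monic_orthogonal (Wa_dirac a \<gamma> \<zeta>) Q \<longleftrightarrow> Q = P (\<zeta> / \<gamma>)) \<and>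
       (\<forall>n. Da a (P (\<zeta> / \<gamma>) n) = mp_const (Gamma_na n a) ** P (\<zeta> / \<gamma>) n)"
  proof (intro exI[of _ P] allI impI conjI)
    fix \<gamma> \<zeta> :: real assume \<gamma>: "0 < \<gamma>" and \<zeta>: "0 \<le> \<zeta>"
    note W = weight_matrix_Wa_dirac[OF \<gamma> \<zeta>, of a]
    have PW: "monic_orthogonal (Wa_dirac a \<gamma> \<zeta>) (P (\<zeta> / \<gamma>))"
      unfolding monic_orthogonal_Wa_dirac_scale[OF \<gamma> \<zeta>] using \<gamma> \<zeta> by (intro P) simp
    show "monic_orthogonal (Wa_dirac a \<gamma> \<zeta>) Q \<longleftrightarrow> Q = P (\<zeta> / \<gamma>)" for Q
      using monic_orthogonal_unique[OF W _ PW] PW by blast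
    fix n
    have "symmetric_wrt (Da a) (Wa_dirac a \<gamma> \<zeta>)"
      using symmetric_Wa_dirac[OF assms, of \<gamma> \<zeta>] \<gamma> \<zeta> by simp
    from symmetric_imp_eigenfunction[OF W PW this Da_degree[OF assms], of n]
    show "Da a (P (\<zeta> / \<gamma>) n) = mp_const (Gamma_na n a) ** P (\<zeta> / \<gamma>) n"
      using Da_lead_coeff[OF assms, of n "P (\<zeta> / \<gamma>) n"] PW unfolding monic_orthogonal_iff by simp
  qed
qed

end
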